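(* For each $n\ge 1$, the action of $G$ on $\mathcal{C}_n$ is doubly transitive; that is, for any two pairs $(p_1,p_2)$, $(q_1,q_2)$ of points of $\mathcal{C}_n$ with $p_1\ne p_2$ and $q_1\neq q_2$ there is $g\in G$ with $g\,p_1=q_1$ and $g\,p_2=q_2$.
   Context: $R=\mathbb{C}\langle x,y\rangle$ is the free associative $\mathbb{C}$-algebra on $x,y$, and $G$ is the group of all $\mathbb{C}$-algebra automorphisms $\sigma$ of $R$ with $\sigma([x,y])=[x,y]$, where $[x,y]=xy-yx$. For $n\ge 1$, $\tilde{\mathcal{C}}_n$ is the set of pairs $(X,Y)$ of complex $n\times n$ matrices with $\mathrm{rank}([X,Y]+I_n)=1$, and $\mathcal{C}_n=\tilde{\mathcal{C}}_n/\mathrm{PGL}_n(\mathbb{C})$ is its quotient by simultaneous conjugation (the $n$-th Calogero-Moser space). The group $G$ acts on $\mathcal{C}_n$ by $\sigma\cdot(X,Y)=(\sigma^{-1}(X),\sigma^{-1}(Y))$, where for $\tau\in G$ the matrices $\tau(X),\tau(Y)$ are obtained by substituting $x=X$, $y=Y$ into the noncommutative polynomials $\tau(x),\tau(y)$. *)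

theory Defs
  imports
    "HOL-Library.Poly_Mapping"
    "Jordan_Normal_Form.DL_Rank"
begin

text \<open>
  The free associative algebra on two letters is the monoid algebra over the free monoid of words.
  The type of finitely supported functions carries the convolution product as soon as the index
  type is an additive monoid, so words get concatenation as their (noncommutative) addition.
\<close>

datatype letter = LetterX | LetterY

instantiation list :: (type) monoid_add
begin

definition zero_list_def: "0 = ([] :: 'a list)"
definition plus_list_def: "u + v = (u @ v :: 'a list)"

instance
  by standard (simp_all add: zero_list_def plus_list_def)

end

type_synonym free_alg = "letter list \<Rightarrow>\<^sub>0 complex"

definition gen :: "letter \<Rightarrow> free_alg" where
  "gen a = Poly_Mapping.single [a] 1"

text \<open>The embedding of the scalars; multiplying by it is scalar multiplication.\<close>

definition const :: "complex \<Rightarrow> free_alg" where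
  "const c = Poly_Mapping.single [] c"

definition commutator :: "'a::ring \<Rightarrow> 'a \<Rightarrow> 'a" where
  "commutator a b = a * b - b * a"

definition algebra_automorphism :: "(free_alg \<Rightarrow> free_alg) \<Rightarrow> bool" where
  "algebra_automorphism \<sigma> \<longleftrightarrow>
     bij \<sigma> \<and> \<sigma> 1 = 1 \<and>
     (\<forall>p q. \<sigma> (p + q) = \<sigma> p + \<sigma> q) \<and>
     (\<forall>p q. \<sigma> (p * q) = \<sigma> p * \<sigma> q) \<and>
     (\<forall>c p. \<sigma> (const c * p) = const c * \<sigma> p)"

definition autG :: "(free_alg \<Rightarrow> free_alg) set" where
  "autG = {\<sigma>. algebra_automorphism \<sigma> \<and>
     \<sigma> (commutator (gen LetterX) (gen LetterY)) = commutator (gen LetterX) (gen LetterY)}"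

fun word_mat :: "nat \<Rightarrow> complex mat \<times> complex mat \<Rightarrow> letter list \<Rightarrow> complex mat" where
  "word_mat n XY [] = 1\<^sub>m n"
| "word_mat n XY (LetterX # w) = fst XY * word_mat n XY w"
| "word_mat n XY (LetterY # w) = snd XY * word_mat n XY w"

text \<open>Substitution of a pair of matrices into a noncommutative polynomial; the sum of matrices
  is taken entrywise because matrices of unspecified dimension do not form an additive monoid.\<close>

definition eval_mat :: "nat \<Rightarrow> complex mat \<times> complex mat \<Rightarrow> free_alg \<Rightarrow> complex mat" where
  "eval_mat n XY p = mat n n (\<lambda>ij. \<Sum>w\<in>Poly_Mapping.keys p.
     Poly_Mapping.lookup p w * word_mat n XY w $$ ij)"

definition CM_pairs :: "nat \<Rightarrow> (complex mat \<times> complex mat) set" where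
  "CM_pairs n = {(X, Y). X \<in> carrier_mat n n \<and> Y \<in> carrier_mat n n \<and>
     vec_space.rank n ((X * Y - Y * X) + 1\<^sub>m n) = 1}"

text \<open>Orbits of \<open>PGL\<^sub>n\<close> are orbits of \<open>GL\<^sub>n\<close>, as scalar matrices act trivially.  In
  \<^term>\<open>similar_mat_wit A B P Q\<close> the matrices \<open>P\<close> and \<open>Q\<close> are mutually inverse and
  \<open>A = P * B * Q\<close>; the same \<open>P\<close> conjugates both components.\<close>

definition CM_rel :: "nat \<Rightarrow> ((complex mat \<times> complex mat) \<times> (complex mat \<times> complex mat)) set" where
  "CM_rel n = {((X, Y), (X', Y')). (X, Y) \<in> CM_pairs n \<and> (X', Y') \<in> CM_pairs n \<and>
     (\<exists>P Q. similar_mat_wit X' X P Q \<and> similar_mat_wit Y' Y P Q)}"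

definition CM_space :: "nat \<Rightarrow> (complex mat \<times> complex mat) set set" where
  "CM_space n = CM_pairs n // CM_rel n"

definition subst_pair ::
  "nat \<Rightarrow> (free_alg \<Rightarrow> free_alg) \<Rightarrow> complex mat \<times> complex mat \<Rightarrow> complex mat \<times> complex mat" where
  "subst_pair n \<tau> XY = (eval_mat n XY (\<tau> (gen LetterX)), eval_mat n XY (\<tau> (gen LetterY)))"

definition CM_act ::
  "nat \<Rightarrow> (free_alg \<Rightarrow> free_alg) \<Rightarrow> (complex mat \<times> complex mat) set \<Rightarrow> (complex mat \<times> complex mat) set"
where
  "CM_act n \<sigma> p = (\<Union>XY\<in>p. CM_rel n `` {subst_pair n (inv_into UNIV \<sigma>) XY})"


subsection \<open>Well-definedness of the action\<close>

lemma one_eq_const: "1 = const 1"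
  by (simp add: const_def single_one zero_list_def[symmetric])

lemma const_mult_single: "const c * Poly_Mapping.single w d = Poly_Mapping.single w (c * d)"
  by (simp add: const_def mult_single plus_list_def)

lemma gen_mult_single: "gen a * Poly_Mapping.single w d = Poly_Mapping.single (a # w) d"
  by (simp add: gen_def mult_single plus_list_def)

lemma free_alg_single_induct [case_names single sum]:
  assumes "\<And>w c. P (Poly_Mapping.single w c)" and "\<And>p q. P p \<Longrightarrow> P q \<Longrightarrow> P (p + q)"
  shows "P (p :: free_alg)"
proof (induction p rule: update_induct)
  case const
  then show ?case using assms(1)[of "[]" 0] by simp
next
  case (update f a b)
  have "Poly_Mapping.update a b f = f + Poly_Mapping.single a b"
    using update(1)
    by (intro poly_mapping_eqI) (auto simp: lookup_update lookup_add lookup_single in_keys_iff when_def)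
  then show ?case using assms update by metis
qed

lemma free_alg_induct [case_names one add scale gen]:
  assumes "P 1" and "\<And>p q. P p \<Longrightarrow> P q \<Longrightarrow> P (p + q)"
    and "\<And>c p. P p \<Longrightarrow> P (const c * p)" and "\<And>a p. P p \<Longrightarrow> P (gen a * p)"
  shows "P (p :: free_alg)"
proof -
  have mono: "P (Poly_Mapping.single w 1)" for w
  proof (induction w)
    case Nil
    then show ?case using assms(1) by (simp add: one_eq_const const_def)
  next
    case (Cons a w)
    then show ?case using assms(4)[of _ a] by (metis gen_mult_single)
  qed
  have single: "P (Poly_Mapping.single w c)" for w c
    using assms(3)[OF mono[of w], of c] by (simp add: const_mult_single)
  show ?thesis
    by (induction p rule: free_alg_single_induct) (use single assms(2) in auto)
qed

lemma word_mat_carrier: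
  assumes "fst XY \<in> carrier_mat n n" "snd XY \<in> carrier_mat n n"
  shows "word_mat n XY w \<in> carrier_mat n n"
  using assms by (induction n XY w rule: word_mat.induct) auto

lemma eval_mat_carrier [simp]: "eval_mat n XY p \<in> carrier_mat n n"
  by (simp add: eval_mat_def)

lemma eval_mat_index:
  assumes "i < n" "j < n" "finite S" "Poly_Mapping.keys p \<subseteq> S"
  shows "eval_mat n XY p $$ (i, j) = (\<Sum>w\<in>S. Poly_Mapping.lookup p w * word_mat n XY w $$ (i, j))"
proof -
  have "(\<Sum>w\<in>Poly_Mapping.keys p. Poly_Mapping.lookup p w * word_mat n XY w $$ (i, j)) =
        (\<Sum>w\<in>S. Poly_Mapping.lookup p w * word_mat n XY w $$ (i, j))"
    by (rule sum.mono_neutral_left) (use assms in \<open>auto simp: in_keys_iff\<close>)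
  then show ?thesis using assms by (simp add: eval_mat_def)
qed

lemma eval_mat_add: "eval_mat n XY (p + q) = eval_mat n XY p + eval_mat n XY q"
proof (rule eq_matI)
  fix i j assume "i < dim_row (eval_mat n XY p + eval_mat n XY q)"
    and "j < dim_col (eval_mat n XY p + eval_mat n XY q)"
  then have ij: "i < n" "j < n" by (auto simp: eval_mat_def)
  let ?S = "Poly_Mapping.keys p \<union> Poly_Mapping.keys q"
  have S: "finite ?S" by simp
  show "eval_mat n XY (p + q) $$ (i, j) = (eval_mat n XY p + eval_mat n XY q) $$ (i, j)"
    using ij eval_mat_carrier[of n XY q] Poly_Mapping.keys_add[of p q]
    by (simp add: eval_mat_index[OF ij S] lookup_add sum.distrib algebra_simps del: eval_mat_carrier)
qed (auto simp: eval_mat_def)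

lemma eval_mat_single:
  assumes "fst XY \<in> carrier_mat n n" "snd XY \<in> carrier_mat n n"
  shows "eval_mat n XY (Poly_Mapping.single w c) = c \<cdot>\<^sub>m word_mat n XY w"
proof (rule eq_matI)
  fix i j assume "i < dim_row (c \<cdot>\<^sub>m word_mat n XY w)" "j < dim_col (c \<cdot>\<^sub>m word_mat n XY w)"
  then have ij: "i < n" "j < n" using word_mat_carrier[OF assms, of w] by auto
  show "eval_mat n XY (Poly_Mapping.single w c) $$ (i, j) = (c \<cdot>\<^sub>m word_mat n XY w) $$ (i, j)"
    using ij word_mat_carrier[OF assms, of w] eval_mat_index[OF ij, of "{w}" "Poly_Mapping.single w c" XY]
    by simp
qed (use word_mat_carrier[OF assms, of w] in \<open>auto simp: eval_mat_def\<close>)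

lemma eval_mat_const_mult:
  assumes "fst XY \<in> carrier_mat n n" "snd XY \<in> carrier_mat n n"
  shows "eval_mat n XY (const c * p) = c \<cdot>\<^sub>m eval_mat n XY p"
proof (induction p rule: free_alg_single_induct)
  case (single w d)
  then show ?case
    using word_mat_carrier[OF assms, of w]
    by (auto simp: const_mult_single eval_mat_single[OF assms] intro!: eq_matI)
next
  case (sum f g)
  then show ?case
    by (simp add: distrib_left eval_mat_add add_smult_distrib_left_mat[of _ n n])
qed

abbreviation letter_mat :: "complex mat \<times> complex mat \<Rightarrow> letter \<Rightarrow> complex mat" where
  "letter_mat XY a \<equiv> (case a of LetterX \<Rightarrow> fst XY | LetterY \<Rightarrow> snd XY)"

lemma eval_mat_gen_mult:
  assumes "fst XY \<in> carrier_mat n n" "snd XY \<in> carrier_mat n n"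
  shows "eval_mat n XY (gen a * p) = letter_mat XY a * eval_mat n XY p"
proof (induction p rule: free_alg_single_induct)
  case (single w d)
  have "letter_mat XY a \<in> carrier_mat n n" using assms by (cases a) auto
  then show ?case
    using word_mat_carrier[OF assms, of w]
    by (cases a) (auto simp: gen_mult_single eval_mat_single[OF assms] mult_smult_distrib)
next
  case (sum f g)
  have "letter_mat XY a \<in> carrier_mat n n" using assms by (cases a) auto
  then show ?case using sum
    by (simp add: distrib_left eval_mat_add mult_add_distrib_mat[of _ n n _ n])
qed

lemma eval_mat_one:
  assumes "fst XY \<in> carrier_mat n n" "snd XY \<in> carrier_mat n n"
  shows "eval_mat n XY 1 = 1\<^sub>m n"
proof -
  have "(1 :: complex) \<cdot>\<^sub>m 1\<^sub>m n = 1\<^sub>m n" by (rule eq_matI) auto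
  then show ?thesis
    using eval_mat_single[OF assms, of "[]" 1] by (simp add: one_eq_const const_def)
qed

lemma eval_mat_gen:
  assumes "fst XY \<in> carrier_mat n n" "snd XY \<in> carrier_mat n n"
  shows "eval_mat n XY (gen a) = letter_mat XY a"
  using eval_mat_gen_mult[OF assms, of a 1] assms
  by (cases a) (auto simp: eval_mat_one[OF assms])

lemma eval_mat_mult:
  assumes "fst XY \<in> carrier_mat n n" "snd XY \<in> carrier_mat n n"
  shows "eval_mat n XY (p * q) = eval_mat n XY p * eval_mat n XY q"
proof (induction p rule: free_alg_induct)
  case one
  then show ?case by (simp add: eval_mat_one[OF assms] left_mult_one_mat[of _ n n])
next
  case (add p p')
  then show ?case
    by (simp add: distrib_right eval_mat_add add_mult_distrib_mat[of _ n n _ _ n])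
next
  case (scale c p)
  then show ?case
    by (simp add: mult.assoc eval_mat_const_mult[OF assms] mult_smult_assoc_mat[of _ n n _ n])
next
  case (gen a p)
  have "letter_mat XY a \<in> carrier_mat n n" using assms by (cases a) auto
  with gen show ?case
    by (simp add: mult.assoc eval_mat_gen_mult[OF assms] assoc_mult_mat[of _ n n _ n _ n])
qed

lemma eval_mat_diff:
  assumes "fst XY \<in> carrier_mat n n" "snd XY \<in> carrier_mat n n"
  shows "eval_mat n XY (p - q) = eval_mat n XY p - eval_mat n XY q"
proof -
  have "eval_mat n XY p = eval_mat n XY (p - q) + eval_mat n XY q"
    by (simp flip: eval_mat_add)
  also have "\<dots> - eval_mat n XY q = eval_mat n XY (p - q)"
    by (intro eq_matI) (auto simp: eval_mat_def)
  finally show ?thesis by simp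
qed

lemma eval_mat_subst_pair:
  assumes "fst XY \<in> carrier_mat n n" "snd XY \<in> carrier_mat n n" "algebra_automorphism \<tau>"
  shows "eval_mat n (subst_pair n \<tau> XY) p = eval_mat n XY (\<tau> p)"
proof -
  have c: "fst (subst_pair n \<tau> XY) \<in> carrier_mat n n" "snd (subst_pair n \<tau> XY) \<in> carrier_mat n n"
    by (simp_all add: subst_pair_def)
  have l: "letter_mat (subst_pair n \<tau> XY) a = eval_mat n XY (\<tau> (gen a))" for a
    by (cases a) (simp_all add: subst_pair_def)
  have h: "\<tau> 1 = 1" "\<tau> (p + q) = \<tau> p + \<tau> q" "\<tau> (p * q) = \<tau> p * \<tau> q"
    "\<tau> (const k * p) = const k * \<tau> p" for p q k
    using assms(3) unfolding algebra_automorphism_def by blast+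
  show ?thesis
  proof (induction p rule: free_alg_induct)
    case one
    then show ?case by (simp add: h(1) eval_mat_one[OF c] eval_mat_one[OF assms(1,2)])
  next
    case (add p q)
    then show ?case by (simp add: h(2) eval_mat_add)
  next
    case (scale k p)
    then show ?case
      by (simp add: h(4) eval_mat_const_mult[OF c] eval_mat_const_mult[OF assms(1,2)])
  next
    case (gen a p)
    then show ?case
      by (simp add: h(3) eval_mat_gen_mult[OF c] l eval_mat_mult[OF assms(1,2)])
  qed
qed

lemma autG_inv:
  assumes "\<sigma> \<in> autG"
  shows "inv_into UNIV \<sigma> \<in> autG"
proof -
  let ?t = "inv_into UNIV \<sigma>"
  have b: "bij \<sigma>" using assms by (simp add: autG_def algebra_automorphism_def)
  have r: "\<sigma> (?t p) = p" for p using b by (simp add: bij_is_surj surj_f_inv_f)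
  have eq: "?t p = q" if "\<sigma> q = p" for p q using b that by (metis bij_is_inj inv_f_f)
  show ?thesis
    using assms b unfolding autG_def algebra_automorphism_def
    by (auto simp: bij_imp_bij_inv r intro!: eq)
qed

lemma autG_comp:
  assumes "\<sigma> \<in> autG" "\<tau> \<in> autG"
  shows "\<sigma> \<circ> \<tau> \<in> autG"
proof -
  have "\<sigma> (\<tau> (const c * p)) = const c * \<sigma> (\<tau> p)" for c p
    using assms unfolding autG_def algebra_automorphism_def mem_Collect_eq by metis
  moreover have "bij (\<sigma> \<circ> \<tau>)"
    using assms by (auto simp: autG_def algebra_automorphism_def intro: bij_comp)
  ultimately show ?thesis
    using assms unfolding autG_def algebra_automorphism_def mem_Collect_eq comp_apply by simp
qed

lemma autG_id: "id \<in> autG"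
  by (simp add: autG_def algebra_automorphism_def)

lemma subst_pair_CM_pairs:
  assumes "\<tau> \<in> autG" "XY \<in> CM_pairs n"
  shows "subst_pair n \<tau> XY \<in> CM_pairs n"
proof -
  have c: "fst XY \<in> carrier_mat n n" "snd XY \<in> carrier_mat n n"
    using assms(2) by (auto simp: CM_pairs_def)
  have hom: "\<tau> (p * q) = \<tau> p * \<tau> q" "\<tau> (p + q) = \<tau> p + \<tau> q" for p q
    using assms(1) by (auto simp: autG_def algebra_automorphism_def)
  have diff: "\<tau> (p - q) = \<tau> p - \<tau> q" for p q
    using hom(2)[of "p - q" q] by (simp add: algebra_simps)
  let ?A = "fst (subst_pair n \<tau> XY)" and ?B = "snd (subst_pair n \<tau> XY)"
  have "?A * ?B - ?B * ?A = eval_mat n XY (\<tau> (commutator (gen LetterX) (gen LetterY)))"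
    by (simp add: subst_pair_def commutator_def diff hom eval_mat_diff[OF c] eval_mat_mult[OF c])
  also have "\<dots> = eval_mat n XY (commutator (gen LetterX) (gen LetterY))"
    using assms(1) by (simp add: autG_def)
  also have "\<dots> = fst XY * snd XY - snd XY * fst XY"
    by (simp add: commutator_def eval_mat_diff[OF c] eval_mat_mult[OF c] eval_mat_gen[OF c])
  finally show ?thesis
    using assms(2) by (auto simp: CM_pairs_def subst_pair_def split: prod.splits)
qed

lemma similar_mat_wit_carrier:
  assumes "similar_mat_wit A B P Q" "B \<in> carrier_mat n n"
  shows "A \<in> carrier_mat n n" "P \<in> carrier_mat n n" "Q \<in> carrier_mat n n"
proof -
  note D = similar_mat_witD[OF refl assms(1)]
  have n: "dim_row A = n" using carrier_matD(1)[OF D(5)] carrier_matD(1)[OF assms(2)] by simp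
  show "A \<in> carrier_mat n n" "P \<in> carrier_mat n n" "Q \<in> carrier_mat n n"
    using D(4) D(6) D(7) by (simp_all only: n)
qed

lemma eval_mat_conj:
  assumes c: "fst XY \<in> carrier_mat n n" "snd XY \<in> carrier_mat n n"
    and s: "similar_mat_wit (fst XY') (fst XY) P Q" "similar_mat_wit (snd XY') (snd XY) P Q"
  shows "similar_mat_wit (eval_mat n XY' p) (eval_mat n XY p) P Q"
proof -
  note c' = similar_mat_wit_carrier(1)[OF s(1) c(1)] similar_mat_wit_carrier(1)[OF s(2) c(2)]
  note PQ = similar_mat_wit_carrier(2,3)[OF s(1) c(1)]
  have inv: "P * Q = 1\<^sub>m n" "Q * P = 1\<^sub>m n"
    using similar_mat_witD2[OF c'(1) s(1)] by auto
  have l: "letter_mat XY' a = P * letter_mat XY a * Q" "letter_mat XY a \<in> carrier_mat n n" for a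
    using similar_mat_witD2[OF c'(1) s(1)] similar_mat_witD2[OF c'(2) s(2)] c by (cases a; auto)+
  have "eval_mat n XY' p = P * eval_mat n XY p * Q"
  proof (induction p rule: free_alg_induct)
    case one
    then show ?case using PQ inv by (simp add: eval_mat_one[OF c] eval_mat_one[OF c'])
  next
    case (add p q)
    then show ?case using PQ
      by (simp add: eval_mat_add mult_add_distrib_mat[of _ n n _ n] add_mult_distrib_mat[of _ n n _ _ n])
  next
    case (scale k p)
    let ?E = "eval_mat n XY p"
    have "P * (k \<cdot>\<^sub>m ?E) * Q = k \<cdot>\<^sub>m (P * ?E * Q)"
      using PQ mult_smult_distrib[of P n n ?E n k] mult_smult_assoc_mat[of "P * ?E" n n Q n k]
      by simp
    with scale show ?case
      by (simp add: eval_mat_const_mult[OF c] eval_mat_const_mult[OF c'])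
  next
    case (gen a p)
    let ?L = "letter_mat XY a" and ?E = "eval_mat n XY p"
    have E: "?E \<in> carrier_mat n n" by simp
    have "eval_mat n XY' (gen a * p) = (P * ?L * Q) * (P * ?E * Q)"
      by (simp add: eval_mat_gen_mult[OF c'] l gen)
    also have "\<dots> = P * ?L * (Q * (P * (?E * Q)))"
      using PQ l(2)[of a] E assoc_mult_mat[of "P * ?L" n n Q n "P * (?E * Q)" n]
        assoc_mult_mat[of P n n ?E n Q n]
      by (metis mult_carrier_mat)
    also have "Q * (P * (?E * Q)) = (Q * P) * (?E * Q)"
      using PQ E assoc_mult_mat[of Q n n P n "?E * Q" n] by (metis mult_carrier_mat)
    also have "\<dots> = ?E * Q" using PQ E left_mult_one_mat[of "?E * Q" n n] by (metis inv(2) mult_carrier_mat)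
    also have "P * ?L * (?E * Q) = P * (?L * ?E) * Q"
      using PQ l(2)[of a] E assoc_mult_mat[of P n n ?L n "?E * Q" n]
        assoc_mult_mat[of ?L n n ?E n Q n] assoc_mult_mat[of P n n "?L * ?E" n Q n]
      by (metis mult_carrier_mat)
    finally show ?case by (simp add: eval_mat_gen_mult[OF c])
  qed
  then show ?thesis
    using PQ inv by (intro similar_mat_witI[of _ _ n]) auto
qed

lemma equiv_CM_rel: "equiv (CM_pairs n) (CM_rel n)"
proof (rule equivI)
  show "CM_rel n \<subseteq> CM_pairs n \<times> CM_pairs n" by (auto simp: CM_rel_def)
  show "refl_on (CM_pairs n) (CM_rel n)"
    by (rule refl_onI)
      (auto simp: CM_rel_def CM_pairs_def intro!: exI[of _ "1\<^sub>m n"] similar_mat_wit_refl)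
  show "sym (CM_rel n)"
    by (rule symI) (auto simp: CM_rel_def dest: similar_mat_wit_sym)
  show "trans (CM_rel n)"
    by (rule transI) (force simp: CM_rel_def intro: similar_mat_wit_trans)
qed

lemma CM_rel_subst_pair:
  assumes "\<tau> \<in> autG" "(XY, XY') \<in> CM_rel n"
  shows "(subst_pair n \<tau> XY, subst_pair n \<tau> XY') \<in> CM_rel n"
proof -
  obtain P Q where PQ: "XY \<in> CM_pairs n" "XY' \<in> CM_pairs n"
    "similar_mat_wit (fst XY') (fst XY) P Q" "similar_mat_wit (snd XY') (snd XY) P Q"
    using assms(2) by (auto simp: CM_rel_def)
  have c: "fst XY \<in> carrier_mat n n" "snd XY \<in> carrier_mat n n"
    using PQ(1) by (auto simp: CM_pairs_def)
  show ?thesis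
    using subst_pair_CM_pairs[OF assms(1) PQ(1)] subst_pair_CM_pairs[OF assms(1) PQ(2)]
      eval_mat_conj[OF c PQ(3,4)]
    by (auto simp: CM_rel_def subst_pair_def)
qed

lemma CM_act_class:
  assumes "\<sigma> \<in> autG" "XY \<in> CM_pairs n"
  shows "CM_act n \<sigma> (CM_rel n `` {XY}) = CM_rel n `` {subst_pair n (inv_into UNIV \<sigma>) XY}"
proof -
  have "(\<lambda>XY. CM_rel n `` {subst_pair n (inv_into UNIV \<sigma>) XY}) respects CM_rel n"
    by (intro congruentI equiv_class_eq[OF equiv_CM_rel] CM_rel_subst_pair autG_inv assms(1))
  then show ?thesis
    unfolding CM_act_def by (rule UN_equiv_class[OF equiv_CM_rel _ assms(2)])
qed

lemma CM_act_closed: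
  assumes "\<sigma> \<in> autG" "p \<in> CM_space n"
  shows "CM_act n \<sigma> p \<in> CM_space n"
proof -
  obtain XY where "XY \<in> CM_pairs n" "p = CM_rel n `` {XY}"
    using assms(2) by (auto simp: CM_space_def elim: quotientE)
  then show ?thesis
    using CM_act_class[OF assms(1), of XY n] subst_pair_CM_pairs[OF autG_inv[OF assms(1)], of XY n]
    by (simp add: CM_space_def quotientI)
qed

lemma CM_act_id:
  assumes "p \<in> CM_space n"
  shows "CM_act n id p = p"
proof -
  obtain XY where XY: "XY \<in> CM_pairs n" "p = CM_rel n `` {XY}"
    using assms by (auto simp: CM_space_def elim: quotientE)
  have c: "fst XY \<in> carrier_mat n n" "snd XY \<in> carrier_mat n n"
    using XY(1) by (auto simp: CM_pairs_def)
  have "subst_pair n (inv_into UNIV id) XY = XY"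
    by (simp add: subst_pair_def eval_mat_gen[OF c])
  then show ?thesis using CM_act_class[OF autG_id XY(1)] XY(2) by simp
qed

lemma CM_act_comp:
  assumes "\<sigma> \<in> autG" "\<tau> \<in> autG" "p \<in> CM_space n"
  shows "CM_act n (\<sigma> \<circ> \<tau>) p = CM_act n \<sigma> (CM_act n \<tau> p)"
proof -
  obtain XY where XY: "XY \<in> CM_pairs n" "p = CM_rel n `` {XY}"
    using assms(3) by (auto simp: CM_space_def elim: quotientE)
  have c: "fst XY \<in> carrier_mat n n" "snd XY \<in> carrier_mat n n"
    using XY(1) by (auto simp: CM_pairs_def)
  let ?s = "inv_into UNIV \<sigma>" and ?t = "inv_into UNIV \<tau>"
  have t: "algebra_automorphism ?t" using autG_inv[OF assms(2)] by (simp add: autG_def)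
  have "inv_into UNIV (\<sigma> \<circ> \<tau>) = ?t \<circ> ?s"
    using assms(1,2) by (intro o_inv_distrib) (auto simp: autG_def algebra_automorphism_def)
  then have "subst_pair n (inv_into UNIV (\<sigma> \<circ> \<tau>)) XY = subst_pair n ?s (subst_pair n ?t XY)"
    using eval_mat_subst_pair[OF c t] by (simp add: subst_pair_def[of n _ "subst_pair n ?t XY"]
        subst_pair_def[of n "?t \<circ> ?s"])
  then show ?thesis
    using XY CM_act_class[OF autG_comp[OF assms(1,2)] XY(1)] CM_act_class[OF assms(2) XY(1)]
      CM_act_class[OF assms(1) subst_pair_CM_pairs[OF autG_inv[OF assms(2)] XY(1)]]
    by simp
qed

end

theory Submission
  imports Defs
    "HOL-Computational_Algebra.Formal_Power_Series"
    "HOL-Library.Landau_Symbols"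
    "Jordan_Normal_Form.Schur_Decomposition"
    "Jordan_Normal_Form.Spectral_Radius"
begin

text \<open>
  The shears \<open>(x, y) \<mapsto> (x + p(y), y)\<close> and \<open>(x, y) \<mapsto> (x, y + q(x))\<close> fix the commutator, and on pairs of
  matrices they act by explicit formulas.  Compositions of shears move every pair of distinct points
  to one standard pair, in two stages.

  The first stage separates the spectra.  Among the images \<open>(X\<^sub>1, Y\<^sub>1), (X\<^sub>2, Y\<^sub>2)\<close> of the given pair
  under the group take one for which \<open>X\<^sub>1\<close> and \<open>X\<^sub>2\<close> have together as many distinct eigenvalues as possible.
  The claim is that there are \<open>2 n\<close> of them.  Consider lines \<open>X\<^sub>b + s Z\<^sub>b\<close> that shears
  produce from the two points simultaneously; this covers \<open>Z\<^sub>b = Y\<^sub>b\<close>, \<open>Z\<^sub>b = Y\<^sub>b\<^sup>2\<close> and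
  \<open>Z\<^sub>b = (Y\<^sub>b + r(X\<^sub>b))\<^sup>3\<close>.  By maximality no eigenvalue splits for small \<open>s\<close>, and hence the polynomial
  \<open>Q\<close> that vanishes on the joint spectrum at \<open>s = 0\<close> is \<open>O(s)\<close> on the spectrum at \<open>s\<close> (\<open>Q_linear_bound\<close>), although multiple
  eigenvalues of a general line move like fractional powers of \<open>s\<close>.  Comparing this with the Taylor
  expansion of the resolvent \<open>R = (z - X\<^sub>b)\<^sup>-\<^sup>1\<close> bounds the order of the poles of \<open>tr(RYRYR)\<close> by 3 and
  that of \<open>tr(Y\<^sup>2R\<^sup>3)\<close> by 4 (\<open>second_order_coeff\<close>, \<open>first_order_coeff\<close>).  On the other hand, as
  \<open>[X, Y] + 1\<close> has rank one,
  \<open>tr(RYRYR) - tr(Y\<^sup>2R\<^sup>3) = tr(R\<^sup>2) tr(R\<^sup>3) - tr(R\<^sup>5)\<close> (\<open>trace_resolvent_commutator\<close>),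
  and at an eigenvalue \<open>l\<close> of multiplicity \<open>m\<close> the right-hand side behaves like
  \<open>(m\<^sup>2 - m) / (z - l)\<^sup>5\<close>.  So \<open>m = 1\<close>: both \<open>X\<^sub>b\<close> have simple spectrum.

  When \<open>X\<close> has simple spectrum \<open>d\<^sub>1, \<dots>, d\<^sub>n\<close>, its point has a representative with \<open>X\<close> diagonal and
  \<open>Y\<^sub>i\<^sub>j = 1 / (d\<^sub>i - d\<^sub>j)\<close> off the diagonal; only the diagonal of \<open>Y\<close> is free (\<open>CM_normal_form\<close>).
  An eigenvalue \<open>l\<close> common to both \<open>X\<^sub>b\<close> must move with the same velocity in both, that is, the
  diagonal entries of \<open>Z\<^sub>1\<close> and \<open>Z\<^sub>2\<close> at \<open>l\<close> agree (\<open>common_eigenvalue\<close>).  With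
  \<open>Z = (Y + r(X))\<^sup>3\<close> this says that the sums of \<open>r(d\<^sub>k) / (l - d\<^sub>k)\<^sup>2\<close> over the other eigenvalues agree
  for every polynomial \<open>r\<close> with \<open>r(l) = 0\<close>, so the two spectra are equal; with \<open>Z = Y\<close> it then says
  that the diagonals of \<open>Y\<^sub>1\<close> and \<open>Y\<^sub>2\<close> agree.  The two points would coincide.

  The second stage reaches the standard pair.  Once the \<open>2 n\<close> eigenvalues are distinct, a shear \<open>y + q(x)\<close> changes the two
  free diagonals arbitrarily, so the orbit depends only on the two spectra
  (\<open>separated_same_spectra\<close>).  Take the point \<open>(X\<^sub>0, Y\<^sub>0)\<close> given by multiplication by \<open>x\<close> and by
  \<open>d/dx\<close>, truncated to polynomials of degree below \<open>n\<close>.  The matrices \<open>X\<^sub>0 + p(Y\<^sub>0)\<close> attain every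
  simple spectrum (\<open>spectrum_base_shear\<close>).  In the pair \<open>(X\<^sub>0, Y\<^sub>0), (X\<^sub>0, Y\<^sub>0 + 1)\<close> the second matrices
  have the spectra \<open>{0}\<close> and \<open>{1}\<close>, so a single shear acts on the two points through two independent
  polynomials, and all disjoint pairs of simple spectra lie in the orbit of this one pair.
\<close>

section \<open>Shear automorphisms of the free algebra\<close>

lemma const_0 [simp]: "const 0 = 0"
  by (simp add: const_def)

lemma const_1 [simp]: "const 1 = 1"
  by (simp add: one_eq_const)

lemma const_add: "const (c + d) = const c + const d"
  by (simp add: const_def single_add)

lemma const_mult: "const (c * d) = const c * const d"
  by (simp add: const_def mult_single plus_list_def)

text \<open>Scalars are central: this is what makes substitution multiplicative below.\<close>

lemma const_commute: "p * const c = const c * p"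
proof (induction p rule: free_alg_single_induct)
  case (single w d)
  then show ?case by (simp add: const_def mult_single plus_list_def mult.commute)
next
  case (sum p q)
  then show ?case by (simp add: algebra_simps)
qed

text \<open>The algebra endomorphism that sends each letter to a prescribed element (the universal property
  of the free algebra).\<close>

definition subst_hom :: "(letter \<Rightarrow> free_alg) \<Rightarrow> free_alg \<Rightarrow> free_alg" where
  "subst_hom f p = (\<Sum>w\<in>Poly_Mapping.keys p. const (Poly_Mapping.lookup p w) * prod_list (map f w))"

lemma subst_hom_superset:
  assumes "finite S" "Poly_Mapping.keys p \<subseteq> S"
  shows "subst_hom f p = (\<Sum>w\<in>S. const (Poly_Mapping.lookup p w) * prod_list (map f w))"
  unfolding subst_hom_def
  by (rule sum.mono_neutral_left) (use assms in \<open>auto simp: in_keys_iff\<close>)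

lemma subst_hom_add: "subst_hom f (p + q) = subst_hom f p + subst_hom f q"
proof -
  let ?S = "Poly_Mapping.keys p \<union> Poly_Mapping.keys q"
  show ?thesis
    using Poly_Mapping.keys_add[of p q]
    by (simp add: subst_hom_superset[of ?S] lookup_add const_add distrib_right sum.distrib)
qed

lemma subst_hom_single: "subst_hom f (Poly_Mapping.single w c) = const c * prod_list (map f w)"
  by (simp add: subst_hom_superset[of "{w}"])

lemma subst_hom_const_mult: "subst_hom f (const c * p) = const c * subst_hom f p"
  by (induction p rule: free_alg_single_induct)
    (simp_all add: const_mult_single subst_hom_single const_mult mult.assoc distrib_left subst_hom_add)

lemma subst_hom_1: "subst_hom f 1 = 1"
proof -
  have "(1 :: free_alg) = Poly_Mapping.single [] 1" by (metis const_1 const_def)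
  then show ?thesis using subst_hom_single[of f "[]" 1] by simp
qed

lemma subst_hom_const [simp]: "subst_hom f (const c) = const c"
  using subst_hom_const_mult[of f c 1] by (simp add: subst_hom_1)

lemma subst_hom_gen_mult: "subst_hom f (gen a * p) = f a * subst_hom f p"
proof (induction p rule: free_alg_single_induct)
  case (single w c)
  have "const c * (f a * q) = f a * (const c * q)" for q
    by (metis const_commute mult.assoc)
  then show ?case by (simp add: gen_mult_single subst_hom_single)
next
  case (sum p q)
  then show ?case by (simp add: distrib_left subst_hom_add)
qed

lemma subst_hom_gen [simp]: "subst_hom f (gen a) = f a"
  using subst_hom_gen_mult[of f a 1] by (simp add: subst_hom_1)

lemma subst_hom_mult: "subst_hom f (p * q) = subst_hom f p * subst_hom f q"
  by (induction p rule: free_alg_induct)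
    (simp_all add: subst_hom_1 subst_hom_add distrib_right mult.assoc subst_hom_const_mult subst_hom_gen_mult)

lemma subst_hom_diff: "subst_hom f (p - q) = subst_hom f p - subst_hom f q"
  using subst_hom_add[of f "p - q" q] by (simp add: algebra_simps)

text \<open>Two substitutions that are inverse on the generators are inverse everywhere; this is how
  substitutions are recognised as automorphisms.\<close>

lemma subst_hom_inverse:
  assumes "\<And>a. subst_hom f (g a) = gen a"
  shows "subst_hom f (subst_hom g p) = p"
  by (induction p rule: free_alg_induct)
    (simp_all add: subst_hom_1 subst_hom_add subst_hom_const_mult subst_hom_gen_mult subst_hom_mult assms)

lemma subst_hom_automorphism:
  assumes "\<And>a. subst_hom f (g a) = gen a" "\<And>a. subst_hom g (f a) = gen a"
  shows "algebra_automorphism (subst_hom f)"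
  unfolding algebra_automorphism_def
  using subst_hom_inverse[of f g, OF assms(1)] subst_hom_inverse[of g f, OF assms(2)]
  by (auto simp: subst_hom_1 subst_hom_add subst_hom_const_mult subst_hom_mult intro!: o_bij[of "subst_hom g"])

text \<open>A polynomial in one of the generators.  It is a Horner scheme because the free algebra is not
  commutative, so that \<^const>\<open>poly\<close> does not apply.\<close>

definition gen_poly :: "letter \<Rightarrow> complex poly \<Rightarrow> free_alg" where
  "gen_poly a p = fold_coeffs (\<lambda>c r. const c + gen a * r) p 0"

lemma gen_poly_0 [simp]: "gen_poly a 0 = 0"
  by (simp add: gen_poly_def)

lemma gen_poly_pCons [simp]: "gen_poly a (pCons c p) = const c + gen a * gen_poly a p"
  by (cases "p = 0 \<and> c = 0") (auto simp: gen_poly_def)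

lemma gen_poly_uminus: "gen_poly a (- p) = - gen_poly a p"
proof (induction p)
  case (pCons c p)
  have "const (- c) = - const c" by (simp add: const_def single_uminus)
  then show ?case using pCons by simp
qed simp

lemma gen_poly_commute: "gen a * gen_poly a p = gen_poly a p * gen a"
  proof (induction p)
  case (pCons c p)
  have "gen a * (gen a * gen_poly a p) = gen a * gen_poly a p * gen a"
    by (metis pCons.IH mult.assoc)
  then show ?case by (simp add: distrib_left distrib_right const_commute)
qed simp

lemma subst_hom_gen_poly:
  assumes "f a = gen a"
  shows "subst_hom f (gen_poly a p) = gen_poly a p"
proof (induction p)
  case 0
  show ?case using subst_hom_single[of f "[]" 0] by simp
next
  case (pCons c p)
  then show ?case using assms subst_hom_const_mult[of f c 1]
    by (simp add: subst_hom_add subst_hom_gen_mult subst_hom_1)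
qed

fun other :: "letter \<Rightarrow> letter" where
  "other LetterX = LetterY" | "other LetterY = LetterX"

definition shear :: "letter \<Rightarrow> complex poly \<Rightarrow> free_alg \<Rightarrow> free_alg" where
  "shear a p = subst_hom (\<lambda>b. if b = a then gen a + gen_poly (other a) p else gen b)"

lemma shear_gen: "shear a p (gen b) = (if b = a then gen a + gen_poly (other a) p else gen b)"
  by (simp add: shear_def)

text \<open>The shear by \<open>- p\<close> is the inverse, since \<open>p\<close> involves only the letter that is left fixed.  The
  commutator is fixed because \<open>p(y)\<close> commutes with \<open>y\<close>.\<close>

lemma shear_autG: "shear a p \<in> autG"
proof -
  have o: "other a \<noteq> a" by (cases a) auto
  have "algebra_automorphism (shear a p)"
    unfolding shear_def
    by (rule subst_hom_automorphism[where g = "\<lambda>b. if b = a then gen a + gen_poly (other a) (- p) else gen b"])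
      (use o in \<open>simp_all add: subst_hom_add subst_hom_diff subst_hom_gen_poly gen_poly_uminus\<close>)
  moreover have "shear a p (commutator (gen LetterX) (gen LetterY)) = commutator (gen LetterX) (gen LetterY)"
  proof -
    have h: "shear b p (q * r) = shear b p q * shear b p r"
      "shear b p (q - r) = shear b p q - shear b p r" for b q r
      by (simp_all add: shear_def subst_hom_mult subst_hom_diff)
    show ?thesis
      by (cases a) (simp_all add: commutator_def h shear_gen distrib_left distrib_right gen_poly_commute)
  qed
  ultimately show ?thesis by (simp add: autG_def)
qed

section \<open>Square matrices: trace, polynomials, triangular form\<close>

text \<open>The ring laws for square matrices with a single dimension \<open>n\<close>: in this form \<open>n\<close> can be
  instantiated once, and the carrier premises become provable by rewriting.\<close>

lemma square_assoc:
  "A \<in> carrier_mat n n \<Longrightarrow> B \<in> carrier_mat n n \<Longrightarrow> C \<in> carrier_mat n n \<Longrightarrow> A * B * C = A * (B * C)"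
  by (rule assoc_mult_mat)

lemma square_carrier [simp]:
  fixes A B :: "'a :: comm_ring_1 mat"
  assumes "A \<in> carrier_mat n n" "B \<in> carrier_mat n n"
  shows "A * B \<in> carrier_mat n n" "A - B \<in> carrier_mat n n" "A + B \<in> carrier_mat n n"
  using assms by auto

lemma square_mult_entry:
  fixes A B :: "'a :: comm_ring_1 mat"
  assumes "A \<in> carrier_mat n n" "B \<in> carrier_mat n n" "i < n" "j < n"
  shows "(A * B) $$ (i, j) = (\<Sum>k<n. A $$ (i, k) * B $$ (k, j))"
  using assms by (simp add: scalar_prod_def atLeast0LessThan)

lemma square_distribs:
  fixes A B C :: "'a :: comm_ring_1 mat"
  assumes "A \<in> carrier_mat n n" "B \<in> carrier_mat n n" "C \<in> carrier_mat n n"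
  shows "A * (B + C) = A * B + A * C" "(A + B) * C = A * C + B * C"
    "A * (B - C) = A * B - A * C" "(A - B) * C = A * C - B * C"
  using assms by (auto intro: mult_add_distrib_mat add_mult_distrib_mat mult_minus_distrib_mat minus_mult_distrib_mat)

lemma square_smult:
  fixes A B :: "'a :: comm_ring_1 mat"
  assumes "A \<in> carrier_mat n n" "B \<in> carrier_mat n n"
  shows "(c \<cdot>\<^sub>m A) * B = c \<cdot>\<^sub>m (A * B)" "A * (c \<cdot>\<^sub>m B) = c \<cdot>\<^sub>m (A * B)"
  using assms by (auto intro: mult_smult_assoc_mat mult_smult_distrib)

lemma square_units:
  fixes A :: "'a :: comm_ring_1 mat"
  shows "A \<in> carrier_mat n n \<Longrightarrow> 1\<^sub>m n * A = A" "A \<in> carrier_mat n n \<Longrightarrow> A * 1\<^sub>m n = A"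
  "A \<in> carrier_mat n n \<Longrightarrow> 0\<^sub>m n n * A = 0\<^sub>m n n" "A \<in> carrier_mat n n \<Longrightarrow> A * 0\<^sub>m n n = 0\<^sub>m n n"
  by auto

lemmas square_simps = square_assoc square_distribs square_smult square_units

definition mat_trace :: "'a :: comm_monoid_add mat \<Rightarrow> 'a" where
  "mat_trace A = (\<Sum>i<dim_row A. A $$ (i, i))"

lemma mat_trace_linear:
  fixes A B :: "'a :: comm_ring_1 mat"
  assumes "A \<in> carrier_mat n n" "B \<in> carrier_mat n n"
  shows "mat_trace (A + B) = mat_trace A + mat_trace B" "mat_trace (A - B) = mat_trace A - mat_trace B"
    "mat_trace (c \<cdot>\<^sub>m A) = c * mat_trace A"
  using assms by (auto simp: mat_trace_def sum.distrib sum_subtractf sum_distrib_left)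

lemma mat_trace_comm:
  fixes A B :: "'a :: comm_ring_1 mat"
  assumes "A \<in> carrier_mat n n" "B \<in> carrier_mat n n"
  shows "mat_trace (A * B) = mat_trace (B * A)"
proof -
  have "mat_trace (A * B) = (\<Sum>i<n. \<Sum>j<n. A $$ (i, j) * B $$ (j, i))"
    using assms by (simp add: mat_trace_def scalar_prod_def atLeast0LessThan)
  also have "\<dots> = (\<Sum>j<n. \<Sum>i<n. A $$ (i, j) * B $$ (j, i))" by (rule sum.swap)
  also have "\<dots> = mat_trace (B * A)"
    using assms by (simp add: mat_trace_def scalar_prod_def atLeast0LessThan mult.commute)
  finally show ?thesis .
qed

lemma mat_trace_similar:
  assumes "similar_mat_wit A (B :: 'a :: comm_ring_1 mat) P Q"
  shows "mat_trace A = mat_trace B"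
proof -
  note D = similar_mat_witD[OF refl assms]
  have "mat_trace A = mat_trace (P * B * Q)" by (rule arg_cong[OF D(3)])
  also have "\<dots> = mat_trace (Q * (P * B))"
    by (rule mat_trace_comm[OF mult_carrier_mat[OF D(6) D(5)] D(7)])
  also have "Q * (P * B) = Q * P * B" using assoc_mult_mat[OF D(7) D(6) D(5)] by (rule sym)
  finally show ?thesis using D(2) left_mult_one_mat[OF D(5)] by (simp only:)
qed

definition mat_poly :: "nat \<Rightarrow> 'a :: comm_ring_1 mat \<Rightarrow> 'a poly \<Rightarrow> 'a mat" where
  "mat_poly n A p = fold_coeffs (\<lambda>c R. c \<cdot>\<^sub>m 1\<^sub>m n + A * R) p (0\<^sub>m n n)"

lemma mat_poly_0 [simp]: "mat_poly n A 0 = 0\<^sub>m n n"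
  by (simp add: mat_poly_def)

lemma mat_poly_pCons:
  assumes "A \<in> carrier_mat n n"
  shows "mat_poly n A (pCons c p) = c \<cdot>\<^sub>m 1\<^sub>m n + A * mat_poly n A p"
proof (cases "p = 0 \<and> c = 0")
  case True
  have "0 \<cdot>\<^sub>m 1\<^sub>m n = (0\<^sub>m n n :: 'a mat)" by (rule eq_matI) auto
  then show ?thesis using True assms by simp
qed (auto simp: mat_poly_def)

lemma mat_poly_carrier [simp]:
  assumes "A \<in> carrier_mat n n"
  shows "mat_poly n A p \<in> carrier_mat n n"
  by (induction p) (use assms in \<open>auto simp: mat_poly_pCons\<close>)

lemma mat_poly_dim [simp]:
  assumes "A \<in> carrier_mat n n"
  shows "dim_row (mat_poly n A p) = n" "dim_col (mat_poly n A p) = n"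
  using mat_poly_carrier[OF assms, of p] by (auto simp del: mat_poly_carrier)

lemma mat_poly_add:
  assumes A: "A \<in> carrier_mat n n"
  shows "mat_poly n A (p + q) = mat_poly n A p + mat_poly n A q"
proof (induction p q rule: poly_induct2)
  case (pCons a p b q)
  have "(a + b) \<cdot>\<^sub>m 1\<^sub>m n + (X + Y) = a \<cdot>\<^sub>m 1\<^sub>m n + X + (b \<cdot>\<^sub>m 1\<^sub>m n + Y)"
    if "X \<in> carrier_mat n n" "Y \<in> carrier_mat n n" for X Y :: "'a mat"
    using that by (intro eq_matI) (auto simp: algebra_simps)
  then show ?case
    using A pCons by (simp add: mat_poly_pCons square_distribs[where n=n])
qed (use A in simp)

lemma mat_poly_smult:
  assumes A: "A \<in> carrier_mat n n"
  shows "mat_poly n A (smult c p) = c \<cdot>\<^sub>m mat_poly n A p"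
proof (induction p)
  case (pCons a p)
  then show ?case
    using A by (intro eq_matI) (auto simp: mat_poly_pCons square_smult[where n=n] algebra_simps simp del: smult_carrier_mat)
qed simp

lemma mat_poly_const: "A \<in> carrier_mat n n \<Longrightarrow> mat_poly n A [:c:] = c \<cdot>\<^sub>m 1\<^sub>m n"
  by (simp add: mat_poly_pCons)

lemma mat_poly_1: "A \<in> carrier_mat n n \<Longrightarrow> mat_poly n A 1 = 1\<^sub>m n"
  using mat_poly_const[of A n 1] by (simp add: one_pCons) (intro eq_matI; auto)

lemma mat_poly_X: "A \<in> carrier_mat n n \<Longrightarrow> mat_poly n A [:0, 1:] = A"
  by (simp add: mat_poly_pCons) (intro eq_matI; auto)

lemma mat_poly_mult:
  assumes A: "A \<in> carrier_mat n n"
  shows "mat_poly n A (p * q) = mat_poly n A p * mat_poly n A q"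
proof (induction p)
  case (pCons a p)
  have "mat_poly n A (pCons a p * q) = a \<cdot>\<^sub>m mat_poly n A q + A * mat_poly n A (p * q)"
    using A by (simp add: mat_poly_add mat_poly_smult mat_poly_pCons) (intro eq_matI; simp)
  then show ?case
    using A pCons by (simp add: mat_poly_pCons square_simps[where n=n])
qed (use A in simp)

lemma eval_mat_gen_poly:
  assumes "fst XY \<in> carrier_mat n n" "snd XY \<in> carrier_mat n n"
  shows "eval_mat n XY (gen_poly a p) = mat_poly n (letter_mat XY a) p"
proof (induction p)
  case 0
  show ?case by (intro eq_matI) (auto simp: eval_mat_def)
next
  case (pCons c p)
  have "letter_mat XY a \<in> carrier_mat n n" using assms by (cases a) auto
  moreover have "eval_mat n XY (const c) = c \<cdot>\<^sub>m 1\<^sub>m n"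
    using eval_mat_const_mult[OF assms, of c 1] eval_mat_one[OF assms] by simp
  ultimately show ?case
    using pCons by (simp add: eval_mat_add mat_poly_pCons eval_mat_gen_mult[OF assms])
qed

lemma subst_pair_shear:
  assumes "X \<in> carrier_mat n n" "Y \<in> carrier_mat n n"
  shows "subst_pair n (shear LetterX p) (X, Y) = (X + mat_poly n Y p, Y)"
    "subst_pair n (shear LetterY p) (X, Y) = (X, Y + mat_poly n X p)"
  using assms eval_mat_gen[of "(X, Y)" n] eval_mat_gen_poly[of "(X, Y)" n]
  by (simp_all add: subst_pair_def shear_gen eval_mat_add)

lemma mat_poly_similar:
  fixes A :: "complex mat"
  assumes "similar_mat_wit A B P Q" "B \<in> carrier_mat n n"
  shows "similar_mat_wit (mat_poly n A p) (mat_poly n B p) P Q"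
proof -
  have A: "A \<in> carrier_mat n n" using similar_mat_wit_carrier[OF assms] by simp
  show ?thesis
    using eval_mat_conj[of "(B, B)" n "(A, A)" P Q "gen_poly LetterX p"] assms A
    by (simp add: eval_mat_gen_poly)
qed

lemma spectrum_similar:
  fixes A :: "complex mat"
  assumes "similar_mat_wit A B P Q" "B \<in> carrier_mat n n"
  shows "spectrum A = spectrum B"
proof -
  have "similar_mat A B" using assms by (auto simp: similar_mat_def)
  then show ?thesis
    using similar_mat_wit_carrier(1)[OF assms] assms(2) char_poly_similar[of A B]
    by (simp add: spectrum_root_char_poly[of _ n])
qed

lemma upper_triangular_mult:
  fixes A B :: "'a :: comm_ring_1 mat"
  assumes A: "A \<in> carrier_mat n n" "upper_triangular A" and B: "B \<in> carrier_mat n n" "upper_triangular B"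
  shows "upper_triangular (A * B)" "i < n \<Longrightarrow> (A * B) $$ (i, i) = A $$ (i, i) * B $$ (i, i)"
proof -
  have z: "A $$ (i, k) * B $$ (k, j) = 0" if "i < n" "j < n" "k < n" "j \<le> i" "\<not> (k = i \<and> k = j)" for i j k
  proof -
    have "k < i \<or> j < k" using that by auto
    then show ?thesis
    proof
      assume "k < i"
      then have "A $$ (i, k) = 0" using A that by (intro upper_triangularD) auto
      then show ?thesis by simp
    next
      assume "j < k"
      then have "B $$ (k, j) = 0" using B that by (intro upper_triangularD) auto
      then show ?thesis by simp
    qed
  qed
  have e: "(A * B) $$ (i, j) = (\<Sum>k<n. A $$ (i, k) * B $$ (k, j))" if "i < n" "j < n" for i j
    using that A B by (simp add: scalar_prod_def atLeast0LessThan)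
  show "upper_triangular (A * B)"
    using A B by (intro upper_triangularI) (auto simp: e simp del: index_mult_mat(1) intro!: sum.neutral z)
  show "(A * B) $$ (i, i) = A $$ (i, i) * B $$ (i, i)" if "i < n"
  proof -
    have "(\<Sum>k<n. A $$ (i, k) * B $$ (k, i)) = (\<Sum>k\<in>{i}. A $$ (i, k) * B $$ (k, i))"
      by (rule sum.mono_neutral_right) (use that in \<open>auto intro: z\<close>)
    then show ?thesis using that by (simp add: e)
  qed
qed

text \<open>Going up from the last row, each equation of \<open>A * B = 1\<close> below the diagonal has a single
  unknown.\<close>

lemma upper_triangular_inverse:
  fixes A B :: "'a :: field mat"
  assumes A: "A \<in> carrier_mat n n" "upper_triangular A" and B: "B \<in> carrier_mat n n"
    and AB: "A * B = 1\<^sub>m n" and nz: "\<And>i. i < n \<Longrightarrow> A $$ (i, i) \<noteq> 0"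
  shows "upper_triangular B" "i < n \<Longrightarrow> B $$ (i, i) = inverse (A $$ (i, i))"
proof -
  have e: "(\<Sum>k<n. A $$ (i, k) * B $$ (k, j)) = (if i = j then 1 else 0)" if "i < n" "j < n" for i j
  proof -
    have "(A * B) $$ (i, j) = (\<Sum>k<n. A $$ (i, k) * B $$ (k, j))"
      using that A B by (simp add: scalar_prod_def atLeast0LessThan)
    then show ?thesis using AB that by simp
  qed
  have lower: "B $$ (i, j) = 0" if "i < n" "j < i" for i j
    using that
  proof (induction "n - i" arbitrary: i rule: less_induct)
    case less
    have "A $$ (i, k) * B $$ (k, j) = 0" if "k < n" "k \<noteq> i" for k
    proof (cases "k < i")
      case True
      then show ?thesis using A less.prems by (auto simp: upper_triangular_def)
    next
      case False
      then have "B $$ (k, j) = 0" using that less by auto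
      then show ?thesis by simp
    qed
    then have "(\<Sum>k<n. A $$ (i, k) * B $$ (k, j)) = (\<Sum>k\<in>{i}. A $$ (i, k) * B $$ (k, j))"
      by (intro sum.mono_neutral_right) (use less.prems in auto)
    then show ?case using e[of i j] less.prems nz[of i] by simp
  qed
  then show u: "upper_triangular B" using B by auto
  show "B $$ (i, i) = inverse (A $$ (i, i))" if "i < n"
    using upper_triangular_mult(2)[OF A B u that] AB that nz[OF that]
    by (simp add: field_simps)
qed

lemma triangularize:
  assumes "(A :: complex mat) \<in> carrier_mat n n"
  obtains T P Q where "similar_mat_wit A T P Q" "upper_triangular T" "T \<in> carrier_mat n n"
proof -
  obtain as where "char_poly A = (\<Prod>a\<leftarrow>as. [:- a, 1:])"
    using char_poly_factorized[OF assms] by auto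
  then obtain T where "T \<in> carrier_mat n n" "upper_triangular T" "similar_mat A T"
    using schur_decomposition_exists[OF assms] by blast
  then show ?thesis using that unfolding similar_mat_def by blast
qed

lemma spectrum_triangular:
  fixes T :: "complex mat"
  assumes "T \<in> carrier_mat n n" "upper_triangular T"
  shows "spectrum T = set (map (\<lambda>i. T $$ (i, i)) [0..<n])"
proof -
  have "set (diag_mat T) = set (map (\<lambda>i. T $$ (i, i)) [0..<n])"
    using assms by (auto simp: diag_mat_def)
  moreover have "poly (\<Prod>a\<leftarrow>as. [:- a, 1:]) k = 0 \<longleftrightarrow> k \<in> set as" for as and k :: complex
    by (induction as) (auto simp: algebra_simps)
  ultimately show ?thesis
    using assms by (auto simp: spectrum_root_char_poly[OF assms(1)] char_poly_upper_triangular[OF assms])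
qed

definition is_resolvent :: "nat \<Rightarrow> complex mat \<Rightarrow> complex \<Rightarrow> complex mat \<Rightarrow> bool" where
  "is_resolvent n A z R \<longleftrightarrow> R \<in> carrier_mat n n \<and>
     (z \<cdot>\<^sub>m 1\<^sub>m n - A) * R = 1\<^sub>m n \<and> R * (z \<cdot>\<^sub>m 1\<^sub>m n - A) = 1\<^sub>m n"

text \<open>\<open>A\<close> becomes upper triangular with diagonal \<open>d\<close> in the basis given by \<open>P\<close>.  For a fixed basis such
  matrices form an algebra on which \<open>A \<mapsto> d\<close> is a homomorphism; this replaces a functional calculus
  for matrices that need not be diagonalizable.\<close>

definition tri_rep where
  "tri_rep n P Q A (d :: nat \<Rightarrow> complex) \<longleftrightarrow> (\<exists>U. U \<in> carrier_mat n n \<and> upper_triangular U \<and> similar_mat_wit A U P Q \<and>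
     (\<forall>i<n. U $$ (i, i) = d i))"

lemma tri_rep_trace:
  assumes "tri_rep n P Q A d"
  shows "mat_trace A = (\<Sum>i<n. d i)"
  using assms mat_trace_similar[of A _ P Q] by (auto simp: tri_rep_def mat_trace_def)

lemma similar_mat_wit_mult:
  assumes "similar_mat_wit A U P Q" "similar_mat_wit B V P Q" "U \<in> carrier_mat n n" "V \<in> carrier_mat n n"
  shows "similar_mat_wit (A * B) (U * V) P Q" and "similar_mat_wit (A + B) (U + V) P Q"
    and "similar_mat_wit (c \<cdot>\<^sub>m A) (c \<cdot>\<^sub>m (U :: complex mat)) P Q"
proof -
  have A: "A \<in> carrier_mat n n" and B: "B \<in> carrier_mat n n" and P: "P \<in> carrier_mat n n" and Q: "Q \<in> carrier_mat n n"
    using similar_mat_wit_carrier[OF assms(1,3)] similar_mat_wit_carrier[OF assms(2,4)] by auto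
  note a = similar_mat_witD2[OF A assms(1)] and b = similar_mat_witD2[OF B assms(2)]
  have "Q * (P * Z) = Z" if "Z \<in> carrier_mat n n" for Z
    using assoc_mult_mat[OF Q P that] a(2) that by simp
  then have "A * B = P * (U * V) * Q"
    using a(3) b(3) P Q assms(3,4) by (simp add: square_assoc[where n=n])
  then show "similar_mat_wit (A * B) (U * V) P Q"
    using a b P Q assms A B by (intro similar_mat_witI[of _ _ n]) auto
  have "A + B = P * (U + V) * Q"
    using a(3) b(3) P Q assms(3,4) by (simp add: square_simps[where n=n])
  then show "similar_mat_wit (A + B) (U + V) P Q"
    using a b P Q assms A B by (intro similar_mat_witI[of _ _ n]) auto
  have "c \<cdot>\<^sub>m A = P * (c \<cdot>\<^sub>m U) * Q"
    using a(3) P Q assms(3,4) by (simp add: square_simps[where n=n])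
  then show "similar_mat_wit (c \<cdot>\<^sub>m A) (c \<cdot>\<^sub>m U) P Q"
    using a b P Q assms A B by (intro similar_mat_witI[of _ _ n]) auto
qed

lemma tri_rep_mult:
  assumes "tri_rep n P Q A d" "tri_rep n P Q B e"
  shows "tri_rep n P Q (A * B) (\<lambda>i. d i * e i)"
proof -
  obtain U V where "U \<in> carrier_mat n n" "upper_triangular U" "similar_mat_wit A U P Q" "\<forall>i<n. U $$ (i, i) = d i"
    "V \<in> carrier_mat n n" "upper_triangular V" "similar_mat_wit B V P Q" "\<forall>i<n. V $$ (i, i) = e i"
    using assms unfolding tri_rep_def by blast
  then show ?thesis
    unfolding tri_rep_def
    by (intro exI[of _ "U * V"]) (simp add: upper_triangular_mult similar_mat_wit_mult del: index_mult_mat(1))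
qed

lemma tri_rep_poly:
  assumes "tri_rep n P Q A d"
  shows "tri_rep n P Q (mat_poly n A p) (\<lambda>i. poly p (d i))"
proof -
  obtain U where U: "U \<in> carrier_mat n n" "upper_triangular U" "similar_mat_wit A U P Q" "\<forall>i<n. U $$ (i, i) = d i"
    using assms unfolding tri_rep_def by blast
  have "upper_triangular (mat_poly n U p) \<and> (\<forall>i<n. mat_poly n U p $$ (i, i) = poly p (d i))"
  proof (induction p)
    case (pCons a p)
    have "upper_triangular (U * mat_poly n U p)" "\<And>i. i < n \<Longrightarrow> (U * mat_poly n U p) $$ (i, i) = d i * poly p (d i)"
      using U pCons upper_triangular_mult[OF U(1,2), of "mat_poly n U p"] by auto
    then show ?case using U(1) by (auto simp: mat_poly_pCons upper_triangular_def simp del: index_mult_mat(1))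
  qed auto
  then show ?thesis
    unfolding tri_rep_def using U mat_poly_similar[OF U(3,1)] by (intro exI[of _ "mat_poly n U p"]) auto
qed

lemma tri_rep_resolvent:
  assumes "tri_rep n P Q A d" "is_resolvent n A z R" "\<And>i. i < n \<Longrightarrow> z \<noteq> d i"
  shows "tri_rep n P Q R (\<lambda>i. 1 / (z - d i))"
proof -
  obtain U where U: "U \<in> carrier_mat n n" "upper_triangular U" "similar_mat_wit A U P Q" "\<forall>i<n. U $$ (i, i) = d i"
    using assms unfolding tri_rep_def by blast
  have PQ: "P \<in> carrier_mat n n" "Q \<in> carrier_mat n n" "A \<in> carrier_mat n n"
    using similar_mat_wit_carrier[OF U(3,1)] by auto
  note w = similar_mat_witD2[OF PQ(3) U(3)]
  have R: "R \<in> carrier_mat n n" "(z \<cdot>\<^sub>m 1\<^sub>m n - A) * R = 1\<^sub>m n" using assms(2) by (auto simp: is_resolvent_def)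
  define S where "S = Q * R * P"
  have S: "S \<in> carrier_mat n n" using PQ R by (simp add: S_def)
  have PS: "R = P * S * Q"
  proof -
    have "P * S * Q = (P * Q) * R * (P * Q)"
      unfolding S_def using PQ R by (simp add: square_assoc[where n=n])
    then show ?thesis using w R by simp
  qed
  have sim: "similar_mat_wit R S P Q"
    using PS w PQ R S by (intro similar_mat_witI[of _ _ n]) auto
  let ?D = "z \<cdot>\<^sub>m 1\<^sub>m n - U"
  have D: "?D \<in> carrier_mat n n" "upper_triangular ?D" "\<And>i. i < n \<Longrightarrow> ?D $$ (i, i) = z - d i"
    using U by (auto simp: upper_triangular_def)
  have "?D = Q * (z \<cdot>\<^sub>m 1\<^sub>m n - A) * P"
  proof -
    have "Q * (z \<cdot>\<^sub>m 1\<^sub>m n - A) * P = z \<cdot>\<^sub>m (Q * P) - Q * (P * U * Q) * P"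
      using PQ w(3) by (simp add: square_simps[where n=n])
    also have "Q * (P * U * Q) * P = (Q * P) * U * (Q * P)"
      using PQ U(1) by (simp add: square_assoc[where n=n])
    finally show ?thesis using w U(1) by simp
  qed
  then have "?D * S = Q * (z \<cdot>\<^sub>m 1\<^sub>m n - A) * (P * Q) * R * P"
    unfolding S_def using PQ R minus_carrier_mat[OF PQ(3), of "z \<cdot>\<^sub>m 1\<^sub>m n"]
    by (simp add: square_assoc[where n=n])
  also have "\<dots> = 1\<^sub>m n"
    using R PQ w minus_carrier_mat[OF PQ(3), of "z \<cdot>\<^sub>m 1\<^sub>m n"]
    by (simp add: square_assoc[where n=n])
  finally have DS: "?D * S = 1\<^sub>m n" .
  have nz: "?D $$ (i, i) \<noteq> 0" if "i < n" for i using D(3)[OF that] assms(3)[OF that] by simp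
  note inv = upper_triangular_inverse[OF D(1,2) S DS nz]
  show ?thesis
    unfolding tri_rep_def
    using S sim inv D(3) by (intro exI[of _ S]) (simp add: divide_inverse)
qed

text \<open>One list of eigenvalues with multiplicity computes the traces of all polynomials in \<open>A\<close> and of all
  powers of its resolvent.  The power \<open>R\<^sup>k\<^sup>+\<^sup>1\<close> is written as an iterated product.\<close>

lemma spectral_calculus:
  assumes A: "A \<in> carrier_mat n n"
  obtains d where "d ` {..<n} = spectrum A"
    "\<And>p. mat_trace (mat_poly n A p) = (\<Sum>i<n. poly p (d i))"
    "\<And>z R k. is_resolvent n A z R \<Longrightarrow> z \<notin> spectrum A \<Longrightarrow>
       mat_trace (((*) R ^^ k) R) = (\<Sum>i<n. 1 / (z - d i) ^ Suc k)"
proof -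
  obtain T P Q where T: "similar_mat_wit A T P Q" "upper_triangular T" "T \<in> carrier_mat n n"
    using triangularize[OF A] .
  define d where "d = (\<lambda>i. T $$ (i, i))"
  have rep: "tri_rep n P Q A d" using T by (auto simp: tri_rep_def d_def)
  have sp: "spectrum A = d ` {..<n}"
    using spectrum_similar[OF T(1,3)] spectrum_triangular[OF T(3,2)] by (auto simp: d_def)
  have res: "tri_rep n P Q R (\<lambda>i. 1 / (z - d i))" if "is_resolvent n A z R" "z \<notin> spectrum A" for z R
    using tri_rep_resolvent[OF rep that(1)] that(2) by (auto simp: sp)
  show ?thesis
  proof (rule that[of d])
    show "d ` {..<n} = spectrum A" by (simp add: sp)
    show "mat_trace (mat_poly n A p) = (\<Sum>i<n. poly p (d i))" for p
      by (rule tri_rep_trace[OF tri_rep_poly[OF rep]])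
    show "mat_trace (((*) R ^^ k) R) = (\<Sum>i<n. 1 / (z - d i) ^ Suc k)"
      if r: "is_resolvent n A z R" "z \<notin> spectrum A" for k z R
    proof -
      have "tri_rep n P Q (((*) R ^^ k) R) (\<lambda>i. 1 / (z - d i) ^ Suc k)"
      proof (induction k)
        case 0
        then show ?case using res[OF r] by simp
      next
        case (Suc k)
        show ?case using tri_rep_mult[OF res[OF r] Suc] by simp
      qed
      then show ?thesis by (rule tri_rep_trace)
    qed
  qed
qed

section \<open>Perturbing a matrix along a line\<close>

text \<open>The first-order term \<open>D\<close> is a sum of words with one factor \<open>Z\<close> among factors \<open>X\<close>.  Under a trace
  against a polynomial in \<open>X\<close> all of these words become equal up to rotation, which turns \<open>D\<close> into
  the derivative of the polynomial.  The remainder has polynomial entries in \<open>s\<close>, so the traces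
  along the line are polynomials in \<open>s\<close> as well.\<close>

lemma mat_poly_line_expansion:
  fixes X Z :: "complex mat"
  assumes X: "X \<in> carrier_mat n n" and Z: "Z \<in> carrier_mat n n"
  shows "\<exists>D E. D \<in> carrier_mat n n \<and> E \<in> carrier_mat n n \<and>
    (\<forall>s. mat_poly n (X + s \<cdot>\<^sub>m Z) p = mat_poly n X p + s \<cdot>\<^sub>m D + s^2 \<cdot>\<^sub>m map_mat (\<lambda>q. poly q s) E) \<and>
    (\<forall>q. mat_trace (D * mat_poly n X q) = mat_trace (mat_poly n X (pderiv p * q) * Z))"
proof (induction p)
  case 0
  show ?case
    using X Z by (intro exI[of _ "0\<^sub>m n n"]) (auto intro!: eq_matI simp: mat_trace_def)
next
  case (pCons a p)
  obtain D E where D: "D \<in> carrier_mat n n" and E: "E \<in> carrier_mat n n"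
    and exp: "\<And>s. mat_poly n (X + s \<cdot>\<^sub>m Z) p = mat_poly n X p + s \<cdot>\<^sub>m D + s^2 \<cdot>\<^sub>m map_mat (\<lambda>q. poly q s) E"
    and tr: "\<And>q. mat_trace (D * mat_poly n X q) = mat_trace (mat_poly n X (pderiv p * q) * Z)"
    using pCons.IH by blast
  let ?c = "map_mat (\<lambda>a. [:a:])"
  define D' where "D' = X * D + Z * mat_poly n X p"
  define E' where "E' = ?c X * E + ?c Z * ?c D + [:0, 1:] \<cdot>\<^sub>m (?c Z * E)"
  have D': "D' \<in> carrier_mat n n" "E' \<in> carrier_mat n n"
    using X Z D E by (auto simp: D'_def E'_def)
  have "mat_poly n (X + s \<cdot>\<^sub>m Z) (pCons a p) =
      mat_poly n X (pCons a p) + s \<cdot>\<^sub>m D' + s^2 \<cdot>\<^sub>m map_mat (\<lambda>q. poly q s) E'" for s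
  proof -
    let ?h = "map_mat (\<lambda>q. poly q s)"
    have hom: "semiring_hom (\<lambda>q :: complex poly. poly q s)" by unfold_locales auto
    have hc: "?h (?c A) = A" for A by (intro eq_matI) auto
    have "?h E' = ?h (?c X * E) + ?h (?c Z * ?c D) + s \<cdot>\<^sub>m ?h (?c Z * E)"
      unfolding E'_def by (intro eq_matI) (use X Z D E in \<open>auto simp del: index_mult_mat(1)\<close>)
    also have "\<dots> = X * ?h E + Z * D + s \<cdot>\<^sub>m (Z * ?h E)"
      using X Z D E by (simp add: semiring_hom.mat_hom_mult[OF hom, of _ n n _ n] hc)
    finally have hE: "?h E' = X * ?h E + Z * D + s \<cdot>\<^sub>m (Z * ?h E)" .
    have h: "?h E \<in> carrier_mat n n" using E by auto
    define H where "H = ?h E"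
    define P where "P = mat_poly n X p"
    have cr: "H \<in> carrier_mat n n" "P \<in> carrier_mat n n" using h X by (auto simp: H_def P_def)
    have "mat_poly n (X + s \<cdot>\<^sub>m Z) (pCons a p) = a \<cdot>\<^sub>m 1\<^sub>m n + (X + s \<cdot>\<^sub>m Z) * (P + s \<cdot>\<^sub>m D + s^2 \<cdot>\<^sub>m H)"
      using X Z by (simp add: mat_poly_pCons exp H_def P_def)
    also have "(X + s \<cdot>\<^sub>m Z) * (P + s \<cdot>\<^sub>m D + s^2 \<cdot>\<^sub>m H) =
        X * P + s \<cdot>\<^sub>m (X * D) + s^2 \<cdot>\<^sub>m (X * H) + (s \<cdot>\<^sub>m (Z * P) + s \<cdot>\<^sub>m (s \<cdot>\<^sub>m (Z * D)) + s \<cdot>\<^sub>m (s^2 \<cdot>\<^sub>m (Z * H)))"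
      using X Z D cr by (simp add: square_simps[where n=n] add_smult_distrib_left_mat[of _ n n])
        (intro eq_matI; auto simp del: index_mult_mat(1) simp: algebra_simps)
    also have "a \<cdot>\<^sub>m 1\<^sub>m n + \<dots> = a \<cdot>\<^sub>m 1\<^sub>m n + X * P + s \<cdot>\<^sub>m (X * D + Z * P) + s^2 \<cdot>\<^sub>m (X * H + Z * D + s \<cdot>\<^sub>m (Z * H))"
      using X Z D cr by (intro eq_matI) (auto simp del: index_mult_mat(1) simp: algebra_simps power2_eq_square)
    finally show ?thesis
      using X by (simp add: hE D'_def mat_poly_pCons P_def H_def)
  qed
  moreover have "mat_trace (D' * mat_poly n X q) = mat_trace (mat_poly n X (pderiv (pCons a p) * q) * Z)" for q
  proof -
    let ?x = "[:0, 1:]"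
    have "mat_trace (X * D * mat_poly n X q) = mat_trace (D * (mat_poly n X q * X))"
      using X D mat_trace_comm[of X n "D * mat_poly n X q"] by (simp add: square_assoc[where n=n])
    also have "mat_poly n X q * X = mat_poly n X (?x * q)"
      using X mat_poly_mult[of X n q ?x] by (simp add: mat_poly_X mult.commute)
    finally have 1: "mat_trace (X * D * mat_poly n X q) = mat_trace (mat_poly n X (pderiv p * (?x * q)) * Z)"
      by (simp only: tr)
    have 2: "mat_trace (Z * mat_poly n X p * mat_poly n X q) = mat_trace (mat_poly n X (p * q) * Z)"
      using X Z mat_trace_comm[OF Z mult_carrier_mat[OF mat_poly_carrier[OF X] mat_poly_carrier[OF X]], of p q]
      by (simp add: square_assoc[where n=n] mat_poly_mult)
    have "pderiv (pCons a p) * q = pderiv p * (?x * q) + p * q"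
      by (simp add: pderiv_pCons algebra_simps)
    then show ?thesis
      unfolding D'_def using X Z D 1 2
      by (simp add: mat_trace_linear[of _ n] square_distribs[where n=n] mat_poly_add)
  qed
  ultimately show ?case using D' by blast
qed

text \<open>The choice is legitimate by \<open>line_trace_ex\<close>, and unambiguous because a complex polynomial is determined by
  its values.\<close>

definition line_trace :: "nat \<Rightarrow> complex mat \<Rightarrow> complex mat \<Rightarrow> complex poly \<Rightarrow> complex poly" where
  "line_trace n X Z p = (SOME t. \<forall>s. poly t s = mat_trace (mat_poly n (X + s \<cdot>\<^sub>m Z) p))"

context
  fixes n :: nat and X Z :: "complex mat"
  assumes X: "X \<in> carrier_mat n n" and Z: "Z \<in> carrier_mat n n"
begin

lemma line_trace_ex:
  "\<exists>t. (\<forall>s. poly t s = mat_trace (mat_poly n (X + s \<cdot>\<^sub>m Z) p)) \<and>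
    coeff t 1 = mat_trace (mat_poly n X (pderiv p) * Z)"
proof -
  obtain D E where D: "D \<in> carrier_mat n n" and E: "E \<in> carrier_mat n n"
    and exp: "\<And>s. mat_poly n (X + s \<cdot>\<^sub>m Z) p = mat_poly n X p + s \<cdot>\<^sub>m D + s^2 \<cdot>\<^sub>m map_mat (\<lambda>q. poly q s) E"
    and tr: "\<And>q. mat_trace (D * mat_poly n X q) = mat_trace (mat_poly n X (pderiv p * q) * Z)"
    using mat_poly_line_expansion[OF X Z, of p] by blast
  let ?t = "[:mat_trace (mat_poly n X p), mat_trace D:] + [:0, 0, 1:] * mat_trace E"
  have "poly (mat_trace E) s = mat_trace (map_mat (\<lambda>q. poly q s) E)" for s
    using E by (simp add: mat_trace_def poly_sum)
  then have "poly ?t s = mat_trace (mat_poly n (X + s \<cdot>\<^sub>m Z) p)" for s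
    using X D E by (simp add: exp mat_trace_linear[of _ n] power2_eq_square algebra_simps)
  moreover have "coeff ?t 1 = mat_trace (mat_poly n X (pderiv p) * Z)"
    using tr[of 1] D X by (simp add: mat_poly_1)
  ultimately show ?thesis by blast
qed

lemma poly_line_trace: "poly (line_trace n X Z p) s = mat_trace (mat_poly n (X + s \<cdot>\<^sub>m Z) p)"
proof -
  have "\<exists>t. \<forall>s. poly t s = mat_trace (mat_poly n (X + s \<cdot>\<^sub>m Z) p)"
    using line_trace_ex by blast
  from someI_ex[OF this] show ?thesis by (simp add: line_trace_def)
qed

lemma line_trace_unique:
  assumes "\<And>s. poly t s = mat_trace (mat_poly n (X + s \<cdot>\<^sub>m Z) p)"
  shows "line_trace n X Z p = t"
  using assms by (simp add: poly_eq_poly_eq_iff[symmetric] fun_eq_iff poly_line_trace)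

lemma line_trace_add: "line_trace n X Z (p + q) = line_trace n X Z p + line_trace n X Z q"
  using X Z by (intro line_trace_unique) (simp add: poly_line_trace mat_poly_add mat_trace_linear[of _ n])

lemma line_trace_smult: "line_trace n X Z (smult c p) = smult c (line_trace n X Z p)"
  using X Z by (intro line_trace_unique) (simp add: poly_line_trace mat_poly_smult mat_trace_linear[of _ n])

lemma coeff_line_trace_1: "coeff (line_trace n X Z p) 1 = mat_trace (mat_poly n X (pderiv p) * Z)"
proof -
  obtain t where t: "\<forall>s. poly t s = mat_trace (mat_poly n (X + s \<cdot>\<^sub>m Z) p)"
    "coeff t 1 = mat_trace (mat_poly n X (pderiv p) * Z)"
    using line_trace_ex by blast
  then show ?thesis using line_trace_unique[of t p] by simp
qed

end

definition lagrange :: "'a::field set \<Rightarrow> 'a \<Rightarrow> 'a poly" where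
  "lagrange A a = (\<Prod>b\<in>A - {a}. smult (1 / (a - b)) [:- b, 1:])"

lemma poly_lagrange:
  assumes "finite A" "a \<in> A" "b \<in> A"
  shows "poly (lagrange A a) b = (if a = b then 1 else 0)"
proof -
  have "1 / (a - x) * (a - x) = 1" if "x \<in> A - {a}" for x using that by auto
  then have "poly (lagrange A a) a = 1"
    by (simp add: lagrange_def poly_prod algebra_simps diff_divide_distrib[symmetric])
  then show ?thesis using assms by (auto simp: lagrange_def poly_prod)
qed

lemma degree_lagrange:
  assumes "finite A" "a \<in> A"
  shows "degree (lagrange A a) < card A"
proof -
  have d: "degree (smult c [:- b, 1:]) \<le> 1" for b c :: 'a
    by (rule order.trans[OF degree_smult_le]) simp
  have "degree (lagrange A a) \<le> (\<Sum>b\<in>A - {a}. 1)"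
    unfolding lagrange_def
  proof (rule order.trans[OF degree_prod_sum_le])
    show "sum (degree \<circ> (\<lambda>b. smult (1 / (a - b)) [:- b, 1:])) (A - {a}) \<le> (\<Sum>b\<in>A - {a}. 1)"
      by (rule sum_mono) (unfold o_def, rule d)
  qed (use assms in simp)
  also have "\<dots> < card A" using assms by (auto simp: card_gt_0_iff intro!: diff_less)
  finally show ?thesis .
qed

definition root_poly :: "'a::field set \<Rightarrow> 'a poly" where
  "root_poly A = (\<Prod>a\<in>A. [:- a, 1:])"

lemma poly_root_poly: "finite A \<Longrightarrow> poly (root_poly A) x = 0 \<longleftrightarrow> x \<in> A"
  by (auto simp: root_poly_def poly_prod)

lemma monic_root_poly: "lead_coeff (root_poly A) = 1"
  by (simp add: root_poly_def lead_coeff_prod)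

lemma degree_root_poly: "finite A \<Longrightarrow> degree (root_poly A) = card A"
  unfolding root_poly_def by (subst degree_prod_eq_sum_degree) auto

text \<open>The difference of two monic polynomials of degree \<open>card A\<close> has smaller degree, so its values on
  \<open>A\<close> determine it.\<close>

lemma lagrange_interpolation:
  fixes p :: "'a::field poly"
  assumes A: "finite A" and p: "degree p = card A" "lead_coeff p = 1"
  shows "p = root_poly A + (\<Sum>a\<in>A. smult (poly p a) (lagrange A a))"
proof (cases "A = {}")
  case True
  then show ?thesis using p by (auto simp: root_poly_def one_pCons elim!: degree_eq_zeroE)
next
  case False
  note A = A False
  show ?thesis
  proof (rule poly_eqI_degree_lead_coeff[where n = "card A" and A = A])
  have lt: "degree (\<Sum>a\<in>A. smult (poly p a) (lagrange A a)) < card A"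
    using A degree_lagrange[OF A(1)]
    by (intro degree_sum_less) (auto simp: card_gt_0_iff intro: order.strict_trans1[OF degree_smult_le])
  then show "degree (root_poly A + (\<Sum>a\<in>A. smult (poly p a) (lagrange A a))) \<le> card A"
    using A by (intro degree_add_le) (auto simp: degree_root_poly)
  show "coeff p (card A) = coeff (root_poly A + (\<Sum>a\<in>A. smult (poly p a) (lagrange A a))) (card A)"
    using lt p monic_root_poly[of A] A by (simp add: coeff_eq_0 degree_root_poly)
  show "poly p x = poly (root_poly A + (\<Sum>a\<in>A. smult (poly p a) (lagrange A a))) x" if "x \<in> A" for x
    using A that by (simp add: poly_sum poly_lagrange poly_root_poly[THEN iffD2] if_distrib cong: if_cong)
  qed (use A p in auto)
qed

section \<open>Eigenvalues along a line on which their number is maximal\<close>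

lemma poly_bounded_ball:
  fixes p :: "'a::real_normed_field poly"
  shows "\<exists>C\<ge>0. \<forall>x. norm x \<le> B \<longrightarrow> norm (poly p x) \<le> C"
proof (cases "B \<ge> 0")
  case True
  show ?thesis
  proof (induction p)
    case (pCons a p)
    then obtain C where C: "C \<ge> 0" "\<And>x. norm x \<le> B \<Longrightarrow> norm (poly p x) \<le> C" by blast
    have "norm (poly (pCons a p) x) \<le> norm a + B * C" if "norm x \<le> B" for x
    proof -
      have "norm (poly (pCons a p) x) \<le> norm a + norm x * norm (poly p x)"
        by (simp add: norm_mult[symmetric] norm_triangle_ineq)
      also have "\<dots> \<le> norm a + B * C"
        using C that by (intro add_left_mono mult_mono) (auto intro: order.trans[OF norm_ge_zero])
      finally show ?thesis .
    qed
    moreover have "norm a + B * C \<ge> 0" using True C by simp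
    ultimately show ?case by blast
  qed auto
qed (auto dest: order.trans[OF norm_ge_zero] intro: exI[of _ 0])

lemma poly_lipschitz_0:
  fixes p :: "'a::real_normed_field poly"
  shows "\<exists>C\<ge>0. \<forall>s. norm s \<le> 1 \<longrightarrow> norm (poly p s - poly p 0) \<le> C * norm s"
proof (cases p)
  case (pCons a q)
  obtain C where "C \<ge> 0" "\<And>x. norm x \<le> 1 \<Longrightarrow> norm (poly q x) \<le> C"
    using poly_bounded_ball[of 1 q] by blast
  then show ?thesis
    using pCons by (intro exI[of _ C]) (auto simp: norm_mult mult.commute[of C] intro!: mult_left_mono)
qed

lemma uniform_bound:
  fixes P :: "'a \<Rightarrow> real \<Rightarrow> bool"
  assumes "finite S" "\<And>x. x \<in> S \<Longrightarrow> \<exists>C\<ge>0. P x C" "\<And>x C D. P x C \<Longrightarrow> C \<le> D \<Longrightarrow> P x D"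
  shows "\<exists>C\<ge>0. \<forall>x\<in>S. P x C"
proof -
  obtain f where f: "\<And>x. x \<in> S \<Longrightarrow> f x \<ge> 0 \<and> P x (f x)" using assms(2) by metis
  have "P x (sum f S)" if "x \<in> S" for x
    using assms(1,3) f that member_le_sum[of x S f] by blast
  then show ?thesis using f by (intro exI[of _ "sum f S"]) (auto intro: sum_nonneg)
qed

text \<open>Compare the largest entry of an eigenvector on both sides of the eigenvalue equation.\<close>

lemma spectrum_bound:
  fixes A :: "complex mat"
  assumes A: "A \<in> carrier_mat n n" and mu: "\<mu> \<in> spectrum A"
  shows "norm \<mu> \<le> (\<Sum>i<n. \<Sum>j<n. norm (A $$ (i, j)))"
proof -
  obtain v where v: "v \<in> carrier_vec n" "v \<noteq> 0\<^sub>v n" "A *\<^sub>v v = \<mu> \<cdot>\<^sub>v v"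
    using mu A by (auto simp: spectrum_def eigenvalue_def eigenvector_def)
  obtain k where k: "k < n" "v $ k \<noteq> 0"
    using v(1,2) by (metis carrier_vecD eq_vecI index_zero_vec)
  let ?N = "(\<lambda>i. norm (v $ i)) ` {..<n}"
  have "Max ?N \<in> ?N" using k by (intro Max_in) auto
  then obtain i where i: "i < n" "norm (v $ i) = Max ?N" by auto
  have i_max: "norm (v $ j) \<le> norm (v $ i)" if "j < n" for j
    unfolding i(2) using that by (intro Max_ge) auto
  have pos: "norm (v $ i) > 0" using i_max[OF k(1)] k(2) by (meson zero_less_norm_iff order.strict_trans2)
  have "\<mu> * v $ i = (\<Sum>j<n. A $$ (i, j) * v $ j)"
  proof -
    have "(A *\<^sub>v v) $ i = (\<mu> \<cdot>\<^sub>v v) $ i" using v(3) by simp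
    then show ?thesis using A v(1) i(1) by (simp add: scalar_prod_def atLeast0LessThan)
  qed
  then have "norm \<mu> * norm (v $ i) \<le> (\<Sum>j<n. norm (A $$ (i, j)) * norm (v $ j))"
    by (metis (mono_tags, lifting) norm_mult norm_sum sum.cong)
  also have "\<dots> \<le> (\<Sum>j<n. norm (A $$ (i, j)) * norm (v $ i))"
    by (intro sum_mono mult_left_mono i_max) auto
  also have "\<dots> = (\<Sum>j<n. norm (A $$ (i, j))) * norm (v $ i)" by (simp add: sum_distrib_right)
  finally have "norm \<mu> \<le> (\<Sum>j<n. norm (A $$ (i, j)))" using pos by simp
  also have "\<dots> \<le> (\<Sum>i<n. \<Sum>j<n. norm (A $$ (i, j)))"
    using i(1) by (intro member_le_sum[where f = "\<lambda>i. \<Sum>j<n. norm (A $$ (i, j))"]) (auto intro: sum_nonneg)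
  finally show ?thesis .
qed

text \<open>A finite family of matrices that move simultaneously on lines, such that the joint spectrum never
  has more elements than at \<open>s = 0\<close>.\<close>

locale spectral_line =
  fixes n :: nat and I :: "'b set" and X Z :: "'b \<Rightarrow> complex mat"
  assumes finite_I: "finite I"
    and X: "b \<in> I \<Longrightarrow> X b \<in> carrier_mat n n" and Z: "b \<in> I \<Longrightarrow> Z b \<in> carrier_mat n n"
    and card_max: "card (\<Union>b\<in>I. spectrum (X b + s \<cdot>\<^sub>m Z b)) \<le> card (\<Union>b\<in>I. spectrum (X b))"
begin

definition M where "M b s = X b + s \<cdot>\<^sub>m Z b"
definition sp where "sp s = (\<Union>b\<in>I. spectrum (M b s))"
definition Q where "Q = root_poly (sp 0)"
definition e where "e l = lagrange (sp 0) l"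
text \<open>A monic polynomial of the fixed degree \<open>card (sp 0)\<close> that vanishes on the joint spectrum at \<open>s\<close>.
  The power of \<open>x\<close> only fills up the degree at those \<open>s\<close> where the joint spectrum is smaller.\<close>

definition Qs where "Qs s = root_poly (sp s) * monom 1 (card (sp 0) - card (sp s))"
text \<open>By interpolation (\<open>Qs_interpolation\<close>), the coordinates of \<open>Qs s - Q\<close> in the Lagrange basis \<open>e\<close>
  are the values of \<open>Qs s\<close> on the joint spectrum at \<open>0\<close>.\<close>

definition c where "c l s = poly (Qs s) l"
abbreviation LT where "LT b \<equiv> line_trace n (X b) (Z b)"

lemma M_carrier [simp]: "b \<in> I \<Longrightarrow> M b s \<in> carrier_mat n n"
  using X Z by (simp add: M_def)

lemma M_0: "b \<in> I \<Longrightarrow> M b 0 = X b"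
  using X[of b] Z[of b] unfolding M_def by (intro eq_matI) auto

lemma finite_sp [simp]: "finite (sp s)"
  using finite_I card_finite_spectrum[OF M_carrier] by (auto simp: sp_def)

lemma sp_0: "sp 0 = (\<Union>b\<in>I. spectrum (X b))"
  by (simp add: sp_def M_0)

lemma card_sp: "card (sp s) \<le> card (sp 0)"
  using card_max[of s] by (simp only: sp_0) (simp add: sp_def M_def)

lemma Qs_root: "x \<in> sp s \<Longrightarrow> poly (Qs s) x = 0"
  by (simp add: Qs_def poly_root_poly)

lemma Qs_interpolation: "Qs s = Q + (\<Sum>l\<in>sp 0. smult (c l s) (e l))"
  unfolding Q_def e_def c_def
proof (rule lagrange_interpolation)
  have nz: "root_poly (sp s) \<noteq> 0" using monic_root_poly[of "sp s"] by auto
  have dm: "degree (monom (1 :: complex) k) = k" for k by (rule degree_monom_eq) simp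
  show "degree (Qs s) = card (sp 0)"
  proof -
    have "monom (1 :: complex) (card (sp 0) - card (sp s)) \<noteq> 0" by (simp add: monom_eq_0_iff)
    then show ?thesis
      unfolding Qs_def using card_sp[of s] by (simp add: degree_mult_eq[OF nz] degree_root_poly dm)
  qed
  show "lead_coeff (Qs s) = 1"
    by (simp add: Qs_def lead_coeff_mult monic_root_poly dm)
qed simp

lemma trace_calculus:
  assumes b: "b \<in> I"
  obtains d where "d ` {..<n} = spectrum (M b s)" "\<forall>p. poly (LT b p) s = (\<Sum>i<n. poly p (d i))"
  using spectral_calculus[OF M_carrier[OF b, of s]] poly_line_trace[OF X[OF b] Z[OF b]]
  unfolding M_def by metis

text \<open>\<open>Qs s\<close> vanishes on the spectrum of every member of the family at \<open>s\<close>, so \<open>tr (Qs s * p) = 0\<close>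
  there; expand \<open>Qs s\<close> in the Lagrange basis.\<close>

lemma line_identity:
  assumes b: "b \<in> I"
  shows "poly (LT b (Q * p)) s = - (\<Sum>l\<in>sp 0. c l s * poly (LT b (e l * p)) s)"
proof -
  obtain d where d: "d ` {..<n} = spectrum (M b s)" "\<forall>p. poly (LT b p) s = (\<Sum>i<n. poly p (d i))"
    using trace_calculus[OF b, of s] .
  have "(\<Sum>i<n. poly (Qs s * p) (d i)) = 0"
  proof (rule sum.neutral, rule ballI)
    fix i assume "i \<in> {..<n}"
    then have "d i \<in> sp s" using d(1) b by (auto simp: sp_def)
    then show "poly (Qs s * p) (d i) = 0" by (simp add: Qs_root)
  qed
  moreover have "poly (Qs s * p) x = poly (Q * p) x + (\<Sum>l\<in>sp 0. c l s * poly (e l * p) x)" for x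
    by (subst Qs_interpolation) (simp add: poly_sum sum_distrib_right distrib_right mult.assoc)
  ultimately have "(\<Sum>i<n. poly (Q * p) (d i)) + (\<Sum>i<n. \<Sum>l\<in>sp 0. c l s * poly (e l * p) (d i)) = 0"
    by (simp add: sum.distrib)
  moreover have "(\<Sum>i<n. \<Sum>l\<in>sp 0. c l s * poly (e l * p) (d i)) = (\<Sum>l\<in>sp 0. c l s * poly (LT b (e l * p)) s)"
    by (subst sum.swap) (simp add: d(2) sum_distrib_left)
  ultimately show ?thesis by (simp add: d(2) eq_neg_iff_add_eq_0)
qed

text \<open>The total multiplicity of an eigenvalue in the family at \<open>s = 0\<close>.\<close>

definition mult_of where "mult_of l = (\<Sum>b\<in>I. poly (LT b (e l)) 0)"

lemma mult_of_ge_1: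
  assumes "l \<in> sp 0"
  shows "norm (mult_of l) \<ge> 1"
proof -
  have nat: "\<exists>k. poly (LT b (e l)) 0 = of_nat k \<and> (l \<in> spectrum (X b) \<longrightarrow> k \<ge> 1)" if b: "b \<in> I" for b
  proof -
    obtain d where d: "d ` {..<n} = spectrum (M b 0)" "\<forall>p. poly (LT b p) 0 = (\<Sum>i<n. poly p (d i))"
      using trace_calculus[OF b, of 0] .
    have "(\<Sum>i<n. poly (e l) (d i)) = (\<Sum>i<n. if d i = l then 1 else 0)"
    proof (rule sum.cong)
      fix i assume "i \<in> {..<n}"
      then have "d i \<in> sp 0" using d(1) b by (auto simp: sp_def)
      then show "poly (e l) (d i) = (if d i = l then 1 else 0)"
        using assms by (auto simp: e_def poly_lagrange)
    qed simp
    also have "\<dots> = of_nat (card {i\<in>{..<n}. d i = l})"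
      by (simp flip: sum.inter_filter)
    finally have "poly (LT b (e l)) 0 = of_nat (card {i\<in>{..<n}. d i = l})" by (simp add: d(2))
    moreover have "card {i\<in>{..<n}. d i = l} \<ge> 1" if "l \<in> spectrum (X b)"
    proof -
      have "l \<in> d ` {..<n}" using d(1) that M_0[OF b] by simp
      then have "{i\<in>{..<n}. d i = l} \<noteq> {}" by auto
      then show ?thesis by (simp add: Suc_le_eq card_gt_0_iff)
    qed
    ultimately show ?thesis by blast
  qed
  then obtain k where k: "\<And>b. b \<in> I \<Longrightarrow> poly (LT b (e l)) 0 = of_nat (k b)"
    "\<And>b. b \<in> I \<Longrightarrow> l \<in> spectrum (X b) \<Longrightarrow> k b \<ge> 1" by metis
  obtain b where b: "b \<in> I" "l \<in> spectrum (X b)" using assms by (auto simp: sp_0)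
  have "k b \<le> (\<Sum>b\<in>I. k b)" using b finite_I by (intro member_le_sum) auto
  then have "(\<Sum>b\<in>I. k b) \<ge> 1" using k(2)[OF b] by linarith
  moreover have "mult_of l = of_nat (\<Sum>b\<in>I. k b)" by (simp add: mult_of_def k(1))
  ultimately show ?thesis by (simp only: norm_of_nat)
qed

lemma LT_at_0:
  assumes b: "b \<in> I"
  shows "poly (LT b (Q * p)) 0 = 0"
    "l \<in> sp 0 \<Longrightarrow> k \<in> sp 0 \<Longrightarrow> poly (LT b (e l * e k)) 0 = (if l = k then poly (LT b (e l)) 0 else 0)"
proof -
  obtain d where d: "d ` {..<n} = spectrum (M b 0)" "\<forall>p. poly (LT b p) 0 = (\<Sum>i<n. poly p (d i))"
    using trace_calculus[OF b, of 0] .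
  have dm: "d i \<in> sp 0" if "i < n" for i using d(1) b that by (auto simp: sp_def)
  show "poly (LT b (Q * p)) 0 = 0" using dm by (auto simp: d(2) Q_def poly_root_poly intro!: sum.neutral)
  show "poly (LT b (e l * e k)) 0 = (if l = k then poly (LT b (e l)) 0 else 0)" if "l \<in> sp 0" "k \<in> sp 0"
    using that dm by (auto simp: d(2) e_def poly_lagrange intro!: sum.cong sum.neutral)
qed

text \<open>Sum \<open>line_identity\<close> for \<open>p = e k\<close> over the family.  At \<open>s = 0\<close> the left-hand side is \<open>0\<close> and the
  matrix \<open>tr (e l * e k)\<close> of the linear system for the \<open>c l s\<close> is diagonal with the multiplicities on
  the diagonal.  Both depend polynomially on \<open>s\<close>, so the system stays invertible for small \<open>s\<close> and
  its solution is \<open>O(s)\<close>.  Maximality enters through the fixed degree of \<open>Qs s\<close>.\<close>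

lemma c_linear_bound: "\<exists>K\<ge>0. \<exists>\<delta>>0. \<delta> \<le> 1 \<and> (\<forall>s. norm s < \<delta> \<longrightarrow> (\<forall>l\<in>sp 0. norm (c l s) \<le> K * norm s))"
proof -
  define T where "T p = (\<Sum>b\<in>I. LT b p)" for p
  have id: "poly (T (Q * p)) s = - (\<Sum>l\<in>sp 0. c l s * poly (T (e l * p)) s)" for p s
  proof -
    have "poly (T (Q * p)) s = (\<Sum>b\<in>I. - (\<Sum>l\<in>sp 0. c l s * poly (LT b (e l * p)) s))"
      by (simp add: T_def poly_sum line_identity)
    also have "\<dots> = - (\<Sum>l\<in>sp 0. \<Sum>b\<in>I. c l s * poly (LT b (e l * p)) s)"
      by (simp add: sum_negf) (rule sum.swap)
    finally show ?thesis by (simp add: T_def poly_sum sum_distrib_left)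
  qed
  have T0: "poly (T (Q * p)) 0 = 0" for p by (simp add: T_def poly_sum LT_at_0)
  have Te: "poly (T (e l * e k)) 0 = (if l = k then mult_of l else 0)" if "l \<in> sp 0" "k \<in> sp 0" for l k
    using that by (simp add: T_def poly_sum LT_at_0 mult_of_def)
  let ?P = "\<lambda>p C. \<forall>s. norm s \<le> 1 \<longrightarrow> norm (poly p s - poly p 0) \<le> C * norm s"
  let ?S = "(\<lambda>k. T (Q * e k)) ` sp 0 \<union> (\<lambda>(l, k). T (e l * e k)) ` (sp 0 \<times> sp 0)"
  have "\<exists>K\<ge>0. \<forall>p\<in>?S. ?P p K"
  proof (rule uniform_bound)
    show "finite ?S" by simp
    show "\<exists>C\<ge>0. ?P p C" for p :: "complex poly" by (rule poly_lipschitz_0)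
    show "?P p D" if "?P p C" "C \<le> D" for p C D
      using that by (meson mult_right_mono norm_ge_zero order.trans)
  qed
  then obtain K where K: "K \<ge> 0" "\<And>p s. p \<in> ?S \<Longrightarrow> norm s \<le> 1 \<Longrightarrow> norm (poly p s - poly p 0) \<le> K * norm s"
    by blast
  define r where "r = real (card (sp 0))"
  \<comment> \<open>small enough for the perturbation of the linear system to be absorbed by its diagonal\<close>
  define \<delta> where "\<delta> = 1 / (2 * r * K + 1)"
  have "r \<ge> 0" by (simp add: r_def)
  then have "2 * r * K + 1 \<ge> 1" using K(1) by simp
  then have \<delta>: "\<delta> > 0" "\<delta> \<le> 1" "r \<ge> 0"
    using \<open>r \<ge> 0\<close> le_imp_inverse_le[of 1 "2 * r * K + 1"]
    by (auto simp: \<delta>_def inverse_eq_divide intro!: add_nonneg_pos)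
  have "norm (c k s) \<le> 2 * r * K * norm s" if s: "norm s < \<delta>" and k: "k \<in> sp 0" for k s
  proof -
    define N where "N = (\<Sum>l\<in>sp 0. norm (c l s))"
    have N0: "N \<ge> 0" by (simp add: N_def sum_nonneg)
    have s1: "norm s \<le> 1" using s \<delta> by simp
    have each: "norm (c k s) \<le> K * norm s * (1 + N)" if k: "k \<in> sp 0" for k
    proof -
      let ?E = "\<lambda>l. poly (T (e l * e k)) s - poly (T (e l * e k)) 0"
      have "(\<Sum>l\<in>sp 0. c l s * poly (T (e l * e k)) s) = (\<Sum>l\<in>sp 0. c l s * ?E l + c l s * poly (T (e l * e k)) 0)"
        by (simp add: algebra_simps)
      also have "\<dots> = (\<Sum>l\<in>sp 0. c l s * ?E l) + (\<Sum>l\<in>sp 0. if l = k then c k s * mult_of k else 0)"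
        unfolding sum.distrib using k by (intro arg_cong2[where f = "(+)"] sum.cong) (auto simp: Te)
      also have "(\<Sum>l\<in>sp 0. if l = k then c k s * mult_of k else 0) = c k s * mult_of k"
        using k by simp
      finally have "c k s * mult_of k = - poly (T (Q * e k)) s - (\<Sum>l\<in>sp 0. c l s * ?E l)"
        using id[of "e k" s] by simp
      then have "norm (c k s) * norm (mult_of k) = norm (- poly (T (Q * e k)) s - (\<Sum>l\<in>sp 0. c l s * ?E l))"
        by (metis norm_mult)
      also have "\<dots> \<le> norm (poly (T (Q * e k)) s) + norm (\<Sum>l\<in>sp 0. c l s * ?E l)"
        using norm_triangle_ineq4[of "- poly (T (Q * e k)) s" "\<Sum>l\<in>sp 0. c l s * ?E l"]
        by (simp only: norm_minus_cancel)
      also have "\<dots> \<le> K * norm s + (\<Sum>l\<in>sp 0. norm (c l s) * (K * norm s))"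
      proof (rule add_mono)
        show "norm (poly (T (Q * e k)) s) \<le> K * norm s"
          using K(2)[of "T (Q * e k)" s] k s1 T0 by auto
        show "norm (\<Sum>l\<in>sp 0. c l s * ?E l) \<le> (\<Sum>l\<in>sp 0. norm (c l s) * (K * norm s))"
          using k s1 by (intro sum_norm_le) (auto simp: norm_mult intro!: mult_left_mono K(2))
      qed
      also have "\<dots> = K * norm s * (1 + N)" by (simp add: N_def sum_distrib_left algebra_simps)
      finally have "norm (c k s) * norm (mult_of k) \<le> K * norm s * (1 + N)" .
      moreover have "norm (c k s) * 1 \<le> norm (c k s) * norm (mult_of k)"
        by (intro mult_left_mono mult_of_ge_1 k) auto
      ultimately show ?thesis by linarith
    qed
    have "(\<Sum>l\<in>sp 0. norm (c l s)) \<le> (\<Sum>l\<in>sp 0. K * norm s * (1 + N))"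
      by (rule sum_mono[OF each])
    then have "N \<le> r * (K * norm s * (1 + N))" by (simp add: r_def N_def[symmetric])
    moreover have "2 * r * K * norm s \<le> 1"
    proof -
      have "2 * r * K * norm s \<le> 2 * r * K * \<delta>" using s \<delta> K(1) by (intro mult_left_mono) auto
      also have "\<dots> \<le> 1" using \<delta> K(1) by (simp add: \<delta>_def field_simps)
      finally show ?thesis .
    qed
    then have "2 * r * K * norm s * N \<le> 1 * N" using N0 by (rule mult_right_mono)
    ultimately have "N \<le> 2 * r * K * norm s" by (simp add: algebra_simps)
    moreover have "norm (c k s) \<le> N" unfolding N_def using k by (intro member_le_sum) auto
    ultimately show ?thesis by simp
  qed
  moreover have "2 * r * K \<ge> 0" using \<delta> K(1) by simp
  ultimately show ?thesis using \<delta> by blast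
qed

lemma sp_bounded: "\<exists>B\<ge>0. \<forall>s. norm s \<le> 1 \<longrightarrow> (\<forall>x\<in>sp s. norm x \<le> B)"
proof -
  define F where "F b = (\<Sum>i<n. \<Sum>j<n. norm (X b $$ (i, j)) + norm (Z b $$ (i, j)))" for b
  have F0: "F b \<ge> 0" for b by (simp only: F_def) (intro sum_nonneg add_nonneg_nonneg norm_ge_zero)
  have "norm x \<le> sum F I" if s: "norm s \<le> 1" and x: "x \<in> sp s" for s x
  proof -
    obtain b where b: "b \<in> I" "x \<in> spectrum (M b s)" using x by (auto simp: sp_def)
    have "norm x \<le> (\<Sum>i<n. \<Sum>j<n. norm (M b s $$ (i, j)))" by (rule spectrum_bound) (use b in auto)
    also have "\<dots> \<le> F b"
      unfolding F_def
    proof (intro sum_mono)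
      fix i j assume "i \<in> {..<n}" "j \<in> {..<n}"
      then have "M b s $$ (i, j) = X b $$ (i, j) + s * Z b $$ (i, j)"
        using X[OF b(1)] Z[OF b(1)] by (simp add: M_def)
      then have "norm (M b s $$ (i, j)) \<le> norm (X b $$ (i, j)) + norm s * norm (Z b $$ (i, j))"
        by (metis norm_mult norm_triangle_ineq)
      also have "norm s * norm (Z b $$ (i, j)) \<le> 1 * norm (Z b $$ (i, j))"
        by (rule mult_right_mono) (use s in auto)
      finally show "norm (M b s $$ (i, j)) \<le> norm (X b $$ (i, j)) + norm (Z b $$ (i, j))" by simp
    qed
    also have "F b \<le> sum F I" using b finite_I F0 by (intro member_le_sum) auto
    finally show ?thesis .
  qed
  then show ?thesis using F0 by (intro exI[of _ "sum F I"]) (auto intro: sum_nonneg)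
qed

text \<open>At an eigenvalue of the family at \<open>s\<close>, \<open>Q\<close> equals \<open>Q - Qs s\<close>, whose coordinates are \<open>O(s)\<close>.\<close>

lemma Q_linear_bound: "\<exists>K\<ge>0. \<exists>\<delta>>0. \<delta> \<le> 1 \<and> (\<forall>s. norm s < \<delta> \<longrightarrow> (\<forall>x\<in>sp s. norm (poly Q x) \<le> K * norm s))"
proof -
  obtain K \<delta> where K: "K \<ge> 0" "\<delta> > 0" "\<delta> \<le> 1" "\<And>s l. norm s < \<delta> \<Longrightarrow> l \<in> sp 0 \<Longrightarrow> norm (c l s) \<le> K * norm s"
    using c_linear_bound by blast
  obtain B where B: "\<And>s x. norm s \<le> 1 \<Longrightarrow> x \<in> sp s \<Longrightarrow> norm x \<le> B" using sp_bounded by blast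
  let ?P = "\<lambda>l C. \<forall>x. norm x \<le> B \<longrightarrow> norm (poly (e l) x) \<le> C"
  have "\<exists>C\<ge>0. \<forall>l\<in>sp 0. ?P l C"
    by (rule uniform_bound) (auto intro: poly_bounded_ball order.trans)
  then obtain C where C: "C \<ge> 0" "\<And>l x. l \<in> sp 0 \<Longrightarrow> norm x \<le> B \<Longrightarrow> norm (poly (e l) x) \<le> C" by blast
  have "norm (poly Q x) \<le> real (card (sp 0)) * (K * C) * norm s" if s: "norm s < \<delta>" and x: "x \<in> sp s" for s x
  proof -
    have "0 = poly Q x + (\<Sum>l\<in>sp 0. c l s * poly (e l) x)"
      using Qs_root[OF x] by (simp add: Qs_interpolation poly_sum)
    then have "norm (poly Q x) = norm (\<Sum>l\<in>sp 0. c l s * poly (e l) x)"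
      by (metis add.inverse_unique norm_minus_cancel add.commute)
    also have "\<dots> \<le> (\<Sum>l\<in>sp 0. (K * norm s) * C)"
      using s x B[of s x] K C by (intro sum_norm_le) (auto simp: norm_mult intro!: mult_mono)
    finally show ?thesis by (simp add: algebra_simps)
  qed
  then show ?thesis using K C by (intro exI[of _ "real (card (sp 0)) * (K * C)"]) auto
qed

end

section \<open>Second-order expansion of the resolvent\<close>

lemma square_inverse_ex:
  fixes A :: "'a::field mat"
  assumes A: "A \<in> carrier_mat n n" and inj: "\<And>v. v \<in> carrier_vec n \<Longrightarrow> A *\<^sub>v v = 0\<^sub>v n \<Longrightarrow> v = 0\<^sub>v n"
  shows "\<exists>B\<in>carrier_mat n n. A * B = 1\<^sub>m n \<and> B * A = 1\<^sub>m n"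
proof -
  have "det A \<noteq> 0" using det_0_iff_vec_prod_zero_field[OF A] inj by blast
  from det_non_zero_imp_unit[OF A this, of "()"] show ?thesis
    by (auto simp: Units_def ring_mat_def)
qed

lemma resolvent_ex:
  assumes A: "A \<in> carrier_mat n n" and z: "z \<notin> spectrum A"
  shows "\<exists>R. is_resolvent n A z R"
proof -
  have "v = 0\<^sub>v n" if v: "v \<in> carrier_vec n" "(z \<cdot>\<^sub>m 1\<^sub>m n - A) *\<^sub>v v = 0\<^sub>v n" for v
  proof (rule ccontr)
    assume nz: "v \<noteq> 0\<^sub>v n"
    have "(z \<cdot>\<^sub>m 1\<^sub>m n - A) *\<^sub>v v = z \<cdot>\<^sub>v v - A *\<^sub>v v"
    proof -
      have "z \<cdot>\<^sub>m 1\<^sub>m n *\<^sub>v v = z \<cdot>\<^sub>v v" using v(1) by (intro eq_vecI) auto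
      then show ?thesis using A v(1) by (simp add: minus_mult_distrib_mat_vec[of _ n n])
    qed
    then have 0: "z \<cdot>\<^sub>v v - A *\<^sub>v v = 0\<^sub>v n" using v(2) by simp
    have "A *\<^sub>v v = z \<cdot>\<^sub>v v"
    proof (rule eq_vecI)
      fix i assume "i < dim_vec (z \<cdot>\<^sub>v v)"
      then have i: "i < n" using v(1) by simp
      have "(z \<cdot>\<^sub>v v - A *\<^sub>v v) $ i = 0" using 0 i by simp
      then show "(A *\<^sub>v v) $ i = (z \<cdot>\<^sub>v v) $ i" using i A v(1) by simp
    qed (use A v in auto)
    then show False using z nz v(1) A by (auto simp: spectrum_def eigenvalue_def eigenvector_def)
  qed
  then show ?thesis
    using square_inverse_ex[of "z \<cdot>\<^sub>m 1\<^sub>m n - A" n] A unfolding is_resolvent_def by (metis one_carrier_mat smult_carrier_mat square_carrier(2))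
qed

text \<open>The resolvent identity.\<close>

lemma resolvent_perturb:
  assumes X: "X \<in> carrier_mat n n" and Z: "Z \<in> carrier_mat n n"
    and R: "is_resolvent n X z R" and S: "is_resolvent n (X + s \<cdot>\<^sub>m Z) z S"
  shows "S = R + s \<cdot>\<^sub>m (R * (Z * S))"
proof -
  have cR: "R \<in> carrier_mat n n" "R * (z \<cdot>\<^sub>m 1\<^sub>m n - X) = 1\<^sub>m n" using R by (auto simp: is_resolvent_def)
  have cS: "S \<in> carrier_mat n n" "(z \<cdot>\<^sub>m 1\<^sub>m n - (X + s \<cdot>\<^sub>m Z)) * S = 1\<^sub>m n" using S by (auto simp: is_resolvent_def)
  let ?D = "z \<cdot>\<^sub>m 1\<^sub>m n - X"
  have D: "?D \<in> carrier_mat n n" using X by auto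
  have "z \<cdot>\<^sub>m 1\<^sub>m n - (X + s \<cdot>\<^sub>m Z) = ?D - s \<cdot>\<^sub>m Z" using X Z by (intro eq_matI) auto
  then have "?D * S - s \<cdot>\<^sub>m (Z * S) = 1\<^sub>m n"
    using cS D Z by (simp add: square_distribs[where n=n] square_smult[where n=n])
  then have "R * (?D * S - s \<cdot>\<^sub>m (Z * S)) = R" using cR by simp
  then have "R * ?D * S - s \<cdot>\<^sub>m (R * (Z * S)) = R"
    using cR(1) cS(1) D Z by (simp add: square_distribs[where n=n] square_smult[where n=n] square_assoc[where n=n])
  then have e: "S - s \<cdot>\<^sub>m (R * (Z * S)) = R" using cR cS by simp
  show ?thesis
  proof (rule eq_matI)
    fix i j assume "i < dim_row (R + s \<cdot>\<^sub>m (R * (Z * S)))" "j < dim_col (R + s \<cdot>\<^sub>m (R * (Z * S)))"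
    then have ij: "i < n" "j < n" using cR cS Z by auto
    have "(S - s \<cdot>\<^sub>m (R * (Z * S))) $$ (i, j) = R $$ (i, j)" using e by simp
    then show "S $$ (i, j) = (R + s \<cdot>\<^sub>m (R * (Z * S))) $$ (i, j)"
      using ij cR cS Z by (simp add: diff_eq_eq del: index_mult_mat(1))
  qed (use cR cS Z in auto)
qed

definition entry_bound :: "nat \<Rightarrow> complex mat \<Rightarrow> real \<Rightarrow> bool" where
  "entry_bound n A K \<longleftrightarrow> (\<forall>i<n. \<forall>j<n. norm (A $$ (i, j)) \<le> K)"

lemma entry_bound_mult:
  assumes A: "A \<in> carrier_mat n n" "entry_bound n A K" and B: "B \<in> carrier_mat n n" "entry_bound n B L"
    and "K \<ge> 0"
  shows "entry_bound n (A * B) (real n * (K * L))"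
  unfolding entry_bound_def
proof (intro allI impI)
  fix i j assume ij: "i < n" "j < n"
  have "(A * B) $$ (i, j) = (\<Sum>k<n. A $$ (i, k) * B $$ (k, j))"
    using ij A B by (simp add: scalar_prod_def atLeast0LessThan)
  also have "norm \<dots> \<le> (\<Sum>k<n. K * L)"
    using ij A B assms(5) by (intro sum_norm_le) (auto simp: entry_bound_def norm_mult intro!: mult_mono)
  finally show "norm ((A * B) $$ (i, j)) \<le> real n * (K * L)" by simp
qed

lemma entry_bound_trace:
  assumes "A \<in> carrier_mat n n" "entry_bound n A K"
  shows "norm (mat_trace A) \<le> real n * K"
proof -
  have "norm (mat_trace A) \<le> (\<Sum>i<n. K)"
    unfolding mat_trace_def carrier_matD(1)[OF assms(1)] using assms
    by (intro sum_norm_le) (auto simp: entry_bound_def)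
  then show ?thesis by simp
qed

lemma entry_bound_ex: "\<exists>K\<ge>0. entry_bound n A K"
proof -
  have "norm (A $$ (i, j)) \<le> (\<Sum>i<n. \<Sum>j<n. norm (A $$ (i, j)))" if "i < n" "j < n" for i j
  proof -
    have "norm (A $$ (i, j)) \<le> (\<Sum>j<n. norm (A $$ (i, j)))"
      using that by (intro member_le_sum) auto
    also have "\<dots> \<le> (\<Sum>i<n. \<Sum>j<n. norm (A $$ (i, j)))"
      using that by (intro member_le_sum[where f = "\<lambda>i. \<Sum>j<n. norm (A $$ (i, j))"]) (auto intro: sum_nonneg)
    finally show ?thesis .
  qed
  then show ?thesis unfolding entry_bound_def by (intro exI[of _ "\<Sum>i<n. \<Sum>j<n. norm (A $$ (i, j))"]) (auto intro!: sum_nonneg)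
qed

text \<open>In \<open>S = R + s R Z S\<close> the last term is at most half of \<open>S\<close> when \<open>s\<close> is small.\<close>

lemma resolvent_bounded:
  assumes X: "X \<in> carrier_mat n n" and Z: "Z \<in> carrier_mat n n" and R: "is_resolvent n X z R"
  shows "\<exists>K\<ge>0. \<exists>\<delta>>0. \<forall>s S. norm s < \<delta> \<longrightarrow> is_resolvent n (X + s \<cdot>\<^sub>m Z) z S \<longrightarrow> entry_bound n S K"
proof -
  obtain K where K: "K \<ge> 0" "entry_bound n R K" using entry_bound_ex by blast
  obtain L where L: "L \<ge> 0" "entry_bound n (R * Z) L" using entry_bound_ex by blast
  have cR: "R \<in> carrier_mat n n" using R by (auto simp: is_resolvent_def)
  define \<delta> where "\<delta> = 1 / (2 * (real n * L) + 1)"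
  have "2 * (real n * L) + 1 > 0" using L(1) by (intro add_nonneg_pos) auto
  then have \<delta>: "\<delta> > 0" "\<delta> * (real n * L) \<le> 1 / 2" by (auto simp: \<delta>_def field_simps)
  have "entry_bound n S (2 * K)" if s: "norm s < \<delta>" and S: "is_resolvent n (X + s \<cdot>\<^sub>m Z) z S" for s S
  proof (cases "n = 0")
    case False
    have cS: "S \<in> carrier_mat n n" using S by (auto simp: is_resolvent_def)
    define m where "m = Max ((\<lambda>(i, j). norm (S $$ (i, j))) ` ({..<n} \<times> {..<n}))"
    have le: "norm (S $$ (i, j)) \<le> m" if "i < n" "j < n" for i j
      unfolding m_def using that by (intro Max_ge) auto
    have "m \<in> (\<lambda>(i, j). norm (S $$ (i, j))) ` ({..<n} \<times> {..<n})"
      unfolding m_def using False by (intro Max_in) auto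
    then obtain i j where ij: "i < n" "j < n" "m = norm (S $$ (i, j))" by auto
    have m0: "m \<ge> 0" using ij by simp
    have "entry_bound n ((R * Z) * S) (real n * (L * m))"
      by (rule entry_bound_mult) (use cR Z cS L le in \<open>auto simp: entry_bound_def simp del: index_mult_mat(1)\<close>)
    then have b: "norm ((R * (Z * S)) $$ (i, j)) \<le> real n * (L * m)"
      using ij cR Z cS by (simp add: entry_bound_def square_assoc[where n=n] del: index_mult_mat(1))
    have "S $$ (i, j) = R $$ (i, j) + s * (R * (Z * S)) $$ (i, j)"
      by (subst resolvent_perturb[OF X Z R S]) (use ij cR cS Z in \<open>simp del: index_mult_mat(1)\<close>)
    then have "m \<le> norm (R $$ (i, j)) + norm s * norm ((R * (Z * S)) $$ (i, j))"
      unfolding ij(3) by (metis norm_mult norm_triangle_ineq)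
    also have "\<dots> \<le> K + \<delta> * (real n * (L * m))"
      using K ij s b \<delta>(1) by (intro add_mono mult_mono) (auto simp: entry_bound_def)
    also have "\<dots> = K + (\<delta> * (real n * L)) * m" by simp
    also have "\<dots> \<le> K + 1 / 2 * m" using \<delta>(2) m0 by (intro add_left_mono mult_right_mono)
    finally have "m \<le> 2 * K" by simp
    then show ?thesis using le unfolding entry_bound_def by (meson order.trans)
  qed (simp add: entry_bound_def)
  then show ?thesis using K \<delta>(1) by (intro exI[of _ "2 * K"]) auto
qed

text \<open>A polynomial in \<open>s\<close> that is \<open>O(s\<^sup>k)\<close> has no terms of order below \<open>k\<close>; this is how estimates are
  turned into identities between Taylor coefficients.\<close>

lemma poly_bigo_coeff:
  fixes p :: "complex poly"
  assumes "poly p \<in> O[at 0](\<lambda>s. s ^ k)" "i < k"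
  shows "coeff p i = 0"
  using assms
proof (induction k arbitrary: p i)
  case 0
  from \<open>i < 0\<close> show ?case by (rule less_zeroE)
next
  case (Suc k)
  obtain c where c: "eventually (\<lambda>s. norm (poly p s) \<le> c * norm (s ^ Suc k)) (at 0)"
    using Suc.prems(1) by (auto elim: landau_o.bigE)
  have "(\<lambda>s :: complex. s ^ Suc k) \<midarrow>0\<rightarrow> 0 ^ Suc k"
    by (intro tendsto_intros)
  then have "(\<lambda>s. s ^ Suc k) \<midarrow>0\<rightarrow> (0 :: complex)" by simp
  then have "(\<lambda>s. poly p s) \<midarrow>0\<rightarrow> 0"
    by (rule tendsto_0_le[where K = c]) (use c in \<open>simp add: mult.commute\<close>)
  moreover have "(\<lambda>s. poly p s) \<midarrow>0\<rightarrow> poly p 0"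
    using poly_isCont[of 0 p] by (simp add: isCont_def)
  ultimately have p0: "poly p 0 = 0" using LIM_unique by blast
  then obtain q where p: "p = pCons 0 q" by (cases p) auto
  have "(\<lambda>s. s * poly q s) \<in> O[at 0](\<lambda>s. s * s ^ k)"
    using Suc.prems(1) by (simp add: p)
  then have "poly q \<in> O[at 0](\<lambda>s. s ^ k)"
    by (subst (asm) landau_o.big.mult_cancel_left) (auto simp: eventually_at_filter)
  from Suc.IH[OF this] show ?case using Suc.prems(2) unfolding p by (cases i) simp_all
qed

lemma square_expand: "(a + b * c)^2 = a^2 + (2 * a * c + b * c^2) * (b :: 'a :: comm_ring_1)"
  by (simp add: power2_eq_square algebra_simps)

context spectral_line
begin

text \<open>An eigenvalue \<open>x\<close> for small \<open>s\<close> satisfies \<open>Q x = O(s)\<close>, while \<open>Q z\<close> is a nonzero constant; so \<open>x\<close> stays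
  away from \<open>z\<close>.\<close>

lemma separation:
  assumes z: "z \<notin> sp 0"
  shows "\<exists>H\<ge>0. \<exists>\<delta>>0. \<forall>s. norm s < \<delta> \<longrightarrow> (\<forall>x\<in>sp s. x \<noteq> z \<and> norm (1 / (z - x)) \<le> H)"
proof -
  obtain K \<delta> where K: "K \<ge> 0" "\<delta> > 0" "\<delta> \<le> 1" "\<And>s x. norm s < \<delta> \<Longrightarrow> x \<in> sp s \<Longrightarrow> norm (poly Q x) \<le> K * norm s"
    using Q_linear_bound by blast
  obtain B where B: "\<And>s x. norm s \<le> 1 \<Longrightarrow> x \<in> sp s \<Longrightarrow> norm x \<le> B" using sp_bounded by blast
  obtain C where C: "C \<ge> 0" "\<And>x. norm x \<le> B \<Longrightarrow> norm (poly (synthetic_div Q z) x) \<le> C"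
    using poly_bounded_ball by blast
  define q where "q = norm (poly Q z)"
  have q: "q > 0" using z by (simp add: q_def Q_def poly_root_poly)
  define \<delta>' where "\<delta>' = min \<delta> (q / (2 * (K + 1)))"
  have "x \<noteq> z \<and> norm (1 / (z - x)) \<le> 2 * C / q" if s: "norm s < \<delta>'" and x: "x \<in> sp s" for s x
  proof -
    have "norm (poly Q x) \<le> K * norm s" using K(4) s x by (simp add: \<delta>'_def)
    also have "\<dots> \<le> (K + 1) * (q / (2 * (K + 1)))"
      using s K(1) by (intro mult_mono) (auto simp: \<delta>'_def)
    also have "\<dots> = q / 2" using K(1) by (simp add: field_simps)
    finally have small: "norm (poly Q x) \<le> q / 2" .
    then have ne: "x \<noteq> z" using q by (auto simp: q_def)
    have "q \<le> norm (poly Q z - poly Q x) + norm (poly Q x)"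
      unfolding q_def by (metis diff_add_cancel norm_triangle_ineq)
    also have "poly Q z - poly Q x = (z - x) * poly (synthetic_div Q z) x"
      using arg_cong[OF synthetic_div_correct'[of z Q], of "\<lambda>p. poly p x"] by (simp add: algebra_simps)
    finally have "q / 2 \<le> norm (z - x) * C"
      using small C(2)[OF B[of s x]] s x K(3)
        mult_left_mono[of "norm (poly (synthetic_div Q z) x)" C "norm (z - x)"]
      by (simp add: norm_mult \<delta>'_def)
    then show ?thesis using ne q by (simp add: norm_divide field_simps)
  qed
  moreover have "\<delta>' > 0" "2 * C / q \<ge> 0" using K q C by (auto simp: \<delta>'_def intro!: divide_pos_pos)
  ultimately show ?thesis by blast
qed

text \<open>Write \<open>P = Q\<^sup>k\<close> and let \<open>D(x) = (P(z) - P(x)) / (z - x)\<close>, a polynomial in \<open>x\<close> (a synthetic division).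
  For an eigenvalue \<open>x\<close> at \<open>s\<close> this reads \<open>P(z) / (z - x) = D(x) + P(x) / (z - x)\<close> with
  \<open>P(x) = O(s\<^sup>k)\<close>.  Summing over the eigenvalues, and doing the same with the squares, shows that up
  to \<open>O(s\<^sup>k)\<close> the traces of the resolvent and of its square are traces of polynomials, once they are
  multiplied by \<open>P(z)\<close> and \<open>P(z)\<^sup>2\<close>.\<close>

lemma line_trace_remainder:
  assumes b: "b \<in> I" and z: "z \<notin> sp 0"
  shows "\<exists>S K. eventually (\<lambda>s. is_resolvent n (M b s) z (S s) \<and> entry_bound n (S s) K) (at 0) \<and> K \<ge> 0 \<and>
    (\<lambda>s. poly (Q ^ k) z * mat_trace (S s) - poly (LT b (synthetic_div (Q ^ k) z)) s) \<in> O[at 0](\<lambda>s. s ^ k) \<and>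
    (\<lambda>s. (poly (Q ^ k) z)^2 * mat_trace (S s * S s) - poly (LT b ((synthetic_div (Q ^ k) z)^2)) s) \<in> O[at 0](\<lambda>s. s ^ k)"
proof -
  obtain R where R: "is_resolvent n (X b) z R"
    using resolvent_ex[OF X[OF b], of z] z b by (auto simp: sp_0)
  obtain H \<delta>1 where H: "H \<ge> 0" "\<delta>1 > 0" "\<And>s x. norm s < \<delta>1 \<Longrightarrow> x \<in> sp s \<Longrightarrow> x \<noteq> z \<and> norm (1 / (z - x)) \<le> H"
    using separation[OF z] by blast
  obtain L \<delta>2 where L: "L \<ge> 0" "\<delta>2 > 0" "\<And>s S. norm s < \<delta>2 \<Longrightarrow> is_resolvent n (X b + s \<cdot>\<^sub>m Z b) z S \<Longrightarrow> entry_bound n S L"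
    using resolvent_bounded[OF X[OF b] Z[OF b] R] by blast
  obtain K \<delta>3 where K: "K \<ge> 0" "\<delta>3 > 0" "\<delta>3 \<le> 1" "\<And>s x. norm s < \<delta>3 \<Longrightarrow> x \<in> sp s \<Longrightarrow> norm (poly Q x) \<le> K * norm s"
    using Q_linear_bound by blast
  obtain B where B: "\<And>s x. norm s \<le> 1 \<Longrightarrow> x \<in> sp s \<Longrightarrow> norm x \<le> B" using sp_bounded by blast
  let ?P = "Q ^ k" and ?D = "synthetic_div (Q ^ k) z"
  obtain C where C: "C \<ge> 0" "\<And>x. norm x \<le> B \<Longrightarrow> norm (poly ?D x) \<le> C"
    using poly_bounded_ball by blast
  obtain C' where C': "C' \<ge> 0" "\<And>x. norm x \<le> B \<Longrightarrow> norm (poly ?P x) \<le> C'"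
    using poly_bounded_ball by blast
  define \<delta> where "\<delta> = min \<delta>1 (min \<delta>2 \<delta>3)"
  have ev: "eventually (\<lambda>s. norm s < \<delta>) (at (0 :: complex))"
    using H(2) L(2) K(2) by (auto simp: eventually_at \<delta>_def intro!: exI[of _ \<delta>])
  define S where "S s = (SOME R. is_resolvent n (M b s) z R)" for s
  have S: "is_resolvent n (M b s) z (S s)" if "norm s < \<delta>" for s
  proof -
    have "z \<notin> spectrum (M b s)" using H(3)[of s z] that b by (auto simp: \<delta>_def sp_def)
    from resolvent_ex[OF M_carrier[OF b] this] show ?thesis
      unfolding S_def by (rule someI_ex)
  qed
  define E1 where "E1 = real n * (K ^ k * H)"
  define E2 where "E2 = real n * ((2 * C * H + C' * H ^ 2) * K ^ k)"
  have key: "norm (poly ?P z * mat_trace (S s) - poly (LT b ?D) s) \<le> E1 * norm (s ^ k) \<and>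
     norm ((poly ?P z)^2 * mat_trace (S s * S s) - poly (LT b (?D^2)) s) \<le> E2 * norm (s ^ k)"
    if s: "norm s < \<delta>" for s
  proof -
    have zs: "z \<notin> spectrum (M b s)" using H(3)[of s z] s b by (auto simp: \<delta>_def sp_def)
    obtain d where d: "d ` {..<n} = spectrum (M b s)"
      "\<And>p. mat_trace (mat_poly n (M b s) p) = (\<Sum>i<n. poly p (d i))"
      "\<And>z R k. is_resolvent n (M b s) z R \<Longrightarrow> z \<notin> spectrum (M b s) \<Longrightarrow>
         mat_trace (((*) R ^^ k) R) = (\<Sum>i<n. 1 / (z - d i) ^ Suc k)"
      by (rule spectral_calculus[OF M_carrier[OF b, of s]], rule that) auto
    have LT: "poly (LT b p) s = (\<Sum>i<n. poly p (d i))" for p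
      using d(2) poly_line_trace[OF X[OF b] Z[OF b]] by (simp add: M_def)
    have tr: "mat_trace (S s) = (\<Sum>i<n. 1 / (z - d i))" "mat_trace (S s * S s) = (\<Sum>i<n. (1 / (z - d i))^2)"
      using d(3)[OF S[OF s] zs, of 0] d(3)[OF S[OF s] zs, of 1] by (simp_all add: power2_eq_square)
    have di: "d i \<in> sp s" if "i < n" for i using d(1) b that by (auto simp: sp_def)
    have h: "norm (1 / (z - d i)) \<le> H" "d i \<noteq> z" "norm (poly ?P (d i)) \<le> K ^ k * norm (s ^ k)"
      "norm (poly ?D (d i)) \<le> C" "norm (poly ?P (d i)) \<le> C'" if "i < n" for i
    proof -
      show "norm (1 / (z - d i)) \<le> H" "d i \<noteq> z" using H(3)[of s "d i"] di[OF that] s by (auto simp: \<delta>_def)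
      have "norm (poly Q (d i)) \<le> K * norm s" using K(4)[of s "d i"] di[OF that] s by (auto simp: \<delta>_def)
      then show "norm (poly ?P (d i)) \<le> K ^ k * norm (s ^ k)"
        by (simp add: poly_power norm_power power_mult_distrib[symmetric] power_mono)
      have "norm (d i) \<le> B" using B[of s "d i"] di[OF that] s K(3) by (auto simp: \<delta>_def)
      then show "norm (poly ?D (d i)) \<le> C" "norm (poly ?P (d i)) \<le> C'" using C C' by auto
    qed
    have split: "poly ?P z * (1 / (z - d i)) = poly ?D (d i) + poly ?P (d i) * (1 / (z - d i))" if "i < n" for i
      using arg_cong[OF synthetic_div_correct'[of z ?P], of "\<lambda>p. poly p (d i)"] h(2)[OF that]
      by (simp add: field_simps)
    have "poly ?P z * mat_trace (S s) - poly (LT b ?D) s = (\<Sum>i<n. poly ?P (d i) * (1 / (z - d i)))"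
      unfolding tr LT sum_distrib_left sum_subtractf[symmetric]
      by (rule sum.cong[OF refl]) (subst split; simp)
    also have "norm \<dots> \<le> (\<Sum>i<n. K ^ k * norm (s ^ k) * H)"
    proof (rule sum_norm_le)
      fix i assume "i \<in> {..<n}"
      then have i: "i < n" by simp
      show "norm (poly ?P (d i) * (1 / (z - d i))) \<le> K ^ k * norm (s ^ k) * H"
        unfolding norm_mult[of "poly ?P (d i)"] using h[OF i] K(1) by (intro mult_mono) auto
    qed
    also have "\<dots> = E1 * norm (s ^ k)" by (simp add: E1_def)
    finally have 1: "norm (poly ?P z * mat_trace (S s) - poly (LT b ?D) s) \<le> E1 * norm (s ^ k)" .
    let ?r = "\<lambda>i. (2 * poly ?D (d i) * (1 / (z - d i)) + poly ?P (d i) * (1 / (z - d i))^2) * poly ?P (d i)"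
    have split2: "(poly ?P z)^2 * (1 / (z - d i))^2 = poly (?D^2) (d i) + ?r i" if "i < n" for i
    proof -
      have "(poly ?P z)^2 * (1 / (z - d i))^2 = (poly ?P z * (1 / (z - d i)))^2" by (simp only: power_mult_distrib)
      also have "\<dots> = poly (?D^2) (d i) + ?r i"
        unfolding split[OF that] poly_power[of ?D] by (rule square_expand)
      finally show ?thesis .
    qed
    have "(poly ?P z)^2 * mat_trace (S s * S s) - poly (LT b (?D^2)) s
        = (\<Sum>i<n. (poly ?P z)^2 * (1 / (z - d i))^2 - poly (?D^2) (d i))"
      unfolding tr LT sum_distrib_left sum_subtractf ..
    also have "\<dots> = (\<Sum>i<n. ?r i)"
      by (rule sum.cong[OF refl]) (subst split2; simp)
    also have "norm \<dots> \<le> (\<Sum>i<n. (2 * C * H + C' * H^2) * (K ^ k * norm (s ^ k)))"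
    proof (rule sum_norm_le)
      fix i assume "i \<in> {..<n}"
      then have i: "i < n" by simp
      have "norm (2 * poly ?D (d i) * (1 / (z - d i)) + poly ?P (d i) * (1 / (z - d i))^2) \<le>
          norm (2 * poly ?D (d i) * (1 / (z - d i))) + norm (poly ?P (d i) * (1 / (z - d i))^2)"
        by (rule norm_triangle_ineq)
      also have "\<dots> = 2 * norm (poly ?D (d i)) * norm (1 / (z - d i)) + norm (poly ?P (d i)) * norm (1 / (z - d i))^2"
        by (simp only: norm_mult norm_power norm_numeral)
      also have "\<dots> \<le> 2 * C * H + C' * H^2"
        using h[OF i] H(1) C(1) C'(1) by (intro add_mono mult_mono power_mono) auto
      finally show "norm (?r i) \<le> (2 * C * H + C' * H^2) * (K ^ k * norm (s ^ k))"
        unfolding norm_mult[of _ "poly ?P (d i)"] using h[OF i] H(1) C(1) C'(1)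
        by (intro mult_mono) auto
    qed
    also have "\<dots> = E2 * norm (s ^ k)" by (simp add: E2_def)
    finally show ?thesis using 1 by blast
  qed
  have "(\<lambda>s. poly ?P z * mat_trace (S s) - poly (LT b ?D) s) \<in> O[at 0](\<lambda>s. s ^ k)"
    by (rule bigoI[of _ E1]) (use key in \<open>auto intro: eventually_mono[OF ev]\<close>)
  moreover have "(\<lambda>s. (poly ?P z)^2 * mat_trace (S s * S s) - poly (LT b (?D^2)) s) \<in> O[at 0](\<lambda>s. s ^ k)"
    by (rule bigoI[of _ E2]) (use key in \<open>auto intro: eventually_mono[OF ev]\<close>)
  moreover have "eventually (\<lambda>s. is_resolvent n (M b s) z (S s) \<and> entry_bound n (S s) L) (at 0)"
    using ev by eventually_elim (use S L(3) in \<open>auto simp: M_def \<delta>_def\<close>)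
  ultimately show ?thesis using L(1) by blast
qed

end

lemma bigo_cmult: "f \<in> O[F](g) \<Longrightarrow> (\<lambda>x. c * f x :: complex) \<in> O[F](g)"
  by (cases "c = 0") simp_all

context spectral_line
begin

lemma trace_resolvent_step:
  assumes b: "b \<in> I" and R: "is_resolvent n (X b) z R" and S: "is_resolvent n (M b s) z S"
    and A: "A \<in> carrier_mat n n" and B: "B \<in> carrier_mat n n"
  shows "mat_trace (A * S) = mat_trace (A * R) + s * mat_trace (A * (R * Z b) * S)"
    and "mat_trace (A * S * B) = mat_trace (A * R * B) + s * mat_trace (A * (R * Z b) * S * B)"
proof -
  have c: "R \<in> carrier_mat n n" "S \<in> carrier_mat n n" using R S by (auto simp: is_resolvent_def)
  have S_eq: "S = R + s \<cdot>\<^sub>m (R * (Z b * S))"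
    using resolvent_perturb[OF X[OF b] Z[OF b] R] S by (simp add: M_def)
  have "A * S = A * (R + s \<cdot>\<^sub>m (R * (Z b * S)))" using S_eq by (rule arg_cong)
  also have "\<dots> = A * R + s \<cdot>\<^sub>m (A * (R * Z b) * S)"
    using A c Z[OF b] by (simp add: square_simps[where n=n])
  finally have AS: "A * S = A * R + s \<cdot>\<^sub>m (A * (R * Z b) * S)" .
  show "mat_trace (A * S) = mat_trace (A * R) + s * mat_trace (A * (R * Z b) * S)"
    unfolding AS using A c Z[OF b] by (simp add: mat_trace_linear[of _ n])
  show "mat_trace (A * S * B) = mat_trace (A * R * B) + s * mat_trace (A * (R * Z b) * S * B)"
    unfolding AS using A B c Z[OF b] by (simp add: square_distribs[where n=n] square_smult[where n=n] mat_trace_linear[of _ n])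
qed

lemma bounded_trace_bigo:
  assumes "eventually (\<lambda>s. S s \<in> carrier_mat n n \<and> entry_bound n (S s) K) (at 0)"
    and A: "A \<in> carrier_mat n n"
  shows "(\<lambda>s. s ^ k * mat_trace (A * S s)) \<in> O[at 0](\<lambda>s. s ^ k)"
proof -
  obtain L where L: "L \<ge> 0" "entry_bound n A L" using entry_bound_ex by blast
  show ?thesis
  proof (rule bigoI[of _ "real n * (real n * (L * K))"])
    show "eventually (\<lambda>s. norm (s ^ k * mat_trace (A * S s)) \<le> real n * (real n * (L * K)) * norm (s ^ k)) (at 0)"
      using assms(1)
    proof eventually_elim
      case (elim s)
      have "norm (mat_trace (A * S s)) \<le> real n * (real n * (L * K))"
        using elim A L by (intro entry_bound_trace entry_bound_mult) auto
      then show ?case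
        unfolding norm_mult mult.commute[of "norm (s ^ k)"] by (rule mult_right_mono) simp
    qed
  qed
qed

text \<open>Iterating \<open>S = R + s R Z S\<close> three times gives \<open>tr S = tr R + s tr(RZR) + s\<^sup>2 tr(RZRZR) + O(s\<^sup>3)\<close>; compare
  the coefficients of \<open>s\<^sup>2\<close> with \<open>line_trace_remainder\<close> for \<open>k = 3\<close>.  The point is that the right-hand
  side is polynomial in \<open>z\<close>, so \<open>tr(RZRZR)\<close> has no worse poles than \<open>Q\<^sup>-\<^sup>3\<close>.\<close>

lemma second_order_coeff:
  assumes b: "b \<in> I" and z: "z \<notin> sp 0" and R: "is_resolvent n (X b) z R"
  shows "poly (Q ^ 3) z * mat_trace (R * Z b * (R * Z b) * R) = coeff (LT b (synthetic_div (Q ^ 3) z)) 2"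
proof -
  obtain S K where ev: "eventually (\<lambda>s. is_resolvent n (M b s) z (S s) \<and> entry_bound n (S s) K) (at 0)"
    and O: "(\<lambda>s. poly (Q ^ 3) z * mat_trace (S s) - poly (LT b (synthetic_div (Q ^ 3) z)) s) \<in> O[at 0](\<lambda>s. s ^ 3)"
    using line_trace_remainder[OF b z, of 3] by blast
  define N where "N = R * Z b"
  have c: "R \<in> carrier_mat n n" "N \<in> carrier_mat n n" using R Z[OF b] by (auto simp: is_resolvent_def N_def)
  let ?p = "smult (poly (Q ^ 3) z) [:mat_trace R, mat_trace (N * R), mat_trace (N * N * R):] - LT b (synthetic_div (Q ^ 3) z)"
  let ?rest = "\<lambda>s. s ^ 3 * mat_trace (N * N * N * S s)"
  have "eventually (\<lambda>s. mat_trace (S s) = poly [:mat_trace R, mat_trace (N * R), mat_trace (N * N * R):] s + ?rest s) (at 0)"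
    using ev
  proof eventually_elim
    case (elim s)
    then have S: "is_resolvent n (M b s) z (S s)" "S s \<in> carrier_mat n n" by (auto simp: is_resolvent_def)
    note step = trace_resolvent_step(1)[OF b R S(1) _ one_carrier_mat, folded N_def]
    show ?case
      using step[of "1\<^sub>m n"] step[of N] step[of "N * N"] c S(2)
      by (simp add: algebra_simps power3_eq_cube power2_eq_square)
  qed
  then have "eventually (\<lambda>s. poly ?p s = (poly (Q ^ 3) z * mat_trace (S s) - poly (LT b (synthetic_div (Q ^ 3) z)) s)
      - poly (Q ^ 3) z * ?rest s) (at 0)"
    by eventually_elim (simp add: algebra_simps)
  moreover have "(\<lambda>s. (poly (Q ^ 3) z * mat_trace (S s) - poly (LT b (synthetic_div (Q ^ 3) z)) s)
      - poly (Q ^ 3) z * ?rest s) \<in> O[at 0](\<lambda>s. s ^ 3)"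
  proof (rule sum_in_bigo(2)[OF O])
    have "?rest \<in> O[at 0](\<lambda>s. s ^ 3)"
      by (rule bounded_trace_bigo[of S K]) (use ev c in \<open>auto simp: is_resolvent_def elim: eventually_mono\<close>)
    then show "(\<lambda>s. poly (Q ^ 3) z * ?rest s) \<in> O[at 0](\<lambda>s. s ^ 3)" by (rule bigo_cmult)
  qed
  ultimately have "poly ?p \<in> O[at 0](\<lambda>s. s ^ 3)"
    by (subst landau_o.big.in_cong) auto
  from poly_bigo_coeff[OF this, of 2] show ?thesis by (simp add: numeral_2_eq_2 N_def)
qed

text \<open>The coefficient of \<open>s\<close> in \<open>tr S\<^sup>2\<close> is \<open>2 tr(Z R\<^sup>3)\<close>; compare with \<open>line_trace_remainder\<close> for \<open>k = 2\<close>.  Hence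
  \<open>tr(Z R\<^sup>3)\<close> has no worse poles than \<open>Q\<^sup>-\<^sup>4\<close>.\<close>

lemma first_order_coeff:
  assumes b: "b \<in> I" and z: "z \<notin> sp 0" and R: "is_resolvent n (X b) z R"
  shows "(poly (Q ^ 2) z)^2 * (2 * mat_trace (Z b * (R * R * R))) = coeff (LT b ((synthetic_div (Q ^ 2) z)^2)) 1"
proof -
  obtain S K where ev: "eventually (\<lambda>s. is_resolvent n (M b s) z (S s) \<and> entry_bound n (S s) K) (at 0)" and K: "K \<ge> 0"
    and O: "(\<lambda>s. (poly (Q ^ 2) z)^2 * mat_trace (S s * S s) - poly (LT b ((synthetic_div (Q ^ 2) z)^2)) s) \<in> O[at 0](\<lambda>s. s ^ 2)"
    using line_trace_remainder[OF b z, of 2] by blast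
  define N where "N = R * Z b"
  have cR: "R \<in> carrier_mat n n" "Z b \<in> carrier_mat n n" using R Z[OF b] by (auto simp: is_resolvent_def)
  then have c: "R \<in> carrier_mat n n" "N \<in> carrier_mat n n" by (auto simp: N_def)
  define t where "t = mat_trace (R * N * R) + mat_trace (N * R * R)"
  define P where "P = (poly (Q ^ 2) z)^2"
  define L where "L = LT b ((synthetic_div (Q ^ 2) z)^2)"
  let ?p = "smult P [:mat_trace (R * R), t:] - L"
  let ?r1 = "\<lambda>s. s ^ 2 * mat_trace (R * N * N * S s)" and ?r2 = "\<lambda>s. s ^ 2 * mat_trace (N * R * N * S s)"
    and ?r3 = "\<lambda>s. s ^ 2 * mat_trace (N * N * (S s * S s))"
  have "eventually (\<lambda>s. mat_trace (S s * S s) = poly [:mat_trace (R * R), t:] s + (?r1 s + ?r2 s + ?r3 s)) (at 0)"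
    using ev
  proof eventually_elim
    case (elim s)
    then have S: "is_resolvent n (M b s) z (S s)" "S s \<in> carrier_mat n n" by (auto simp: is_resolvent_def)
    note step1 = trace_resolvent_step(1)[OF b R S(1) _ one_carrier_mat, folded N_def]
    note step2 = trace_resolvent_step(2)[OF b R S(1) _ S(2), folded N_def]
    show ?case
      using step2[of "1\<^sub>m n"] step2[of N] step1[of R] step1[of "R * N"] step1[of "N * R"] c S(2)
      by (simp add: algebra_simps power2_eq_square t_def square_assoc[where n=n])
  qed
  then have "eventually (\<lambda>s. poly ?p s = (P * mat_trace (S s * S s) - poly L s) - P * (?r1 s + ?r2 s + ?r3 s)) (at 0)"
    by eventually_elim (simp add: algebra_simps)
  moreover have "(\<lambda>s. (P * mat_trace (S s * S s) - poly L s) - P * (?r1 s + ?r2 s + ?r3 s)) \<in> O[at 0](\<lambda>s. s ^ 2)"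
  proof (rule sum_in_bigo(2)[OF O[folded P_def L_def]])
    have bd: "eventually (\<lambda>s. S s \<in> carrier_mat n n \<and> entry_bound n (S s) K) (at 0)"
      using ev by eventually_elim (auto simp: is_resolvent_def)
    then have "eventually (\<lambda>s. S s * S s \<in> carrier_mat n n \<and> entry_bound n (S s * S s) (real n * (K * K))) (at 0)"
      by eventually_elim (use K in \<open>auto intro!: entry_bound_mult\<close>)
    then have "(\<lambda>s. ?r1 s + ?r2 s + ?r3 s) \<in> O[at 0](\<lambda>s. s ^ 2)"
      using bd c by (intro sum_in_bigo(1) bounded_trace_bigo) auto
    then show "(\<lambda>s. P * (?r1 s + ?r2 s + ?r3 s)) \<in> O[at 0](\<lambda>s. s ^ 2)"
      by (rule bigo_cmult)
  qed
  ultimately have "poly ?p \<in> O[at 0](\<lambda>s. s ^ 2)"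
    by (subst landau_o.big.in_cong) auto
  from poly_bigo_coeff[OF this, of 1] have "P * t = coeff L 1" by simp
  moreover have "t = 2 * mat_trace (Z b * (R * R * R))"
  proof -
    have "mat_trace (R * N * R) = mat_trace (Z b * (R * R * R))"
      using mat_trace_comm[of "R * R" n "Z b * R"] cR by (simp add: N_def square_assoc[where n=n])
    moreover have "mat_trace (N * R * R) = mat_trace (Z b * (R * R * R))"
      using mat_trace_comm[of "R" n "Z b * (R * R)"] cR by (simp add: N_def square_assoc[where n=n])
    ultimately show ?thesis by (simp add: t_def)
  qed
  ultimately show ?thesis by (simp add: P_def L_def)
qed

end

text \<open>The coefficients of the quotient by \<open>x - z\<close> depend polynomially on \<open>z\<close>, hence so does every linear
  function of it.\<close>

lemma linear_synthetic_div_poly: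
  fixes L :: "complex poly \<Rightarrow> complex"
  assumes "\<And>p q. L (p + q) = L p + L q" "\<And>c p. L (smult c p) = c * L p"
  shows "\<exists>U. \<forall>z. L (synthetic_div P z) = poly U z"
  using assms
proof (induction P arbitrary: L)
  case 0
  have "L 0 = 0" using "0.prems"(2)[of 0 0] by simp
  then show ?case by (intro exI[of _ 0]) simp
next
  case (pCons a p)
  have "\<exists>U. \<forall>z. L (pCons 0 (synthetic_div p z)) = poly U z"
  proof (rule pCons.IH)
    show "L (pCons 0 (p + q)) = L (pCons 0 p) + L (pCons 0 q)" for p q
      using pCons.prems(1)[of "pCons 0 p" "pCons 0 q"] by simp
    show "L (pCons 0 (smult c p)) = c * L (pCons 0 p)" for c p
      using pCons.prems(2)[of c "pCons 0 p"] by simp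
  qed
  then obtain U where U: "\<And>z. L (pCons 0 (synthetic_div p z)) = poly U z" by blast
  have "L (synthetic_div (pCons a p) z) = poly (smult (L 1) p + U) z" for z
  proof -
    have "synthetic_div (pCons a p) z = smult (poly p z) 1 + pCons 0 (synthetic_div p z)" by simp
    then show ?thesis using U by (simp only: pCons.prems) (simp add: mult.commute)
  qed
  then show ?case by blast
qed

lemma bilinear_synthetic_div_poly:
  fixes L :: "complex poly \<Rightarrow> complex"
  assumes "\<And>p q. L (p + q) = L p + L q" "\<And>c p. L (smult c p) = c * L p"
  shows "\<exists>U. \<forall>z. L (synthetic_div P z * synthetic_div P' z) = poly U z"
  using assms
proof (induction P arbitrary: L)
  case 0
  have "L 0 = 0" using "0.prems"(2)[of 0 0] by simp
  then show ?case by (intro exI[of _ 0]) simp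
next
  case (pCons a p)
  have "\<exists>U. \<forall>z. L (pCons 0 (synthetic_div p z * synthetic_div P' z)) = poly U z"
  proof (rule pCons.IH)
    show "L (pCons 0 (p + q)) = L (pCons 0 p) + L (pCons 0 q)" for p q
      using pCons.prems(1)[of "pCons 0 p" "pCons 0 q"] by simp
    show "L (pCons 0 (smult c p)) = c * L (pCons 0 p)" for c p
      using pCons.prems(2)[of c "pCons 0 p"] by simp
  qed
  then obtain U where U: "\<And>z. L (pCons 0 (synthetic_div p z * synthetic_div P' z)) = poly U z" by blast
  obtain V where V: "\<And>z. L (synthetic_div P' z) = poly V z"
    using linear_synthetic_div_poly[of L P'] pCons.prems by blast
  have "L (synthetic_div (pCons a p) z * synthetic_div P' z) = poly (p * V + U) z" for z
  proof -
    have "synthetic_div (pCons a p) z * synthetic_div P' z =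
        smult (poly p z) (synthetic_div P' z) + pCons 0 (synthetic_div p z * synthetic_div P' z)" by simp
    then show ?thesis using U V by (simp only: pCons.prems) simp
  qed
  then show ?case by blast
qed

section \<open>Calogero-Moser pairs\<close>

text \<open>The matrix whose rank is one on \<^const>\<open>CM_pairs\<close>.\<close>

definition cm_defect :: "nat \<Rightarrow> complex mat \<Rightarrow> complex mat \<Rightarrow> complex mat" where
  "cm_defect n X Y = X * Y - Y * X + 1\<^sub>m n"

text \<open>A maximal independent set of columns consists of a single column, and all others are multiples of it.\<close>

lemma rank_1_factor:
  fixes A :: "'a::field mat"
  assumes A: "A \<in> carrier_mat n n" and r: "vec_space.rank n A = 1"
  shows "\<exists>f g. \<forall>i<n. \<forall>j<n. A $$ (i, j) = f i * g j"
proof -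
  interpret vec_space "TYPE('a)" n .
  obtain S where S: "finite S" "maximal S (\<lambda>T. T \<subseteq> set (cols A) \<and> lin_indpt T)"
    using maximal_exists_superset[of "set (cols A)" "\<lambda>T. T \<subseteq> set (cols A) \<and> lin_indpt T" "{}"] 
    by (auto simp: finite_lin_indpt2)
  then have "card S = 1" using rank_card_indpt[OF A S(2)] r by simp
  then obtain u where u: "S = {u}" by (auto simp: card_1_singleton_iff)
  have Su: "u \<in> set (cols A)" "lin_indpt {u}" using S(2) by (auto simp: maximal_def u)
  have u_c: "u \<in> carrier_vec n" using Su(1) A cols_dim by blast
  have "\<exists>c. col A j = c \<cdot>\<^sub>v u" if j: "j < n" for j
  proof (cases "col A j = u")
    case True
    then show ?thesis by (intro exI[of _ 1]) simp
  next
    case False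
    have cj: "col A j \<in> set (cols A)" "col A j \<in> carrier_vec n" using j A by (auto simp: cols_def)
    have "\<not> lin_indpt {u, col A j}"
    proof
      assume "lin_indpt {u, col A j}"
      moreover have "{u, col A j} \<subseteq> set (cols A)" "{u} \<subseteq> {u, col A j}" using Su cj by auto
      ultimately have "{u, col A j} = {u}"
        using S(2) unfolding maximal_def u by blast
      then show False using False by auto
    qed
    then have "col A j \<in> span {u}"
      using lin_dep_iff_in_span[of "{u}" "col A j"] Su(2) u_c cj(2) False by (auto simp: insert_commute)
    then obtain a T where T: "T \<subseteq> {u}" "col A j = lincomb a T" by (auto simp: span_def)
    show ?thesis
    proof (cases "T = {}")
      case True
      then show ?thesis using T(2) u_c by (intro exI[of _ 0]) (auto simp: lincomb_def)
    next
      case False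
      then have "T = {u}" using T(1) by auto
      then show ?thesis using T(2) u_c by (intro exI[of _ "a u"]) (simp add: lincomb_def)
    qed
  qed
  then obtain g where g: "\<And>j. j < n \<Longrightarrow> col A j = g j \<cdot>\<^sub>v u" by metis
  have "A $$ (i, j) = u $ i * g j" if "i < n" "j < n" for i j
  proof -
    have "A $$ (i, j) = col A j $ i" using that A by simp
    then show ?thesis using g[OF that(2)] that u_c by simp
  qed
  then show ?thesis by blast
qed

text \<open>For \<open>K = f g\<^sup>T\<close> one has \<open>tr(K A) = g\<^sup>T A f\<close>, a scalar, so that \<open>g\<^sup>T\<close> and \<open>f\<close> cut the trace of a product
  into factors.\<close>

lemma rank_1_trace:
  fixes f g :: "nat \<Rightarrow> complex"
  assumes K: "K \<in> carrier_mat n n" "\<And>i j. i < n \<Longrightarrow> j < n \<Longrightarrow> K $$ (i, j) = f i * g j"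
    and A: "A \<in> carrier_mat n n" and B: "B \<in> carrier_mat n n"
  shows "mat_trace (K * A * (K * B)) = mat_trace (K * A) * mat_trace (K * B)"
proof -
  have KA: "(K * A) $$ (i, j) = f i * (\<Sum>k<n. g k * A $$ (k, j))" if "i < n" "j < n" "A \<in> carrier_mat n n" for i j A
    using that K by (simp add: scalar_prod_def atLeast0LessThan sum_distrib_left mult.assoc)
  have tr: "mat_trace (K * A) = (\<Sum>i<n. f i * (\<Sum>k<n. g k * A $$ (k, i)))" if "A \<in> carrier_mat n n" for A
  proof -
    have d: "dim_row (K * A) = n" using K by simp
    show ?thesis unfolding mat_trace_def d using that by (intro sum.cong refl KA) auto
  qed
  have "mat_trace (K * A * (K * B)) = (\<Sum>i<n. \<Sum>j<n. (K * A) $$ (i, j) * (K * B) $$ (j, i))"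
    using K A B by (simp add: mat_trace_def scalar_prod_def atLeast0LessThan)
  also have "\<dots> = (\<Sum>i<n. \<Sum>j<n. (f i * (\<Sum>k<n. g k * B $$ (k, i))) * (f j * (\<Sum>k<n. g k * A $$ (k, j))))"
    using A B by (intro sum.cong refl) (simp add: KA del: index_mult_mat(1))
  also have "\<dots> = mat_trace (K * B) * mat_trace (K * A)"
    unfolding tr[OF A] tr[OF B] sum_product ..
  finally show ?thesis by (simp add: mult.commute)
qed

text \<open>Both sides are half of \<open>tr([Y, R] [Y, R\<^sup>2])\<close>.  Expanding the commutators as they stand gives the left-hand
  side.  Expanding them with \<open>[Y, R] = R\<^sup>2 - R K R\<close>, where \<open>K = [X, Y] + 1\<close>, gives the right-hand side:
  traces with two factors \<open>K\<close> split, and \<open>tr(K A) = tr A\<close> for every \<open>A\<close> that commutes with \<open>X\<close>.\<close>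

lemma trace_resolvent_commutator:
  assumes X: "X \<in> carrier_mat n n" and Y: "Y \<in> carrier_mat n n"
    and rank1: "\<And>A B. A \<in> carrier_mat n n \<Longrightarrow> B \<in> carrier_mat n n \<Longrightarrow>
       mat_trace (cm_defect n X Y * A * (cm_defect n X Y * B)) = mat_trace (cm_defect n X Y * A) * mat_trace (cm_defect n X Y * B)"
    and R: "is_resolvent n X z R"
  shows "mat_trace (Y * (R * (Y * (R * R)))) - mat_trace (Y * (Y * (R * (R * R)))) =
    mat_trace (R * R) * mat_trace (R * (R * R)) - mat_trace (R * (R * (R * (R * R))))"
proof -
  define K where "K = cm_defect n X Y"
  have cR: "R \<in> carrier_mat n n" "(z \<cdot>\<^sub>m 1\<^sub>m n - X) * R = 1\<^sub>m n" "R * (z \<cdot>\<^sub>m 1\<^sub>m n - X) = 1\<^sub>m n"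
    using R by (auto simp: is_resolvent_def)
  have K: "K \<in> carrier_mat n n" using X Y by (simp add: K_def cm_defect_def)
  note cs = X Y cR(1) K
  note sa = square_assoc[where n=n] and sq = square_simps[where n=n]
  note ss = sa square_distribs[where n=n] square_smult[where n=n] mat_trace_linear[of _ n]
  have zX: "z \<cdot>\<^sub>m R - X * R = 1\<^sub>m n" "z \<cdot>\<^sub>m R - R * X = 1\<^sub>m n"
    using cR X by (simp_all add: sq)
  have XR: "X * R = R * X"
  proof -
    have "X * R = z \<cdot>\<^sub>m R - 1\<^sub>m n" unfolding zX(1)[symmetric] using X cR by (intro eq_matI) (auto simp del: index_mult_mat(1))
    moreover have "R * X = z \<cdot>\<^sub>m R - 1\<^sub>m n" unfolding zX(2)[symmetric] using X cR by (intro eq_matI) (auto simp del: index_mult_mat(1))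
    ultimately show ?thesis by simp
  qed
  have comm: "Y * R - R * Y = R * R - R * K * R"
  proof -
    define D where "D = z \<cdot>\<^sub>m 1\<^sub>m n - X"
    have D: "D \<in> carrier_mat n n" using X by (simp add: D_def)
    have "D * Y - Y * D = 1\<^sub>m n - K"
      using cs by (auto simp: D_def K_def cm_defect_def sq simp del: index_mult_mat(1) intro!: eq_matI)
    then have "R * (D * Y - Y * D) * R = R * R - R * K * R"
      using cs by (simp add: sq)
    moreover have "R * (D * Y - Y * D) * R = (R * D) * (Y * R) - R * Y * (D * R)"
      using cs D by (simp add: sq)
    moreover have "R * D = 1\<^sub>m n" "D * R = 1\<^sub>m n" using cR by (auto simp: D_def)
    ultimately show ?thesis using cs by simp
  qed
  define E where "E = Y * R - R * Y"
  have E: "E \<in> carrier_mat n n" using cs by (simp add: E_def)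
  have k: "mat_trace (K * A) = mat_trace A" if A: "A \<in> carrier_mat n n" "X * A = A * X" for A
  proof -
    have "mat_trace (X * (Y * A)) = mat_trace (Y * (A * X))"
      using mat_trace_comm[of X n "Y * A"] cs A(1) by (simp add: sa)
    moreover have "mat_trace (K * A) = mat_trace (X * (Y * A)) - mat_trace (Y * (X * A)) + mat_trace A"
      using cs A(1) by (simp add: K_def cm_defect_def ss square_units[where n=n])
    ultimately show ?thesis by (simp add: A(2))
  qed
  have RX: "X * (R * R) = R * R * X" "X * (R * (R * R)) = R * (R * R) * X"
    "X * (R * (R * (R * (R * R)))) = R * (R * (R * (R * R))) * X"
  proof -
    have st: "X * (R * A) = R * A * X" if "A \<in> carrier_mat n n" "X * A = A * X" for A
    proof -
      have "X * (R * A) = R * X * A" using cs that XR by (simp flip: assoc_mult_mat[of X n n R n A n])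
      also have "\<dots> = R * A * X" using cs that by (simp add: sa)
      finally show ?thesis .
    qed
    show a: "X * (R * R) = R * R * X" by (rule st) (use cs XR in auto)
    show b: "X * (R * (R * R)) = R * (R * R) * X" by (rule st) (use cs a in auto)
    have c: "X * (R * (R * (R * R))) = R * (R * (R * R)) * X" by (rule st) (use cs b in auto)
    show "X * (R * (R * (R * (R * R)))) = R * (R * (R * (R * R))) * X" by (rule st) (use cs c in auto)
  qed
  have "mat_trace (E * (E * R + R * E)) = 2 * mat_trace (Y * (R * (Y * (R * R)))) - 2 * mat_trace (Y * (Y * (R * (R * R))))"
  proof -
    have 1: "E * R + R * E = Y * (R * R) - R * R * Y"
      unfolding E_def using cs by (auto simp: sq simp del: index_mult_mat(1) intro!: eq_matI)
    have "mat_trace (E * (E * R + R * E)) = mat_trace (Y * (R * (Y * (R * R)))) - mat_trace (Y * (R * (R * (R * Y))))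
       - (mat_trace (R * (Y * (Y * (R * R)))) - mat_trace (R * (Y * (R * (R * Y)))))"
      unfolding 1 using cs by (simp add: E_def ss)
    moreover have "mat_trace (Y * (R * (R * (R * Y)))) = mat_trace (Y * (Y * (R * (R * R))))"
      using mat_trace_comm[of "Y * (R * (R * R))" n Y] cs by (simp add: sa)
    moreover have "mat_trace (R * (Y * (Y * (R * R)))) = mat_trace (Y * (Y * (R * (R * R))))"
      using mat_trace_comm[of R n "Y * (Y * (R * R))"] cs by (simp add: sa)
    moreover have "mat_trace (R * (Y * (R * (R * Y)))) = mat_trace (Y * (R * (Y * (R * R))))"
      using mat_trace_comm[of "R * (Y * (R * R))" n Y] cs by (simp add: sa)
    ultimately show ?thesis by simp
  qed
  moreover have "mat_trace (E * (E * R + R * E)) = 2 * mat_trace (E * (E * R))"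
    using mat_trace_comm[of "E * R" n E] cs E by (simp add: ss)
  moreover have "mat_trace (E * (E * R)) = mat_trace (R * R) * mat_trace (R * (R * R)) - mat_trace (R * (R * (R * (R * R))))"
  proof -
    have "mat_trace (E * (E * R)) = mat_trace (R * (R * (R * (R * R)))) - mat_trace (R * (R * (R * (K * (R * R)))))
       - (mat_trace (R * (K * (R * (R * (R * R))))) - mat_trace (R * (K * (R * (R * (K * (R * R)))))))"
      unfolding E_def comm using cs by (simp add: ss)
    moreover have "mat_trace (R * (R * (R * (K * (R * R))))) = mat_trace (K * (R * (R * (R * (R * R)))))"
      using mat_trace_comm[of "R * (R * R)" n "K * (R * R)"] cs by (simp add: sa)
    moreover have "mat_trace (R * (K * (R * (R * (R * R))))) = mat_trace (K * (R * (R * (R * (R * R)))))"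
      using mat_trace_comm[of R n "K * (R * (R * (R * R)))"] cs by (simp add: sa)
    moreover have "mat_trace (R * (K * (R * (R * (K * (R * R)))))) = mat_trace (K * (R * R) * (K * (R * (R * R))))"
      using mat_trace_comm[of R n "K * (R * (R * (K * (R * R))))"] cs by (simp add: sa)
    moreover have "mat_trace (K * (R * R) * (K * (R * (R * R)))) = mat_trace (R * R) * mat_trace (R * (R * R))"
      unfolding K_def using rank1[of "R * R" "R * (R * R)"] k[of "R * R"] k[of "R * (R * R)"] RX cs by (simp add: K_def)
    moreover have "mat_trace (K * (R * (R * (R * (R * R))))) = mat_trace (R * (R * (R * (R * R))))"
      by (rule k) (use cs RX in auto)
    ultimately show ?thesis by simp
  qed
  ultimately have "2 * (mat_trace (Y * (R * (Y * (R * R)))) - mat_trace (Y * (Y * (R * (R * R))))) =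
      2 * (mat_trace (R * R) * mat_trace (R * (R * R)) - mat_trace (R * (R * (R * (R * R)))))"
    by (simp only: right_diff_distrib)
  then show ?thesis by (rule iffD1[OF mult_left_cancel, rotated]) simp
qed

section \<open>Multiplicity one at a maximal joint spectrum\<close>

lemma pole_limit:
  fixes d :: "nat \<Rightarrow> complex"
  assumes "k \<ge> 1"
  shows "((\<lambda>z. (z - l) ^ k * (\<Sum>i<n. 1 / (z - d i) ^ k)) \<longlongrightarrow> of_nat (card {i\<in>{..<n}. d i = l})) (at l)"
proof -
  have "((\<lambda>z. (z - l) ^ k * (1 / (z - d i) ^ k)) \<longlongrightarrow> (if d i = l then 1 else 0)) (at l)" for i
  proof (cases "d i = l")
    case True
    have "eventually (\<lambda>z. (z - l) ^ k * (1 / (z - d i) ^ k) = 1) (at l)"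
      using True by (auto simp: eventually_at_filter)
    then show ?thesis using True by (simp add: tendsto_eventually)
  next
    case False
    then have "((\<lambda>z. (z - l) ^ k * (1 / (z - d i) ^ k)) \<longlongrightarrow> (l - l) ^ k * (1 / (l - d i) ^ k)) (at l)"
      by (intro tendsto_intros) auto
    then show ?thesis using False assms by (simp add: power_0_left)
  qed
  then have "((\<lambda>z. \<Sum>i<n. (z - l) ^ k * (1 / (z - d i) ^ k)) \<longlongrightarrow> (\<Sum>i<n. if d i = l then 1 else 0)) (at l)"
    by (intro tendsto_sum)
  then show ?thesis by (simp add: sum_distrib_left flip: sum.inter_filter)
qed

lemma fifth_power_split: "w ^ 5 * (a * b - c) = (w ^ 2 * a) * (w ^ 3 * b) - w ^ 5 * (c :: complex)"
  by (simp add: eval_nat_numeral algebra_simps)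

lemma cancel_fourth_power:
  fixes w g A B :: complex
  assumes "w ^ 4 * g ^ 4 * A = B" "g \<noteq> 0"
  shows "w * B / g ^ 4 = w ^ 5 * A"
  unfolding assms(1)[symmetric] using assms(2) by (simp add: eval_nat_numeral)

text \<open>Multiply the identity of \<open>trace_resolvent_commutator\<close> by \<open>(z - l)\<^sup>5\<close> and let \<open>z\<close> tend to an eigenvalue \<open>l\<close> of
  multiplicity \<open>m\<close>.  The left-hand side tends to \<open>0\<close>, because its poles have order at most 4, and
  the right-hand side to \<open>m\<^sup>2 - m\<close>.\<close>

lemma maximal_spectrum_simple:
  fixes X Y :: "'b \<Rightarrow> complex mat"
  assumes L1: "spectral_line n I X Y" and L2: "spectral_line n I X (\<lambda>b. Y b * Y b)"
    and b: "b \<in> I"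
    and rank1: "\<And>A B. A \<in> carrier_mat n n \<Longrightarrow> B \<in> carrier_mat n n \<Longrightarrow>
       mat_trace (cm_defect n (X b) (Y b) * A * (cm_defect n (X b) (Y b) * B)) =
       mat_trace (cm_defect n (X b) (Y b) * A) * mat_trace (cm_defect n (X b) (Y b) * B)"
  shows "card (spectrum (X b)) = n"
proof -
  interpret L1: spectral_line n I X Y by fact
  interpret L2: spectral_line n I X "\<lambda>b. Y b * Y b" by fact
  have sp: "L2.sp 0 = L1.sp 0" by (simp add: L1.sp_0 L2.sp_0)
  then have Q: "L2.Q = L1.Q" by (simp add: L1.Q_def L2.Q_def)
  let ?sp = "L1.sp 0" and ?Q = "L1.Q"
  have Xb: "X b \<in> carrier_mat n n" and Yb: "Y b \<in> carrier_mat n n" using L1.X L1.Z b by auto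
  have YY: "Y b * Y b \<in> carrier_mat n n" using Yb by simp
  obtain d where d: "d ` {..<n} = spectrum (X b)"
    "\<And>p. mat_trace (mat_poly n (X b) p) = (\<Sum>i<n. poly p (d i))"
    "\<And>z R k. is_resolvent n (X b) z R \<Longrightarrow> z \<notin> spectrum (X b) \<Longrightarrow>
       mat_trace (((*) R ^^ k) R) = (\<Sum>i<n. 1 / (z - d i) ^ Suc k)"
    by (rule spectral_calculus[OF Xb], rule that) auto
  let ?L1 = "\<lambda>p. coeff (L1.LT b p) 2" and ?L2 = "\<lambda>p. coeff (L2.LT b p) 1"
  obtain U1 where U1: "\<And>z. ?L1 (synthetic_div (?Q ^ 3) z) = poly U1 z"
    using linear_synthetic_div_poly[of ?L1 "?Q ^ 3"]
    by (auto simp: line_trace_add[OF Xb Yb] line_trace_smult[OF Xb Yb])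
  obtain U2 where U2: "\<And>z. ?L2 (synthetic_div (?Q ^ 2) z * synthetic_div (?Q ^ 2) z) = poly U2 z"
    using bilinear_synthetic_div_poly[of ?L2 "?Q ^ 2" "?Q ^ 2"]
    by (auto simp: line_trace_add[OF Xb YY] line_trace_smult[OF Xb YY])
  let ?r = "\<lambda>k z. \<Sum>i<n. 1 / (z - d i) ^ k"
  have key: "poly ?Q z ^ 4 * (?r 2 z * ?r 3 z - ?r 5 z) = poly ?Q z * poly U1 z - poly U2 z / 2" if z: "z \<notin> ?sp" for z
  proof -
    have zX: "z \<notin> spectrum (X b)" using z b by (auto simp: L1.sp_0)
    obtain R where R: "is_resolvent n (X b) z R" using resolvent_ex[OF Xb zX] by blast
    have cR: "R \<in> carrier_mat n n" using R by (simp add: is_resolvent_def)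
    have tr: "mat_trace (R * R) = ?r 2 z" "mat_trace (R * (R * R)) = ?r 3 z" "mat_trace (R * (R * (R * (R * R)))) = ?r 5 z"
      using d(3)[OF R zX, of 1] d(3)[OF R zX, of 2] d(3)[OF R zX, of 4] by (simp_all add: eval_nat_numeral)
    have "mat_trace (R * Y b * (R * Y b) * R) = mat_trace (Y b * (R * (Y b * (R * R))))"
      using mat_trace_comm[of R n "Y b * (R * (Y b * R))"] cR Yb by (simp add: square_assoc[where n=n])
    then have 1: "poly ?Q z ^ 3 * mat_trace (Y b * (R * (Y b * (R * R)))) = poly U1 z"
      using L1.second_order_coeff[OF b z R] U1[of z] by simp
    have "mat_trace (Y b * Y b * (R * R * R)) = mat_trace (Y b * (Y b * (R * (R * R))))"
      using cR Yb by (simp add: square_assoc[where n=n])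
    then have 2: "poly ?Q z ^ 4 * (2 * mat_trace (Y b * (Y b * (R * (R * R))))) = poly U2 z"
      using L2.first_order_coeff[OF b _ R] z U2[of z] by (simp add: sp Q power2_eq_square eval_nat_numeral algebra_simps)
    have "?r 2 z * ?r 3 z - ?r 5 z = mat_trace (Y b * (R * (Y b * (R * R)))) - mat_trace (Y b * (Y b * (R * (R * R))))"
      using trace_resolvent_commutator[OF Xb Yb rank1 R] by (simp add: tr)
    then show ?thesis unfolding 1[symmetric] 2[symmetric]
      by (simp only:) (simp add: eval_nat_numeral algebra_simps)
  qed
  have mult1: "card {i\<in>{..<n}. d i = l} \<le> 1" if l: "l \<in> ?sp" for l
  proof -
    let ?m = "of_nat (card {i\<in>{..<n}. d i = l}) :: complex"
    define G where "G = root_poly (?sp - {l})"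
    have QG: "?Q = [:- l, 1:] * G"
      unfolding L1.Q_def G_def root_poly_def using l by (subst prod.remove[of _ l]) auto
    have Gl: "poly G l \<noteq> 0" by (simp add: G_def poly_root_poly)
    have "((\<lambda>z. ((z - l) ^ 2 * ?r 2 z) * ((z - l) ^ 3 * ?r 3 z) - (z - l) ^ 5 * ?r 5 z) \<longlongrightarrow> ?m * ?m - ?m) (at l)"
      by (intro tendsto_intros pole_limit) auto
    moreover have "eventually (\<lambda>z. ((z - l) ^ 2 * ?r 2 z) * ((z - l) ^ 3 * ?r 3 z) - (z - l) ^ 5 * ?r 5 z =
        (z - l) * (poly ?Q z * poly U1 z - poly U2 z / 2) / poly G z ^ 4) (at l)"
    proof -
      have "open (- (?sp - {l}))" by (intro open_Compl finite_imp_closed) auto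
      then have "eventually (\<lambda>z. z \<in> - (?sp - {l})) (nhds l)" by (rule eventually_nhds_in_open) simp
      then have "eventually (\<lambda>z. z \<notin> ?sp) (at l)" unfolding eventually_at_filter by eventually_elim auto
      then show ?thesis
      proof eventually_elim
        case (elim z)
        then have nz: "poly G z \<noteq> 0" "z - l \<noteq> 0" using l by (auto simp: G_def poly_root_poly)
        let ?A = "?r 2 z * ?r 3 z - ?r 5 z"
        have "poly ?Q z = (z - l) * poly G z" by (simp add: QG algebra_simps)
        then have "(z - l) ^ 4 * poly G z ^ 4 * ?A = poly ?Q z ^ 4 * ?A" by (simp only: power_mult_distrib)
        also note key[OF elim]
        finally have "(z - l) * (poly ?Q z * poly U1 z - poly U2 z / 2) / poly G z ^ 4 = (z - l) ^ 5 * ?A"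
          by (rule cancel_fourth_power[OF _ nz(1)])
        also have "(z - l) ^ 5 * ?A = ((z - l) ^ 2 * ?r 2 z) * ((z - l) ^ 3 * ?r 3 z) - (z - l) ^ 5 * ?r 5 z"
          by (rule fifth_power_split)
        finally show ?case by simp
      qed
    qed
    ultimately have "((\<lambda>z. (z - l) * (poly ?Q z * poly U1 z - poly U2 z / 2) / poly G z ^ 4) \<longlongrightarrow> ?m * ?m - ?m) (at l)"
      by (rule Lim_transform_eventually)
    moreover have "((\<lambda>z. (z - l) * (poly ?Q z * poly U1 z - poly U2 z / 2) / poly G z ^ 4) \<longlongrightarrow>
        (l - l) * (poly ?Q l * poly U1 l - poly U2 l / 2) / poly G l ^ 4) (at l)"
      using Gl by (intro tendsto_intros) auto
    ultimately have "?m * ?m - ?m = 0" using tendsto_unique[OF at_neq_bot] by fastforce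
    then have "?m * (?m - 1) = 0" by (simp add: algebra_simps)
    then have "?m = 0 \<or> ?m = 1" by simp
    then have "card {i\<in>{..<n}. d i = l} = 0 \<or> card {i\<in>{..<n}. d i = l} = 1"
      by (simp only: of_nat_eq_0_iff of_nat_eq_1_iff)
    then show ?thesis by linarith
  qed
  have "inj_on d {..<n}"
  proof (rule inj_onI)
    fix i j assume ij: "i \<in> {..<n}" "j \<in> {..<n}" "d i = d j"
    have "d i \<in> ?sp" using d(1) ij b by (auto simp: L1.sp_0)
    from mult1[OF this] have "card {k\<in>{..<n}. d k = d i} \<le> 1" .
    then have "\<forall>a\<in>{k\<in>{..<n}. d k = d i}. \<forall>b\<in>{k\<in>{..<n}. d k = d i}. a = b"
      by (subst card_le_Suc0_iff_eq[symmetric]) auto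
    then show "i = j" using ij by simp
  qed
  then show ?thesis using d(1) by (metis card_image card_lessThan)
qed

section \<open>Normal form\<close>

text \<open>The nonzero trace excludes rank zero.\<close>

lemma rank_1_iff:
  fixes K :: "complex mat"
  assumes K: "K \<in> carrier_mat n n" and nz: "mat_trace K \<noteq> 0"
  shows "vec_space.rank n K = 1 \<longleftrightarrow> (\<exists>f g. \<forall>i<n. \<forall>j<n. K $$ (i, j) = f i * g j)"
proof
  assume "\<exists>f g. \<forall>i<n. \<forall>j<n. K $$ (i, j) = f i * g j"
  then obtain f g where fg: "\<And>i j. i < n \<Longrightarrow> j < n \<Longrightarrow> K $$ (i, j) = f i * g j" by blast
  interpret vec_space "TYPE(complex)" n .
  have "rank K \<le> 1" by (rule rank_le_1_product_entries[OF K]) (use fg K in auto)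
  moreover have "rank K \<ge> 1"
  proof -
    obtain j where j: "j < n" "K $$ (j, j) \<noteq> 0"
      using nz K by (auto simp: mat_trace_def dest: sum.not_neutral_contains_not_neutral)
    define u where "u = col K j"
    have u: "u \<in> carrier_vec n" "u \<noteq> 0\<^sub>v n" "u \<in> set (cols K)"
      using j K by (auto simp: u_def cols_def dest: arg_cong[of _ _ "\<lambda>v. v $ j"])
    have "lin_indpt {u}"
      using u lin_dep_iff_in_span[of "{}" u] by (auto simp: span_empty lindep_span)
    then show ?thesis using rank_ge_card_indpt[OF K, of "{u}"] u(3) by simp
  qed
  ultimately show "rank K = 1" by simp
qed (rule rank_1_factor[OF K])

lemma trace_cm_defect:
  assumes "X \<in> carrier_mat n n" "Y \<in> carrier_mat n n"
  shows "mat_trace (cm_defect n X Y) = of_nat n"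
proof -
  have "mat_trace (1\<^sub>m n :: complex mat) = of_nat n" by (simp add: mat_trace_def)
  then show ?thesis
    using assms mat_trace_comm[of X n Y] by (simp add: cm_defect_def mat_trace_linear[of _ n])
qed

lemma CM_pairs_iff:
  assumes "n \<ge> 1"
  shows "(X, Y) \<in> CM_pairs n \<longleftrightarrow> X \<in> carrier_mat n n \<and> Y \<in> carrier_mat n n \<and>
    (\<exists>f g. \<forall>i<n. \<forall>j<n. cm_defect n X Y $$ (i, j) = f i * g j)"
proof -
  have "vec_space.rank n (cm_defect n X Y) = 1 \<longleftrightarrow> (\<exists>f g. \<forall>i<n. \<forall>j<n. cm_defect n X Y $$ (i, j) = f i * g j)"
    if "X \<in> carrier_mat n n" "Y \<in> carrier_mat n n"
    using that assms trace_cm_defect[OF that] by (intro rank_1_iff) (auto simp: cm_defect_def)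
  then show ?thesis
    unfolding CM_pairs_def mem_Collect_eq case_prod_conv cm_defect_def[symmetric] by blast
qed

text \<open>The rank-one factorization of the defect is conjugated along with the pair.\<close>

lemma CM_pairs_conj:
  assumes n: "n \<ge> 1" and XY: "(X, Y) \<in> CM_pairs n"
    and s: "similar_mat_wit X' X P Q" "similar_mat_wit Y' Y P Q"
  shows "((X, Y), (X', Y')) \<in> CM_rel n"
proof -
  have c: "X \<in> carrier_mat n n" "Y \<in> carrier_mat n n" using XY by (auto simp: CM_pairs_def)
  note c' = similar_mat_wit_carrier[OF s(1) c(1)] similar_mat_wit_carrier[OF s(2) c(2)]
  obtain f g where fg: "\<And>i j. i < n \<Longrightarrow> j < n \<Longrightarrow> cm_defect n X Y $$ (i, j) = f i * g j"
    using XY CM_pairs_iff[OF n] by blast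
  define K where "K = cm_defect n X Y"
  have K: "K \<in> carrier_mat n n" using c by (simp add: K_def cm_defect_def)
  have wP: "P * Q = 1\<^sub>m n" "Q * P = 1\<^sub>m n" "X' = P * X * Q" using similar_mat_witD2[OF c'(1) s(1)] by auto
  have wY: "Y' = P * Y * Q" using similar_mat_witD2[OF c'(4) s(2)] by auto
  have QP: "Q * (P * A) = A" if "A \<in> carrier_mat n n" for A
    using assoc_mult_mat[OF c'(3) c'(2) that] wP that by simp
  have K': "cm_defect n X' Y' = P * K * Q"
  proof -
    have "P * (X * Y - Y * X + 1\<^sub>m n) * Q = P * X * Y * Q - P * Y * X * Q + P * Q"
      using c c'(2,3) by (simp add: square_simps[where n=n])
    moreover have "P * A * Q * (P * B * Q) = P * A * B * Q" if "A \<in> carrier_mat n n" "B \<in> carrier_mat n n" for A B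
    proof -
      have "P * A * Q * (P * B * Q) = P * A * (Q * (P * (B * Q)))"
        using that c'(2,3) by (simp add: square_assoc[where n=n])
      also have "Q * (P * (B * Q)) = B * Q" using QP that c'(3) by simp
      finally show ?thesis using that c'(2,3) by (simp add: square_assoc[where n=n])
    qed
    ultimately show ?thesis
      unfolding K_def cm_defect_def wP(3) wY by (simp only: c wP(1))
  qed
  have "\<exists>f g. \<forall>i<n. \<forall>j<n. (P * K * Q) $$ (i, j) = f i * g j"
  proof (intro exI allI impI)
    fix i j assume ij: "i < n" "j < n"
    have "(P * K * Q) $$ (i, j) = (\<Sum>k<n. (P * K) $$ (i, k) * Q $$ (k, j))"
      using ij c' K by (intro square_mult_entry) auto
    also have "\<dots> = (\<Sum>k<n. (\<Sum>l<n. P $$ (i, l) * K $$ (l, k)) * Q $$ (k, j))"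
      using ij c' K by (intro sum.cong refl) (simp add: square_mult_entry[of P n K] del: index_mult_mat(1))
    also have "\<dots> = (\<Sum>k<n. (\<Sum>l<n. P $$ (i, l) * f l) * (g k * Q $$ (k, j)))"
      using fg by (intro sum.cong refl) (auto simp: K_def sum_distrib_right mult.assoc)
    also have "\<dots> = (\<Sum>l<n. P $$ (i, l) * f l) * (\<Sum>k<n. g k * Q $$ (k, j))"
      by (simp add: sum_distrib_left)
    finally show "(P * K * Q) $$ (i, j) = (\<Sum>l<n. P $$ (i, l) * f l) * (\<Sum>k<n. g k * Q $$ (k, j))" .
  qed
  then have "(X', Y') \<in> CM_pairs n" using CM_pairs_iff[OF n] c' K' by auto
  then show ?thesis using XY s by (auto simp: CM_rel_def)
qed

lemma mat_diag_simps:
  "mat_diag n d \<in> carrier_mat n n"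
  "i < n \<Longrightarrow> j < n \<Longrightarrow> mat_diag n d $$ (i, j) = (if i = j then d j else 0)"
  "A \<in> carrier_mat n n \<Longrightarrow> i < n \<Longrightarrow> j < n \<Longrightarrow> (mat_diag n d * A) $$ (i, j) = d i * (A $$ (i, j) :: complex)"
  "A \<in> carrier_mat n n \<Longrightarrow> i < n \<Longrightarrow> j < n \<Longrightarrow> (A * mat_diag n d) $$ (i, j) = A $$ (i, j) * d j"
  using mat_diag_mult_left[of A n n d] mat_diag_mult_right[of A n n d]
  by (auto simp: mat_diag_def)

lemma mat_poly_mat_diag: "mat_poly n (mat_diag n d) p = mat_diag n (\<lambda>i. poly p (d i :: complex))"
proof (induction p)
  case (pCons a p)
  show ?case
    unfolding mat_poly_pCons[OF mat_diag_simps(1)] pCons.IH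
    by (rule eq_matI) (auto simp: mat_diag_simps(2,3) mat_diag_simps(3)[OF mat_diag_simps(1)] carrier_matD[OF mat_diag_simps(1)] simp del: index_mult_mat(1))
qed (auto simp: mat_diag_def)

lemma spectrum_mat_diag: "spectrum (mat_diag n d :: complex mat) = d ` {..<n}"
  using spectrum_triangular[of "mat_diag n d" n]
  by (auto simp: mat_diag_def upper_triangular_def atLeast0LessThan)

lemma mat_poly_intertwine:
  assumes X: "X \<in> carrier_mat n n" and D: "D \<in> carrier_mat n n" and P: "P \<in> carrier_mat n n"
    and XP: "X * P = P * (D :: complex mat)"
  shows "mat_poly n X p * P = P * mat_poly n D p"
proof (induction p)
  case (pCons a p)
  have "X * mat_poly n X p * P = X * P * mat_poly n D p"
    using X D P pCons.IH by (simp add: square_assoc[where n=n])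
  also have "\<dots> = P * (D * mat_poly n D p)" using X D P by (simp add: XP square_assoc[where n=n])
  finally show ?case
    using X D P by (simp add: mat_poly_pCons square_simps[where n=n])
qed (use X D P in simp)

text \<open>The eigenvectors form a matrix \<open>P\<close> with \<open>X P = P D\<close>.  It is injective: applying the Lagrange polynomials
  of the spectrum to \<open>X\<close> isolates the single components of a relation between the eigenvectors.\<close>

lemma diagonalize:
  fixes X :: "complex mat"
  assumes X: "X \<in> carrier_mat n n" and d: "inj_on d {..<n}" "d ` {..<n} = spectrum X"
  shows "\<exists>P Q. similar_mat_wit (mat_diag n d) X P Q"
proof -
  have "\<forall>j<n. \<exists>v. v \<in> carrier_vec n \<and> v \<noteq> 0\<^sub>v n \<and> X *\<^sub>v v = d j \<cdot>\<^sub>v v"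
    using d(2) X by (auto simp: spectrum_def eigenvalue_def eigenvector_def)
  then obtain v where v: "\<And>j. j < n \<Longrightarrow> v j \<in> carrier_vec n" "\<And>j. j < n \<Longrightarrow> v j \<noteq> 0\<^sub>v n"
    "\<And>j. j < n \<Longrightarrow> X *\<^sub>v v j = d j \<cdot>\<^sub>v v j" by metis
  define P where "P = mat n n (\<lambda>(i, j). v j $ i)"
  have P: "P \<in> carrier_mat n n" by (simp add: P_def)
  have colP: "col P j = v j" if "j < n" for j
    using that v(1)[OF that] by (intro eq_vecI) (auto simp: P_def)
  let ?D = "mat_diag n d"
  have XP: "X * P = P * ?D"
  proof (rule eq_matI)
    fix i j assume "i < dim_row (P * ?D)" "j < dim_col (P * ?D)"
    then have ij: "i < n" "j < n" using P by (auto simp: mat_diag_def)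
    have "(X * P) $$ (i, j) = (X *\<^sub>v v j) $ i" using ij X P by (simp add: colP)
    also have "\<dots> = P $$ (i, j) * d j" using v(1,3)[OF ij(2)] ij by (simp add: P_def mult.commute)
    finally show "(X * P) $$ (i, j) = (P * ?D) $$ (i, j)"
      unfolding mat_diag_simps(4)[OF P ij] .
  qed (use X P in \<open>auto simp: mat_diag_def\<close>)
  have "c = 0\<^sub>v n" if c: "c \<in> carrier_vec n" "P *\<^sub>v c = 0\<^sub>v n" for c
  proof (rule eq_vecI)
    fix k assume "k < dim_vec (0\<^sub>v n :: complex vec)"
    then have k: "k < n" by simp
    let ?e = "lagrange (spectrum X) (d k)"
    have fin: "finite (spectrum X)" using card_finite_spectrum[OF X] by simp
    have e: "poly ?e (d i) = (if i = k then 1 else 0)" if "i < n" for i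
    proof -
      have "d i \<in> spectrum X" "d k \<in> spectrum X" "d k = d i \<longleftrightarrow> i = k"
        using d that k by (auto simp: inj_on_def simp flip: d(2))
      then show ?thesis using poly_lagrange[OF fin, of "d k" "d i"] by simp
    qed
    have "P *\<^sub>v (mat_poly n ?D ?e *\<^sub>v c) = (P * mat_poly n ?D ?e) *\<^sub>v c"
      using P c by (intro assoc_mult_mat_vec[symmetric]) (auto simp: mat_diag_simps(1))
    also have "\<dots> = (mat_poly n X ?e * P) *\<^sub>v c"
      by (simp add: mat_poly_intertwine[OF X mat_diag_simps(1) P XP])
    also have "\<dots> = mat_poly n X ?e *\<^sub>v (P *\<^sub>v c)" using P c X by (intro assoc_mult_mat_vec) auto
    also have "\<dots> = 0\<^sub>v n" using X c by (auto intro!: eq_vecI)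
    finally have "P *\<^sub>v (mat_poly n ?D ?e *\<^sub>v c) = 0\<^sub>v n" .
    moreover have "mat_poly n ?D ?e *\<^sub>v c = c $ k \<cdot>\<^sub>v unit_vec n k"
    proof (rule eq_vecI)
      fix i assume "i < dim_vec (c $ k \<cdot>\<^sub>v unit_vec n k :: complex vec)"
      then have i: "i < n" by simp
      have "(mat_poly n ?D ?e *\<^sub>v c) $ i = (\<Sum>j<n. (if i = j then poly ?e (d j) else 0) * c $ j)"
        unfolding mat_poly_mat_diag using i c by (simp add: scalar_prod_def atLeast0LessThan mat_diag_def)
      also have "\<dots> = poly ?e (d i) * c $ i" using i by (simp add: if_distrib if_distribR cong: if_cong)
      finally show "(mat_poly n ?D ?e *\<^sub>v c) $ i = (c $ k \<cdot>\<^sub>v unit_vec n k) $ i"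
        using i k e by auto
    qed (simp add: mat_poly_mat_diag mat_diag_def)
    moreover have "P *\<^sub>v (c $ k \<cdot>\<^sub>v unit_vec n k) = c $ k \<cdot>\<^sub>v v k"
    proof -
      have "P *\<^sub>v unit_vec n k = col P k"
        using P k by (intro eq_vecI) auto
      then show ?thesis using P k by (simp add: mult_mat_vec[of P n n] colP)
    qed
    ultimately have z: "c $ k \<cdot>\<^sub>v v k = 0\<^sub>v n" by simp
    obtain i where i: "i < n" "v k $ i \<noteq> 0"
      using v(1,2)[OF k] by (metis carrier_vecD eq_vecI index_zero_vec)
    have "(c $ k \<cdot>\<^sub>v v k) $ i = 0" using z i by simp
    then show "c $ k = 0\<^sub>v n $ k" using i v(1)[OF k] k by simp
  qed (use c in simp)
  then obtain Q where Q: "Q \<in> carrier_mat n n" "P * Q = 1\<^sub>m n" "Q * P = 1\<^sub>m n"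
    using square_inverse_ex[OF P] by blast
  have "Q * X * P = Q * (P * ?D)" using Q X P XP by (simp add: square_assoc[where n=n])
  also have "\<dots> = ?D" using assoc_mult_mat[OF Q(1) P mat_diag_simps(1)[of n d]] left_mult_one_mat[OF mat_diag_simps(1)[of n d]]
    by (simp add: Q(3))
  finally have "?D = Q * X * P" ..
  then have "similar_mat_wit ?D X Q P"
    using Q P X by (intro similar_mat_witI[of _ _ n]) (auto simp: mat_diag_simps(1))
  then show ?thesis by blast
qed

text \<open>The shape that \<open>Y\<close> takes when \<open>X\<close> is diagonal with entries \<open>d\<close>.\<close>

definition offdiag_normal :: "nat \<Rightarrow> (nat \<Rightarrow> complex) \<Rightarrow> complex mat \<Rightarrow> bool" where
  "offdiag_normal n d Y \<longleftrightarrow> Y \<in> carrier_mat n n \<and>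
     (\<forall>i<n. \<forall>j<n. i \<noteq> j \<longrightarrow> Y $$ (i, j) = 1 / (d i - d j))"

lemma CM_rel_trans: "(p, q) \<in> CM_rel n \<Longrightarrow> (q, r) \<in> CM_rel n \<Longrightarrow> (p, r) \<in> CM_rel n"
  using equiv_CM_rel[of n] unfolding equiv_def by (meson transD)

lemma CM_rel_sym: "(p, q) \<in> CM_rel n \<Longrightarrow> (q, p) \<in> CM_rel n"
  using equiv_CM_rel[of n] unfolding equiv_def by (meson symD)

lemma CM_rel_refl: "p \<in> CM_pairs n \<Longrightarrow> (p, p) \<in> CM_rel n"
  using equiv_CM_rel[of n] unfolding equiv_def by (meson refl_onD)

lemma CM_rel_pairs: "(p, q) \<in> CM_rel n \<Longrightarrow> p \<in> CM_pairs n" "(p, q) \<in> CM_rel n \<Longrightarrow> q \<in> CM_pairs n"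
  by (auto simp: CM_rel_def)

lemma CM_pairs_carrier: "p \<in> CM_pairs n \<Longrightarrow> fst p \<in> carrier_mat n n" "p \<in> CM_pairs n \<Longrightarrow> snd p \<in> carrier_mat n n"
  by (auto simp: CM_pairs_def)

text \<open>With \<open>X\<close> diagonal the entries of \<open>[X, Y] + 1 = f g\<^sup>T\<close> read \<open>(d\<^sub>i - d\<^sub>j) Y\<^sub>i\<^sub>j = f\<^sub>i g\<^sub>j\<close> off the diagonal and
  \<open>f\<^sub>i g\<^sub>i = 1\<close> on it.  Conjugation by the diagonal matrix of \<open>f\<close> therefore normalises all products
  \<open>f\<^sub>i g\<^sub>j\<close> to \<open>1\<close>.\<close>

lemma CM_normal_form:
  assumes n: "n \<ge> 1" and XY: "(X, Y) \<in> CM_pairs n" and d: "inj_on d {..<n}" "d ` {..<n} = spectrum X"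
  shows "\<exists>Y'. ((X, Y), (mat_diag n d, Y')) \<in> CM_rel n \<and> offdiag_normal n d Y'"
proof -
  have c: "X \<in> carrier_mat n n" "Y \<in> carrier_mat n n" using XY by (auto simp: CM_pairs_def)
  obtain P Q where s: "similar_mat_wit (mat_diag n d) X P Q" using diagonalize[OF c(1) d] by blast
  define D where "D = mat_diag n d"
  have D: "D \<in> carrier_mat n n" by (simp add: D_def mat_diag_simps(1))
  define Y1 where "Y1 = P * Y * Q"
  note PQ = similar_mat_wit_carrier(2,3)[OF s c(1)] and w = similar_mat_witD2(1,2)[OF mat_diag_simps(1) s]
  have Y1: "Y1 \<in> carrier_mat n n" using PQ c by (simp add: Y1_def)
  have sY: "similar_mat_wit Y1 Y P Q"
    using PQ c w Y1 by (intro similar_mat_witI[of _ _ n]) (auto simp: Y1_def)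
  have rel1: "((X, Y), (D, Y1)) \<in> CM_rel n" unfolding D_def by (rule CM_pairs_conj[OF n XY s sY])
  then have DY1: "(D, Y1) \<in> CM_pairs n" by (rule CM_rel_pairs)
  then obtain f g where "\<And>i j. i < n \<Longrightarrow> j < n \<Longrightarrow> cm_defect n D Y1 $$ (i, j) = f i * g j"
    using CM_pairs_iff[OF n] by blast
  then have fg: "(d i - d j) * Y1 $$ (i, j) + (if i = j then 1 else 0) = f i * g j" if "i < n" "j < n" for i j
  proof -
    have "cm_defect n D Y1 $$ (i, j) = (D * Y1) $$ (i, j) - (Y1 * D) $$ (i, j) + (if i = j then 1 else 0)"
      using that D Y1 by (simp add: cm_defect_def del: index_mult_mat(1))
    also have "\<dots> = (d i - d j) * Y1 $$ (i, j) + (if i = j then 1 else 0)"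
      unfolding D_def mat_diag_simps(3)[OF Y1 that] mat_diag_simps(4)[OF Y1 that] by (simp add: algebra_simps)
    finally show ?thesis using \<open>\<And>i j. i < n \<Longrightarrow> j < n \<Longrightarrow> cm_defect n D Y1 $$ (i, j) = f i * g j\<close> that by simp
  qed
  have f1: "f i * g i = 1" if "i < n" for i using fg[OF that that] by simp
  then have f0: "f i \<noteq> 0" if "i < n" for i using that by fastforce
  define T where "T = mat_diag n f"
  define U where "U = mat_diag n (\<lambda>i. 1 / f i)"
  have TU: "T \<in> carrier_mat n n" "U \<in> carrier_mat n n" by (auto simp: T_def U_def mat_diag_simps(1))
  have inv: "U * T = 1\<^sub>m n" "T * U = 1\<^sub>m n"
    using TU f0 unfolding T_def U_def mat_diag_diag by (auto intro!: eq_matI simp: mat_diag_simps(2) carrier_matD[OF mat_diag_simps(1)])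
  define Y' where "Y' = U * Y1 * T"
  have Y': "Y' \<in> carrier_mat n n" using TU Y1 by (simp add: Y'_def)
  have "D = U * D * T"
    unfolding D_def T_def U_def mat_diag_diag using f0
    by (auto intro!: eq_matI simp: mat_diag_simps(2) carrier_matD[OF mat_diag_simps(1)])
  then have "similar_mat_wit D D U T" using TU inv D by (intro similar_mat_witI[of _ _ n]) auto
  moreover have "similar_mat_wit Y' Y1 U T" using TU inv Y1 Y' by (intro similar_mat_witI[of _ _ n]) (auto simp: Y'_def)
  ultimately have "((D, Y1), (D, Y')) \<in> CM_rel n" by (rule CM_pairs_conj[OF n DY1])
  with rel1 have "((X, Y), (D, Y')) \<in> CM_rel n" by (rule CM_rel_trans)
  moreover have "Y' $$ (i, j) = 1 / (d i - d j)" if ij: "i < n" "j < n" "i \<noteq> j" for i j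
  proof -
    have ne: "d i - d j \<noteq> 0" using d(1) ij by (auto simp: inj_on_def)
    have UY: "U * Y1 \<in> carrier_mat n n" using TU Y1 by simp
    have "Y' $$ (i, j) = 1 / f i * Y1 $$ (i, j) * f j"
      unfolding Y'_def T_def mat_diag_simps(4)[OF UY ij(1,2)] unfolding U_def mat_diag_simps(3)[OF Y1 ij(1,2)] ..
    also have "Y1 $$ (i, j) = f i * g j / (d i - d j)" using fg[OF ij(1,2)] ij(3) ne by (simp add: field_simps)
    finally show ?thesis using f0[OF ij(1)] f1[OF ij(2)] by (simp add: mult.commute)
  qed
  ultimately show ?thesis using Y' by (auto simp: offdiag_normal_def D_def)
qed

context spectral_line
begin

text \<open>The diagonal entry of \<open>Z\<close> is the velocity of the eigenvalue.  For \<open>p = e l\<close> the identity \<open>line_identity\<close>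
  expresses \<open>tr(Q * e l)\<close> at \<open>s\<close> as \<open>- c l s\<close> up to \<open>O(s\<^sup>2)\<close> in both members of the family, with the same
  function \<open>c l\<close>; and the derivative of the left-hand side at \<open>s = 0\<close> is \<open>Q'(l)\<close> times the diagonal entry.\<close>

lemma common_eigenvalue:
  assumes b: "b \<in> I" "b' \<in> I"
    and X_b: "X b = mat_diag n d" "inj_on d {..<n}" "i < n"
    and X_b': "X b' = mat_diag n d'" "inj_on d' {..<n}" "i' < n"
    and l: "d i = l" "d' i' = l"
  shows "Z b $$ (i, i) = Z b' $$ (i', i')"
proof -
  have aux: "poly (LT a (e l)) 0 = 1 \<and> coeff (LT a (Q * e l)) 1 = poly (pderiv Q) l * Z a $$ (k, k)"
    if a: "a \<in> I" "X a = mat_diag n f" "inj_on f {..<n}" "k < n" "f k = l" for a f k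
  proof -
    have sub: "f j \<in> sp 0" if "j < n" for j
    proof -
      have "f j \<in> spectrum (X a)" using spectrum_mat_diag[of n f] a(2) that by auto
      then show ?thesis using a(1) unfolding sp_0 by blast
    qed
    have le: "poly (e l) (f j) = (if j = k then 1 else 0)" if "j < n" for j
    proof -
      have "f j = l \<longleftrightarrow> j = k" using a(3-5) that by (auto simp: inj_on_def)
      then show ?thesis using poly_lagrange[OF finite_sp sub[OF a(4)] sub[OF that]] a(5) by (auto simp: e_def)
    qed
    have "poly (LT a (e l)) 0 = mat_trace (mat_poly n (X a) (e l))"
      using poly_line_trace[OF X[OF a(1)] Z[OF a(1)], of "e l" 0] M_0[OF a(1)] by (simp add: M_def)
    also have "\<dots> = (\<Sum>j<n. poly (e l) (f j))"
      unfolding a(2) mat_poly_mat_diag by (simp add: mat_trace_def mat_diag_def)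
    also have "\<dots> = 1" using a(4) by (simp add: le)
    finally have 1: "poly (LT a (e l)) 0 = 1" .
    have "coeff (LT a (Q * e l)) 1 = mat_trace (mat_diag n (\<lambda>j. poly (pderiv (Q * e l)) (f j)) * Z a)"
      unfolding coeff_line_trace_1[OF X[OF a(1)] Z[OF a(1)]] unfolding a(2) mat_poly_mat_diag ..
    also have "\<dots> = (\<Sum>j<n. poly (pderiv (Q * e l)) (f j) * Z a $$ (j, j))"
      unfolding mat_trace_def using Z[OF a(1)]
      by (intro sum.cong) (auto simp: mat_diag_simps(3) carrier_matD[OF mat_diag_simps(1)] simp del: index_mult_mat(1))
    also have "\<dots> = (\<Sum>j<n. if j = k then poly (pderiv Q) l * Z a $$ (k, k) else 0)"
    proof (intro sum.cong refl)
      fix j assume "j \<in> {..<n}"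
      then have j: "j < n" by simp
      have "poly Q (f j) = 0" using sub[OF j] by (simp add: Q_def poly_root_poly)
      then show "poly (pderiv (Q * e l)) (f j) * Z a $$ (j, j) = (if j = k then poly (pderiv Q) l * Z a $$ (k, k) else 0)"
        using le[OF j] a(5) by (simp add: pderiv_mult)
    qed
    also have "\<dots> = poly (pderiv Q) l * Z a $$ (k, k)" using a(4) by simp
    finally show ?thesis using 1 by simp
  qed
  have "l \<in> spectrum (X b)" using spectrum_mat_diag[of n d] X_b l(1) by auto
  then have lsp: "l \<in> sp 0" using b(1) unfolding sp_0 by blast
  have Q': "poly (pderiv Q) l \<noteq> 0"
  proof -
    define G where "G = root_poly (sp 0 - {l})"
    have "Q = [:- l, 1:] * G"
      unfolding Q_def G_def root_poly_def using lsp by (subst prod.remove[of _ l]) auto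
    then have "pderiv Q = [:- l, 1:] * pderiv G + G * pderiv [:- l, 1:]" by (simp only: pderiv_mult)
    moreover have "poly G l \<noteq> 0" by (simp add: G_def poly_root_poly)
    ultimately show ?thesis by (simp add: pderiv_pCons)
  qed
  let ?D = "\<lambda>k. LT b (e k * e l) - LT b' (e k * e l)"
  let ?f = "LT b (Q * e l) - LT b' (Q * e l)"
  have "poly ?f s = - (\<Sum>k\<in>sp 0. c k s * poly (?D k) s)" for s
    by (simp add: line_identity[OF b(1)] line_identity[OF b(2)] right_diff_distrib sum_subtractf)
  moreover have "(\<lambda>s. - (\<Sum>k\<in>sp 0. c k s * poly (?D k) s)) \<in> O[at 0](\<lambda>s. s ^ 2)"
  proof -
    have "(\<lambda>s. c k s * poly (?D k) s) \<in> O[at 0](\<lambda>s. s ^ 2)" if k: "k \<in> sp 0" for k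
    proof -
      obtain K \<delta> where K: "\<delta> > 0" "\<And>s. norm s < \<delta> \<Longrightarrow> norm (c k s) \<le> K * norm s"
        using c_linear_bound k by blast
      have 1: "c k \<in> O[at 0](\<lambda>s. s)"
        by (rule bigoI[of _ K]) (use K in \<open>auto simp: eventually_at intro!: exI[of _ \<delta>]\<close>)
      have D0: "poly (?D k) 0 = 0"
        using aux[OF b(1) X_b l(1)] aux[OF b(2) X_b' l(2)]
        by (simp add: LT_at_0(2)[OF b(1) k lsp] LT_at_0(2)[OF b(2) k lsp])
      obtain C where C: "\<And>s. norm s \<le> 1 \<Longrightarrow> norm (poly (?D k) s - poly (?D k) 0) \<le> C * norm s"
        using poly_lipschitz_0 by blast
      have 2: "poly (?D k) \<in> O[at 0](\<lambda>s. s)"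
        by (rule bigoI[of _ C]) (use C D0 in \<open>auto simp: eventually_at intro!: exI[of _ 1]\<close>)
      show ?thesis using landau_o.big.mult[OF 1 2] by (simp add: power2_eq_square)
    qed
    then show ?thesis by (simp add: big_sum_in_bigo)
  qed
  ultimately have "poly ?f \<in> O[at 0](\<lambda>s. s ^ 2)" by presburger
  from poly_bigo_coeff[OF this, of 1] have "coeff (LT b (Q * e l)) 1 = coeff (LT b' (Q * e l)) 1" by simp
  then show ?thesis using aux[OF b(1) X_b l(1)] aux[OF b(2) X_b' l(2)] Q' by simp
qed

end

section \<open>Pairs of points with as many eigenvalues as possible\<close>

definition spectra_card :: "(complex mat \<times> complex mat) \<Rightarrow> (complex mat \<times> complex mat) \<Rightarrow> nat" where
  "spectra_card p q = card (spectrum (fst p) \<union> spectrum (fst q))"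

definition spectra_maximal :: "nat \<Rightarrow> (complex mat \<times> complex mat) \<Rightarrow> (complex mat \<times> complex mat) \<Rightarrow> bool" where
  "spectra_maximal n p q \<longleftrightarrow> (\<forall>\<sigma>\<in>autG. spectra_card (subst_pair n \<sigma> p) (subst_pair n \<sigma> q) \<le> spectra_card p q)"

lemma subst_pair_comp:
  assumes "\<sigma> \<in> autG" "\<tau> \<in> autG" "p \<in> CM_pairs n"
  shows "subst_pair n \<sigma> (subst_pair n \<tau> p) = subst_pair n (\<tau> \<circ> \<sigma>) p"
  using eval_mat_subst_pair[OF CM_pairs_carrier[OF assms(3)], of \<tau>] assms(2)
  by (simp add: subst_pair_def[of n _ "subst_pair n \<tau> p"] subst_pair_def[of n "\<tau> \<circ> \<sigma>"] autG_def)

lemma CM_rel_spectrum: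
  assumes "(p, q) \<in> CM_rel n"
  shows "spectrum (fst p) = spectrum (fst q)"
proof -
  obtain P Q where "similar_mat_wit (fst q) (fst p) P Q" using assms by (auto simp: CM_rel_def)
  then show ?thesis using spectrum_similar CM_pairs_carrier(1)[OF CM_rel_pairs(1)[OF assms]] by metis
qed

lemma spectra_maximal_CM_rel:
  assumes "spectra_maximal n p q" "(p, p') \<in> CM_rel n" "(q, q') \<in> CM_rel n"
  shows "spectra_maximal n p' q'"
  unfolding spectra_maximal_def
proof
  fix \<sigma> assume s: "\<sigma> \<in> autG"
  show "spectra_card (subst_pair n \<sigma> p') (subst_pair n \<sigma> q') \<le> spectra_card p' q'"
    using assms(1) s CM_rel_spectrum[OF assms(2)] CM_rel_spectrum[OF assms(3)]
      CM_rel_spectrum[OF CM_rel_subst_pair[OF s assms(2)]] CM_rel_spectrum[OF CM_rel_subst_pair[OF s assms(3)]]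
    by (auto simp: spectra_maximal_def spectra_card_def)
qed

lemma spectra_maximal_ex:
  assumes "p \<in> CM_pairs n" "q \<in> CM_pairs n"
  shows "\<exists>\<tau>\<in>autG. spectra_maximal n (subst_pair n \<tau> p) (subst_pair n \<tau> q)"
proof -
  let ?f = "\<lambda>\<tau>. spectra_card (subst_pair n \<tau> p) (subst_pair n \<tau> q)"
  have "?f \<tau> \<le> 2 * n" if "\<tau> \<in> autG" for \<tau>
  proof -
    have "card (spectrum (fst (subst_pair n \<tau> p))) \<le> n" "card (spectrum (fst (subst_pair n \<tau> q))) \<le> n"
      using card_finite_spectrum(2)[OF CM_pairs_carrier(1)[OF subst_pair_CM_pairs[OF that]]] assms by auto
    then show ?thesis unfolding spectra_card_def by (intro order.trans[OF card_Un_le]) auto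
  qed
  then have "\<exists>\<tau>. \<tau> \<in> autG \<and> (\<forall>\<sigma>. \<sigma> \<in> autG \<longrightarrow> ?f \<sigma> \<le> ?f \<tau>)"
    by (intro Lattices_Big.ex_has_greatest_nat[where b = "Suc (2 * n)" and k = id]) (auto simp: autG_id less_Suc_eq_le)
  then obtain \<tau> where t: "\<tau> \<in> autG" "\<And>\<sigma>. \<sigma> \<in> autG \<Longrightarrow> ?f \<sigma> \<le> ?f \<tau>" by blast
  have "spectra_maximal n (subst_pair n \<tau> p) (subst_pair n \<tau> q)"
    unfolding spectra_maximal_def using t autG_comp[OF t(1)]
    by (simp add: subst_pair_comp[OF _ t(1) assms(1)] subst_pair_comp[OF _ t(1) assms(2)])
  then show ?thesis using t(1) by blast
qed

lemma subst_pair_two_shears: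
  assumes "XY \<in> CM_pairs n"
  shows "subst_pair n (shear LetterY r \<circ> shear LetterX p) XY =
    (fst XY + mat_poly n (snd XY + mat_poly n (fst XY) r) p, snd XY + mat_poly n (fst XY) r)"
proof -
  note c = CM_pairs_carrier[OF assms]
  have "subst_pair n (shear LetterY r) (fst XY, snd XY) = (fst XY, snd XY + mat_poly n (fst XY) r)"
    by (rule subst_pair_shear(2)[OF c])
  moreover have "subst_pair n (shear LetterX p) (fst XY, snd XY + mat_poly n (fst XY) r) =
      (fst XY + mat_poly n (snd XY + mat_poly n (fst XY) r) p, snd XY + mat_poly n (fst XY) r)"
    by (rule subst_pair_shear(1)) (use c in auto)
  ultimately show ?thesis
    using subst_pair_comp[OF shear_autG shear_autG assms, of LetterX p LetterY r] by simp
qed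

text \<open>The points of the line are images under \<open>y + r(x)\<close> followed by \<open>x + s p(y)\<close>.\<close>

lemma spectra_maximal_line:
  assumes P: "\<And>b. P b \<in> CM_pairs n" and mx: "spectra_maximal n (P True) (P False)"
  shows "spectral_line n (UNIV :: bool set) (\<lambda>b. fst (P b))
    (\<lambda>b. mat_poly n (snd (P b) + mat_poly n (fst (P b)) r) p)"
proof
  let ?Z = "\<lambda>b. mat_poly n (snd (P b) + mat_poly n (fst (P b)) r) p"
  note c = CM_pairs_carrier[OF P]
  show "finite (UNIV :: bool set)" by simp
  show "fst (P b) \<in> carrier_mat n n" for b by (rule c)
  show "?Z b \<in> carrier_mat n n" for b using c by simp
  show "card (\<Union>b\<in>UNIV. spectrum (fst (P b) + s \<cdot>\<^sub>m ?Z b)) \<le> card (\<Union>b\<in>UNIV. spectrum (fst (P b)))" for s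
  proof -
    let ?\<sigma> = "shear LetterY r \<circ> shear LetterX (smult s p)"
    have "?\<sigma> \<in> autG" by (intro autG_comp shear_autG)
    moreover have "fst (subst_pair n ?\<sigma> (P b)) = fst (P b) + s \<cdot>\<^sub>m ?Z b" for b
      using c by (simp add: subst_pair_two_shears[OF P] mat_poly_smult)
    ultimately show ?thesis
      using mx by (auto simp: spectra_maximal_def spectra_card_def UNIV_bool Un_commute)
  qed
qed

lemma CM_pairs_rank1_trace:
  assumes n: "n \<ge> 1" and XY: "(X, Y) \<in> CM_pairs n" and AB: "A \<in> carrier_mat n n" "B \<in> carrier_mat n n"
  shows "mat_trace (cm_defect n X Y * A * (cm_defect n X Y * B)) =
       mat_trace (cm_defect n X Y * A) * mat_trace (cm_defect n X Y * B)"
proof -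
  obtain f g where "\<forall>i<n. \<forall>j<n. cm_defect n X Y $$ (i, j) = f i * g j"
    and c: "X \<in> carrier_mat n n" "Y \<in> carrier_mat n n"
    using XY CM_pairs_iff[OF n] by blast
  moreover have "cm_defect n X Y \<in> carrier_mat n n" using c by (simp add: cm_defect_def)
  ultimately show ?thesis using rank_1_trace[of "cm_defect n X Y" n f g A B] AB by blast
qed

lemma spectra_maximal_simple:
  assumes n: "n \<ge> 1" and P: "\<And>b. P b \<in> CM_pairs n" and mx: "spectra_maximal n (P True) (P False)"
  shows "card (spectrum (fst (P b))) = n"
proof (rule maximal_spectrum_simple[where I = UNIV and X = "\<lambda>b. fst (P b)" and Y = "\<lambda>b. snd (P b)"])
  note c = CM_pairs_carrier[OF P]
  have 0: "snd (P b) + 0\<^sub>m n n = snd (P b)" for b using c by simp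
  show "spectral_line n UNIV (\<lambda>b. fst (P b)) (\<lambda>b. snd (P b))"
    using spectra_maximal_line[OF P mx, of 0 "[:0, 1:]"] c by (simp add: 0 mat_poly_X)
  have "mat_poly n (snd (P b)) [:0, 0, 1:] = snd (P b) * snd (P b)" for b
    using mat_poly_mult[OF c(2), of b "[:0, 1:]" "[:0, 1:]"] c by (simp add: mat_poly_X)
  then show "spectral_line n UNIV (\<lambda>b. fst (P b)) (\<lambda>b. snd (P b) * snd (P b))"
    using spectra_maximal_line[OF P mx, of 0 "[:0, 0, 1:]"] by (simp add: 0)
  show "b \<in> UNIV" by simp
  show "mat_trace (cm_defect n (fst (P b)) (snd (P b)) * A * (cm_defect n (fst (P b)) (snd (P b)) * B)) =
     mat_trace (cm_defect n (fst (P b)) (snd (P b)) * A) * mat_trace (cm_defect n (fst (P b)) (snd (P b)) * B)"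
    if "A \<in> carrier_mat n n" "B \<in> carrier_mat n n" for A B
    using CM_pairs_rank1_trace[OF n _ that, of "fst (P b)" "snd (P b)"] P[of b] by simp
qed

text \<open>Since \<open>r\<close> vanishes at \<open>i\<close>, row and column \<open>i\<close> of \<open>Y + D\<close> are those of \<open>Y\<close>, so only the middle factor of
  the cube sees \<open>D\<close>.\<close>

lemma cube_diag_entry:
  fixes Y D :: "complex mat"
  assumes Y: "Y \<in> carrier_mat n n" and i: "i < n" "r i = 0"
  shows "mat_poly n (Y + mat_diag n r) [:0, 0, 0, 1:] $$ (i, i) =
    mat_poly n (Y + 0\<^sub>m n n) [:0, 0, 0, 1:] $$ (i, i) + (\<Sum>k<n. Y $$ (i, k) * r k * Y $$ (k, i))"
proof -
  have cube: "mat_poly n W [:0, 0, 0, 1:] $$ (i, i) = (\<Sum>k<n. \<Sum>l<n. W $$ (i, k) * (W $$ (k, l) * W $$ (l, i)))"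
    if W: "W \<in> carrier_mat n n" for W
  proof -
    have "mat_poly n W [:0, 0, 0, 1:] = W * (W * W)"
      using mat_poly_mult[OF W, of "[:0, 1:]" "[:0, 1:]"] mat_poly_mult[OF W, of "[:0, 1:]" "[:0, 0, 1:]"]
      by (simp add: mat_poly_X[OF W])
    then show ?thesis
      using W i(1) by (simp add: square_mult_entry[of W n] sum_distrib_left del: index_mult_mat(1))
  qed
  let ?W = "Y + mat_diag n r"
  have W: "?W \<in> carrier_mat n n" using Y mat_diag_simps(1) by simp
  have ent: "?W $$ (k, l) = Y $$ (k, l) + (if k = l then r l else 0)" if "k < n" "l < n" for k l
    using that Y by (simp add: mat_diag_simps(2) carrier_matD[OF mat_diag_simps(1)])
  have "mat_poly n ?W [:0, 0, 0, 1:] $$ (i, i) =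
      (\<Sum>k<n. \<Sum>l<n. Y $$ (i, k) * ((Y $$ (k, l) + (if k = l then r l else 0)) * Y $$ (l, i)))"
    unfolding cube[OF W] using i by (intro sum.cong refl) (auto simp: ent)
  also have "\<dots> = (\<Sum>k<n. \<Sum>l<n. Y $$ (i, k) * (Y $$ (k, l) * Y $$ (l, i)) + (if k = l then Y $$ (i, l) * r l * Y $$ (l, i) else 0))"
    by (intro sum.cong refl) (auto simp: algebra_simps)
  also have "\<dots> = (\<Sum>k<n. \<Sum>l<n. Y $$ (i, k) * (Y $$ (k, l) * Y $$ (l, i))) + (\<Sum>k<n. Y $$ (i, k) * r k * Y $$ (k, i))"
    by (simp add: sum.distrib)
  finally show ?thesis using cube[OF Y] Y by simp
qed

lemma normal_common_eigenvalue:
  assumes P: "\<And>b. (mat_diag n (d b), Y b) \<in> CM_pairs n"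
    and mx: "spectra_maximal n (mat_diag n (d True), Y True) (mat_diag n (d False), Y False)"
    and d: "\<And>b. inj_on (d b) {..<n}" and i: "i < n" "i' < n" "d True i = d False i'"
  shows "Y True $$ (i, i) = Y False $$ (i', i')"
    and "poly r (d True i) = 0 \<Longrightarrow>
      (\<Sum>k<n. Y True $$ (i, k) * poly r (d True k) * Y True $$ (k, i)) =
      (\<Sum>k<n. Y False $$ (i', k) * poly r (d False k) * Y False $$ (k, i'))"
proof -
  define Pr where "Pr b = (mat_diag n (d b), Y b)" for b
  have Pr: "Pr b \<in> CM_pairs n" for b using P by (simp add: Pr_def)
  have mx': "spectra_maximal n (Pr True) (Pr False)" using mx by (simp add: Pr_def)
  have Yc: "Y b \<in> carrier_mat n n" for b using CM_pairs_carrier(2)[OF P] by simp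
  have eq: "mat_poly n (Y True + mat_diag n (\<lambda>k. poly r (d True k))) p $$ (i, i) =
      mat_poly n (Y False + mat_diag n (\<lambda>k. poly r (d False k))) p $$ (i', i')" for r p
  proof -
    interpret spectral_line n UNIV "\<lambda>b. fst (Pr b)" "\<lambda>b. mat_poly n (snd (Pr b) + mat_poly n (fst (Pr b)) r) p"
      by (rule spectra_maximal_line[OF Pr mx'])
    have "mat_poly n (snd (Pr True) + mat_poly n (fst (Pr True)) r) p $$ (i, i) =
        mat_poly n (snd (Pr False) + mat_poly n (fst (Pr False)) r) p $$ (i', i')"
      by (rule common_eigenvalue[of True False "d True" i "d False" i' "d True i"])
        (use d i in \<open>auto simp: Pr_def\<close>)
    then show ?thesis by (simp add: Pr_def mat_poly_mat_diag)
  qed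
  have z: "mat_diag n (\<lambda>k. 0) = (0\<^sub>m n n :: complex mat)" by (auto simp: mat_diag_def)
  show "Y True $$ (i, i) = Y False $$ (i', i')"
    using eq[of 0 "[:0, 1:]"] Yc by (simp add: z mat_poly_X)
  show "(\<Sum>k<n. Y True $$ (i, k) * poly r (d True k) * Y True $$ (k, i)) =
      (\<Sum>k<n. Y False $$ (i', k) * poly r (d False k) * Y False $$ (k, i'))" if "poly r (d True i) = 0"
    using eq[of r "[:0, 0, 0, 1:]"] eq[of 0 "[:0, 0, 0, 1:]"] that i
      cube_diag_entry[OF Yc[of True] i(1), of "\<lambda>k. poly r (d True k)"]
      cube_diag_entry[OF Yc[of False] i(2), of "\<lambda>k. poly r (d False k)"]
    by (simp add: z)
qed

lemma enumerate_spectrum: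
  assumes "X \<in> carrier_mat n n" "card (spectrum X) = n"
  obtains d :: "nat \<Rightarrow> complex" where "inj_on d {..<n}" "d ` {..<n} = spectrum X"
proof -
  have "finite (spectrum X)" using card_finite_spectrum[OF assms(1)] by simp
  from ex_bij_betw_nat_finite[OF this] show ?thesis
    using that assms(2) by (auto simp: bij_betw_def atLeast0LessThan)
qed

text \<open>If \<open>a\<close> were an eigenvalue of the first matrix only, take for \<open>r\<close> the Lagrange polynomial of \<open>a\<close> on the
  joint spectrum: the sums in \<open>normal_common_eigenvalue\<close> reduce to \<open>- 1 / (l - a)\<^sup>2\<close> and \<open>0\<close>.\<close>

lemma spectra_maximal_common_subset:
  assumes n: "n \<ge> 1" and P: "\<And>b. P b \<in> CM_pairs n" and mx: "spectra_maximal n (P True) (P False)"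
    and l: "l \<in> spectrum (fst (P True))" "l \<in> spectrum (fst (P False))"
  shows "spectrum (fst (P True)) \<subseteq> spectrum (fst (P False))"
proof
  fix a assume a: "a \<in> spectrum (fst (P True))"
  note c = CM_pairs_carrier[OF P] and simple = spectra_maximal_simple[OF n P mx]
  have "\<exists>d Y. inj_on d {..<n} \<and> d ` {..<n} = spectrum (fst (P b)) \<and>
     (P b, (mat_diag n d, Y)) \<in> CM_rel n \<and> offdiag_normal n d Y" for b
  proof -
    obtain d where d: "inj_on d {..<n}" "d ` {..<n} = spectrum (fst (P b))"
      using enumerate_spectrum[OF c(1) simple] .
    have "(fst (P b), snd (P b)) \<in> CM_pairs n" using P by simp
    from CM_normal_form[OF n this d] d show ?thesis by auto
  qed
  then obtain d Y where d: "\<And>b. inj_on (d b) {..<n}" "\<And>b. d b ` {..<n} = spectrum (fst (P b))"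
    and rel: "\<And>b. (P b, (mat_diag n (d b), Y b)) \<in> CM_rel n" and Y: "\<And>b. offdiag_normal n (d b) (Y b)" by metis
  have mx': "spectra_maximal n (mat_diag n (d True), Y True) (mat_diag n (d False), Y False)"
    by (rule spectra_maximal_CM_rel[OF mx rel rel])
  obtain i i' j where i: "i < n" "i' < n" "j < n" "d True i = l" "d False i' = l" "d True j = a"
  proof -
    have "l \<in> d True ` {..<n}" "l \<in> d False ` {..<n}" "a \<in> d True ` {..<n}" using l a by (simp_all add: d(2))
    then show ?thesis using that by auto
  qed
  show "a \<in> spectrum (fst (P False))"
  proof (rule ccontr)
    assume na: "a \<notin> spectrum (fst (P False))"
    let ?A = "spectrum (fst (P True)) \<union> spectrum (fst (P False))"
    have fin: "finite ?A" using card_finite_spectrum(1)[OF c(1)] by blast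
    define r where "r = lagrange ?A a"
    have r: "poly r x = (if x = a then 1 else 0)" if "x \<in> ?A" for x
      using poly_lagrange[OF fin _ that, of a] a by (auto simp: r_def)
    have la: "l \<noteq> a" using l na by auto
    then have ij: "i \<noteq> j" using i by auto
    have "(\<Sum>k<n. Y True $$ (i, k) * poly r (d True k) * Y True $$ (k, i)) =
      (\<Sum>k<n. Y False $$ (i', k) * poly r (d False k) * Y False $$ (k, i'))"
      by (rule normal_common_eigenvalue(2)[OF CM_rel_pairs(2)[OF rel] mx' d(1)]) (use i l la r in auto)
    moreover have "(\<Sum>k<n. Y False $$ (i', k) * poly r (d False k) * Y False $$ (k, i')) = 0"
    proof (rule sum.neutral, rule ballI)
      fix k assume "k \<in> {..<n}"
      then have "d False k \<in> spectrum (fst (P False))" using d(2) by auto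
      then have "poly r (d False k) = 0" using r na by auto
      then show "Y False $$ (i', k) * poly r (d False k) * Y False $$ (k, i') = 0" by simp
    qed
    moreover have "(\<Sum>k<n. Y True $$ (i, k) * poly r (d True k) * Y True $$ (k, i)) =
        (\<Sum>k<n. if k = j then Y True $$ (i, j) * Y True $$ (j, i) else 0)"
    proof (intro sum.cong refl)
      fix k assume "k \<in> {..<n}"
      then have k: "k < n" by simp
      have "d True k \<in> ?A" using d(2) k by auto
      moreover have "d True k = a \<longleftrightarrow> k = j" using d(1)[of True] i k by (auto simp: inj_on_def)
      ultimately show "Y True $$ (i, k) * poly r (d True k) * Y True $$ (k, i) =
          (if k = j then Y True $$ (i, j) * Y True $$ (j, i) else 0)" using r by auto
    qed
    ultimately have "Y True $$ (i, j) * Y True $$ (j, i) = 0" using i(3) by simp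
    then show False using Y[of True] i ij la by (auto simp: offdiag_normal_def)
  qed
qed

lemma normal_form_unique:
  assumes "offdiag_normal n d Y" "offdiag_normal n d Y'" "\<And>i. i < n \<Longrightarrow> Y $$ (i, i) = Y' $$ (i, i)"
  shows "Y = Y'"
  using assms by (intro eq_matI) (auto simp: offdiag_normal_def, metis)

text \<open>With one common eigenvalue the whole spectra agree, and then so do the free diagonals of the two
  normal forms.\<close>

lemma spectra_maximal_disjoint:
  assumes n: "n \<ge> 1" and P: "\<And>b. P b \<in> CM_pairs n" and mx: "spectra_maximal n (P True) (P False)"
    and ne: "(P True, P False) \<notin> CM_rel n"
  shows "spectrum (fst (P True)) \<inter> spectrum (fst (P False)) = {}"
proof (rule ccontr)
  assume "\<not> ?thesis"
  then obtain l where l: "l \<in> spectrum (fst (P True))" "l \<in> spectrum (fst (P False))" by blast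
  note c = CM_pairs_carrier[OF P] and simple = spectra_maximal_simple[OF n P mx]
  have "spectrum (fst (P True)) = spectrum (fst (P False))"
    using spectra_maximal_common_subset[OF n P mx l] simple card_finite_spectrum(1)[OF c(1)]
    by (intro card_subset_eq) auto
  then have sp: "spectrum (fst (P b)) = spectrum (fst (P True))" for b by (cases b) auto
  obtain d where d: "inj_on d {..<n}" "d ` {..<n} = spectrum (fst (P True))"
    using enumerate_spectrum[OF c(1) simple] .
  have "\<exists>Y. (P b, (mat_diag n d, Y)) \<in> CM_rel n \<and> offdiag_normal n d Y" for b
    using CM_normal_form[OF n _ d(1), of "fst (P b)" "snd (P b)"] P[of b] d(2) sp[of b] by simp
  then obtain Y where rel: "\<And>b. (P b, (mat_diag n d, Y b)) \<in> CM_rel n" and Y: "\<And>b. offdiag_normal n d (Y b)" by metis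
  have mx': "spectra_maximal n (mat_diag n d, Y True) (mat_diag n d, Y False)"
    by (rule spectra_maximal_CM_rel[OF mx rel rel])
  have "Y True = Y False"
  proof (rule normal_form_unique[OF Y Y])
    show "Y True $$ (i, i) = Y False $$ (i, i)" if "i < n" for i
      by (rule normal_common_eigenvalue(1)[where d = "\<lambda>_. d", OF CM_rel_pairs(2)[OF rel] mx' d(1) that that refl])
  qed
  then have "(P True, P False) \<in> CM_rel n"
    using CM_rel_trans[OF rel[of True] CM_rel_sym[OF rel[of False, folded \<open>Y True = Y False\<close>]]] by simp
  with ne show False by simp
qed

section \<open>The base point\<close>

text \<open>Multiplication by \<open>x\<close> in the basis \<open>x\<^sup>i / i!\<close> of the polynomials of degree below \<open>n\<close>, with \<open>x\<^sup>n\<close> set to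
  zero; \<open>lower_mat\<close> is the derivative in the same basis.\<close>

definition raise_mat :: "nat \<Rightarrow> complex mat" where
  "raise_mat n = mat n n (\<lambda>(i, j). if i = Suc j then of_nat i else 0)"

definition lower_mat :: "nat \<Rightarrow> complex mat" where
  "lower_mat n = mat n n (\<lambda>(i, j). if j = Suc i then 1 else 0)"

lemma base_carrier [simp]: "raise_mat n \<in> carrier_mat n n" "lower_mat n \<in> carrier_mat n n"
  by (auto simp: raise_mat_def lower_mat_def)

lemma lower_mat_mult_entry:
  assumes A: "A \<in> carrier_mat n n" and ij: "i < n" "j < n"
  shows "(lower_mat n * A) $$ (i, j) = (if Suc i < n then A $$ (Suc i, j) else 0)"
proof -
  have "(lower_mat n * A) $$ (i, j) = (\<Sum>k<n. if k = Suc i then A $$ (Suc i, j) else 0)"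
    unfolding square_mult_entry[OF base_carrier(2) A ij]
    by (intro sum.cong refl) (use ij in \<open>auto simp: lower_mat_def\<close>)
  then show ?thesis by simp
qed

lemma mult_lower_mat_entry:
  assumes A: "A \<in> carrier_mat n n" and ij: "i < n" "j < n"
  shows "(A * lower_mat n) $$ (i, j) = (if j = 0 then 0 else A $$ (i, j - 1))"
proof -
  have "(A * lower_mat n) $$ (i, j) = (\<Sum>k<n. if k = j - 1 then (if j = 0 then 0 else A $$ (i, j - 1)) else 0)"
    unfolding square_mult_entry[OF A base_carrier(2) ij]
    by (intro sum.cong refl) (use ij in \<open>auto simp: lower_mat_def\<close>)
  then show ?thesis using ij by simp
qed

text \<open>The relation \<open>[x, d/dx] = - 1\<close> fails only in the top degree, because of the truncation.\<close>

lemma base_CM_pairs: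
  assumes n: "n \<ge> 1"
  shows "(raise_mat n, lower_mat n + c \<cdot>\<^sub>m 1\<^sub>m n) \<in> CM_pairs n"
proof -
  let ?X = "raise_mat n" and ?Y = "lower_mat n"
  have "cm_defect n ?X (?Y + c \<cdot>\<^sub>m 1\<^sub>m n) $$ (i, j) = (if Suc i = n then of_nat n else 0) * (if Suc j = n then 1 else 0)"
    if ij: "i < n" "j < n" for i j
  proof -
    have "cm_defect n ?X (?Y + c \<cdot>\<^sub>m 1\<^sub>m n) = ?X * ?Y + c \<cdot>\<^sub>m ?X - (?Y * ?X + c \<cdot>\<^sub>m ?X) + 1\<^sub>m n"
      unfolding cm_defect_def by (simp add: square_simps[where n=n])
    then have "cm_defect n ?X (?Y + c \<cdot>\<^sub>m 1\<^sub>m n) $$ (i, j) =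
        (?X * ?Y) $$ (i, j) - (?Y * ?X) $$ (i, j) + (if i = j then 1 else 0)"
      using ij by (simp add: carrier_matD[OF base_carrier(1)] carrier_matD[OF base_carrier(2)] del: index_mult_mat(1))
    also have "\<dots> = (if Suc i = n then of_nat n else 0) * (if Suc j = n then 1 else 0)"
      unfolding mult_lower_mat_entry[OF base_carrier(1) ij] lower_mat_mult_entry[OF base_carrier(1) ij]
      using ij by (cases j) (auto simp: raise_mat_def)
    finally show ?thesis .
  qed
  moreover have "?Y + c \<cdot>\<^sub>m 1\<^sub>m n \<in> carrier_mat n n" by simp
  ultimately show ?thesis
    unfolding CM_pairs_iff[OF n]
    by (intro conjI exI[of _ "\<lambda>i. if Suc i = n then of_nat n else 0"] exI[of _ "\<lambda>j. if Suc j = n then 1 else 0"]) auto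
qed

lemma mat_poly_lower_mat:
  assumes "i < n" "j < n"
  shows "mat_poly n (lower_mat n) p $$ (i, j) = (if i \<le> j then coeff p (j - i) else 0)"
  using assms
proof (induction p arbitrary: i j)
  case (pCons a p)
  have c: "mat_poly n (lower_mat n) p \<in> carrier_mat n n" by simp
  have "mat_poly n (lower_mat n) (pCons a p) $$ (i, j) = (if i = j then a else 0) + (lower_mat n * mat_poly n (lower_mat n) p) $$ (i, j)"
    using pCons.prems c by (simp add: mat_poly_pCons carrier_matD[OF base_carrier(2)] del: index_mult_mat(1))
  also have "\<dots> = (if i \<le> j then coeff (pCons a p) (j - i) else 0)"
  proof (cases "i < j")
    case True
    then have "j - i = Suc (j - Suc i)" by simp
    then show ?thesis unfolding lower_mat_mult_entry[OF c pCons.prems] using True pCons by simp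
  next
    case False
    then show ?thesis unfolding lower_mat_mult_entry[OF c pCons.prems] using pCons by auto
  qed
  finally show ?case .
qed auto

lemma mat_poly_shift:
  fixes A :: "complex mat"
  assumes A: "A \<in> carrier_mat n n"
  shows "mat_poly n (A + c \<cdot>\<^sub>m 1\<^sub>m n) p = mat_poly n A (pcompose p [:c, 1:])"
proof (induction p)
  case (pCons a p)
  have 1: "mat_poly n A [:c, 1:] = A + c \<cdot>\<^sub>m 1\<^sub>m n"
    using A by (simp add: mat_poly_pCons) (intro eq_matI; auto)
  have "A + c \<cdot>\<^sub>m 1\<^sub>m n \<in> carrier_mat n n" using A by simp
  then show ?case
    using A pCons by (simp only: mat_poly_pCons pcompose_pCons mat_poly_add mat_poly_const mat_poly_mult 1)
      (simp add: square_units[where n=n])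
qed simp

lemma mat_poly_lower_mat_monom_mult: "mat_poly n (lower_mat n) (monom 1 n * p) = 0\<^sub>m n n"
  by (rule eq_matI) (auto simp: mat_poly_lower_mat coeff_monom_mult)

text \<open>The two matrices are annihilated by the coprime polynomials \<open>x\<^sup>n\<close> and \<open>(x - 1)\<^sup>n\<close>, so this is the
  Chinese remainder theorem.  An explicit idempotent is \<open>w = (1 - x\<^sup>n)\<^sup>n\<close>, which is \<open>1\<close> modulo \<open>x\<^sup>n\<close> and,
  as \<open>x - 1\<close> divides \<open>1 - x\<^sup>n\<close>, is \<open>0\<close> modulo \<open>(x - 1)\<^sup>n\<close>.\<close>

lemma mat_poly_two_shifts:
  "\<exists>r. mat_poly n (lower_mat n) r = mat_poly n (lower_mat n) p \<and>
       mat_poly n (lower_mat n + 1 \<cdot>\<^sub>m 1\<^sub>m n) r = mat_poly n (lower_mat n) q"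
proof (cases "n = 0")
  case False
  define w where "w = (1 - monom 1 n :: complex poly) ^ n"
  let ?m = "monom 1 n :: complex poly"
  define r where "r = w * p + (1 - w) * pcompose q [:-1, 1:]"
  have "?m dvd 1 - w"
  proof -
    have "?m dvd 1 - (1 - ?m) ^ k" for k
    proof (induction k)
      case (Suc k)
      have "1 - (1 - ?m) ^ Suc k = (1 - (1 - ?m) ^ k) + ?m * (1 - ?m) ^ k" by (simp add: algebra_simps)
      then show ?case using Suc by (simp only: dvd_add_times_triv_right_iff dvd_add dvd_triv_left)
    qed simp
    then show ?thesis by (simp only: w_def)
  qed
  then obtain h where h: "1 - w = ?m * h" by (elim dvdE)
  have "?m dvd pcompose w [:1, 1:]"
  proof -
    have "poly (1 - pcompose ?m [:1, 1:]) 0 = 0" by (simp add: poly_pcompose poly_monom)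
    then have "[:- 0, 1:] dvd 1 - pcompose ?m [:1, 1:]" by (rule iffD1[OF poly_eq_0_iff_dvd])
    then have "[:0, 1:] dvd 1 - pcompose ?m [:1, 1:]" by (simp only: minus_zero)
    then have "[:0, 1:] ^ n dvd (1 - pcompose ?m [:1, 1:]) ^ n" by (rule dvd_power_same)
    moreover have "[:0, 1:] ^ n = ?m" by (simp add: monom_altdef)
    moreover have "pcompose ((1 - ?m) ^ k) [:1, 1:] = (1 - pcompose ?m [:1, 1:]) ^ k" for k
      by (induction k) (simp_all add: pcompose_1 pcompose_mult pcompose_diff)
    ultimately show ?thesis by (simp only: w_def)
  qed
  then obtain k where k: "pcompose w [:1, 1:] = ?m * k" by (elim dvdE)
  have "r = p + ?m * (h * (pcompose q [:-1, 1:] - p))"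
    unfolding r_def mult.assoc[symmetric] h[symmetric] by (simp add: algebra_simps)
  then have 1: "mat_poly n (lower_mat n) r = mat_poly n (lower_mat n) p"
    by (simp only: mat_poly_add[OF base_carrier(2)] mat_poly_lower_mat_monom_mult) simp
  have "pcompose (pcompose q [:-1, 1:]) [:1, 1:] = q"
    by (simp add: pcompose_assoc[symmetric] pcompose_pCons pcompose_idR)
  then have "pcompose r [:1, 1:] = q + ?m * (k * (pcompose p [:1, 1:] - q))"
    unfolding mult.assoc[symmetric] k[symmetric] by (simp add: r_def pcompose_add pcompose_mult pcompose_diff pcompose_1 algebra_simps)
  then have "mat_poly n (lower_mat n) (pcompose r [:1, 1:]) = mat_poly n (lower_mat n) q"
    by (simp only: mat_poly_add[OF base_carrier(2)] mat_poly_lower_mat_monom_mult) simp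
  then have "mat_poly n (lower_mat n + 1 \<cdot>\<^sub>m 1\<^sub>m n) r = mat_poly n (lower_mat n) q"
    by (simp only: mat_poly_shift[OF base_carrier(2)])
  with 1 show ?thesis by blast
qed (auto intro!: eq_matI)

lemma spectrum_transpose:
  fixes A :: "complex mat"
  assumes "A \<in> carrier_mat n n"
  shows "spectrum (transpose_mat A) = spectrum A"
  using assms by (simp add: spectrum_root_char_poly[of _ n] char_poly_transpose_mat)

text \<open>A row vector \<open>L\<close> is a left eigenvector of \<open>raise_mat n + p(lower_mat n)\<close> for the eigenvalue \<open>a\<close> iff
  its generating function solves \<open>L' + p L = a L\<close> up to order \<open>n\<close> and \<open>L\<^sub>n = 0\<close>.  The solutions are
  \<open>L = g exp(a y)\<close> with \<open>p = - g' / g\<close>, and the coefficient of \<open>y\<^sup>n\<close> in \<open>L\<close> is a polynomial in \<open>a\<close> whose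
  coefficients are those of \<open>g\<close> up to factorials.  Choose \<open>g\<close> such that this polynomial is
  \<open>root_poly A / n!\<close>; then every element of \<open>A\<close> is an eigenvalue.\<close>

lemma spectrum_base_shear:
  assumes A: "finite A" "card A = n"
  shows "\<exists>p. spectrum (raise_mat n + mat_poly n (lower_mat n) p) = A"
proof -
  define g :: "complex fps" where "g = Abs_fps (\<lambda>k. if k \<le> n then coeff (root_poly A) (n - k) * fact (n - k) / fact n else 0)"
  have deg: "degree (root_poly A) = n" using A by (simp add: degree_root_poly)
  have g0: "fps_nth g 0 = 1" using monic_root_poly[of A] deg by (simp add: g_def)
  \<comment> \<open>only the terms of \<open>u\<close> below order \<open>n\<close> matter, so \<open>u\<close> may be cut off to a polynomial\<close>
  define u where "u = - fps_deriv g * inverse g"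
  define p where "p = (\<Sum>k<n. monom (fps_nth u k) k)"
  have p: "coeff p k = fps_nth u k" if "k < n" for k
    using that by (simp add: p_def coeff_sum)
  let ?M = "raise_mat n + mat_poly n (lower_mat n) p"
  have M: "?M \<in> carrier_mat n n" by simp
  have "a \<in> spectrum (transpose_mat ?M)" if a: "a \<in> A" for a
  proof -
    define L where "L = g * fps_exp a"
    have "u * L = - fps_deriv g * (inverse g * g) * fps_exp a" by (simp add: u_def L_def mult_ac)
    then have "u * L = - fps_deriv g * fps_exp a" using g0 by (simp add: inverse_mult_eq_1)
    then have ode: "fps_deriv L + u * L = fps_const a * L" by (simp add: L_def mult_ac)
    have rec: "of_nat (Suc i) * fps_nth L (Suc i) + (\<Sum>k\<le>i. fps_nth u k * fps_nth L (i - k)) = a * fps_nth L i" for i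
    proof -
      have "fps_nth (fps_deriv L + u * L) i = fps_nth (fps_const a * L) i" by (simp only: ode)
      then show ?thesis by (simp add: fps_mult_nth[of u] atLeast0AtMost)
    qed
    have Ln: "fps_nth L n = 0"
    proof -
      have "fps_nth L n = (\<Sum>k\<le>n. coeff (root_poly A) (n - k) * fact (n - k) / fact n * (a ^ (n - k) / fact (n - k)))"
        by (simp add: L_def fps_mult_nth g_def atLeast0AtMost)
      also have "\<dots> = (\<Sum>k\<le>n. coeff (root_poly A) (n - k) * a ^ (n - k)) / fact n"
        by (simp add: sum_divide_distrib)
      also have "(\<Sum>k\<le>n. coeff (root_poly A) (n - k) * a ^ (n - k)) = (\<Sum>k\<le>n. coeff (root_poly A) k * a ^ k)"
        by (rule sum.reindex_bij_witness[of _ "\<lambda>k. n - k" "\<lambda>k. n - k"]) auto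
      also have "\<dots> = poly (root_poly A) a" by (simp add: poly_altdef deg)
      also have "\<dots> = 0" using a A by (simp add: poly_root_poly)
      finally show ?thesis by simp
    qed
    define v where "v = vec n (\<lambda>i. fps_nth L i)"
    have "n > 0" using a A card_gt_0_iff by blast
    then have "v $ 0 = 1" using g0 by (simp add: v_def L_def fps_mult_nth)
    then have "v \<noteq> 0\<^sub>v n" using \<open>n > 0\<close> by auto
    moreover have "transpose_mat ?M *\<^sub>v v = a \<cdot>\<^sub>v v"
    proof (rule eq_vecI)
      fix j assume "j < dim_vec (a \<cdot>\<^sub>v v)"
      then have j: "j < n" by (simp add: v_def)
      have ent: "?M $$ (i, j) = (if i = Suc j then of_nat i else 0) + (if i \<le> j then fps_nth u (j - i) else 0)" if "i < n" for i
        using that j by (simp add: mat_poly_lower_mat p) (simp add: raise_mat_def)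
      have "(transpose_mat ?M *\<^sub>v v) $ j = (\<Sum>i<n. ?M $$ (i, j) * fps_nth L i)"
        using j by (simp add: scalar_prod_def atLeast0LessThan v_def)
      also have "\<dots> = (\<Sum>i<n. (if i = Suc j then of_nat (Suc j) * fps_nth L (Suc j) else 0) + (if i \<le> j then fps_nth u (j - i) * fps_nth L i else 0))"
        by (intro sum.cong refl) (auto simp: ent)
      also have "\<dots> = (if Suc j < n then of_nat (Suc j) * fps_nth L (Suc j) else 0) + (\<Sum>i<n. if i \<le> j then fps_nth u (j - i) * fps_nth L i else 0)"
        by (simp add: sum.distrib)
      also have "(if Suc j < n then of_nat (Suc j) * fps_nth L (Suc j) else 0) = of_nat (Suc j) * fps_nth L (Suc j)"
        using Ln j by (cases "Suc j = n") auto
      also have "(\<Sum>i<n. if i \<le> j then fps_nth u (j - i) * fps_nth L i else 0) = (\<Sum>i\<le>j. fps_nth u (j - i) * fps_nth L i)"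
        using j by (intro sum.mono_neutral_cong_right) auto
      also have "\<dots> = (\<Sum>k\<le>j. fps_nth u k * fps_nth L (j - k))"
        by (rule sum.reindex_bij_witness[of _ "\<lambda>k. j - k" "\<lambda>k. j - k"]) auto
      also have "of_nat (Suc j) * fps_nth L (Suc j) + \<dots> = a * fps_nth L j" by (rule rec)
      finally show "(transpose_mat ?M *\<^sub>v v) $ j = (a \<cdot>\<^sub>v v) $ j" using j by (simp add: v_def)
    qed (simp add: v_def)
    ultimately have "eigenvector (transpose_mat ?M) v a"
      using M by (simp add: eigenvector_def v_def)
    then show ?thesis by (auto simp: spectrum_def eigenvalue_def)
  qed
  then have "A \<subseteq> spectrum ?M" using spectrum_transpose[OF M] by blast
  moreover have "finite (spectrum ?M)" "card (spectrum ?M) \<le> n" using card_finite_spectrum[OF M] by auto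
  ultimately have "spectrum ?M = A" using A by (metis card_seteq)
  then show ?thesis by blast
qed

section \<open>Orbits of pairs of points\<close>

text \<open>Two families of representatives describe families of points in one orbit of the diagonal action.\<close>

definition orbit_equiv :: "nat \<Rightarrow> ('b \<Rightarrow> complex mat \<times> complex mat) \<Rightarrow> ('b \<Rightarrow> complex mat \<times> complex mat) \<Rightarrow> bool" where
  "orbit_equiv n P P' \<longleftrightarrow> (\<forall>b. P b \<in> CM_pairs n \<and> P' b \<in> CM_pairs n) \<and>
     (\<exists>\<tau>\<in>autG. \<forall>b. (subst_pair n \<tau> (P b), P' b) \<in> CM_rel n)"

lemma subst_pair_id: "XY \<in> CM_pairs n \<Longrightarrow> subst_pair n id XY = XY"
  using eval_mat_gen[OF CM_pairs_carrier] by (simp add: subst_pair_def)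

lemma subst_pair_inverse:
  assumes "\<tau> \<in> autG" "XY \<in> CM_pairs n"
  shows "subst_pair n (inv_into UNIV \<tau>) (subst_pair n \<tau> XY) = XY"
proof -
  have "surj \<tau>" using assms(1) by (simp add: autG_def algebra_automorphism_def bij_is_surj)
  then have "\<tau> \<circ> inv_into UNIV \<tau> = id" by (auto simp: surj_f_inv_f)
  then show ?thesis
    using subst_pair_comp[OF autG_inv[OF assms(1)] assms] subst_pair_id[OF assms(2)] by simp
qed

lemma orbit_equiv_sym:
  assumes "orbit_equiv n P P'"
  shows "orbit_equiv n P' P"
proof -
  obtain \<tau> where t: "\<tau> \<in> autG" and P: "\<And>b. P b \<in> CM_pairs n" "\<And>b. P' b \<in> CM_pairs n"
    and rel: "\<And>b. (subst_pair n \<tau> (P b), P' b) \<in> CM_rel n"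
    using assms unfolding orbit_equiv_def by blast
  have "(subst_pair n (inv_into UNIV \<tau>) (P' b), P b) \<in> CM_rel n" for b
    using CM_rel_sym[OF CM_rel_subst_pair[OF autG_inv[OF t] rel[of b]]] subst_pair_inverse[OF t P(1)[of b]] by simp
  then show ?thesis unfolding orbit_equiv_def using P autG_inv[OF t] by blast
qed

lemma orbit_equiv_trans:
  assumes "orbit_equiv n P P'" "orbit_equiv n P' P''"
  shows "orbit_equiv n P P''"
proof -
  obtain \<sigma> \<tau> where t: "\<sigma> \<in> autG" "\<tau> \<in> autG" and P: "\<And>b. P b \<in> CM_pairs n" "\<And>b. P'' b \<in> CM_pairs n"
    and rel: "\<And>b. (subst_pair n \<sigma> (P b), P' b) \<in> CM_rel n" "\<And>b. (subst_pair n \<tau> (P' b), P'' b) \<in> CM_rel n"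
    using assms unfolding orbit_equiv_def by blast
  have "(subst_pair n (\<sigma> \<circ> \<tau>) (P b), P'' b) \<in> CM_rel n" for b
    using CM_rel_trans[OF CM_rel_subst_pair[OF t(2) rel(1)] rel(2), of b] subst_pair_comp[OF t(2,1) P(1)] by simp
  then show ?thesis unfolding orbit_equiv_def using P autG_comp[OF t] by blast
qed

lemma orbit_equiv_subst:
  assumes "\<tau> \<in> autG" "\<And>b. P b \<in> CM_pairs n"
  shows "orbit_equiv n P (\<lambda>b. subst_pair n \<tau> (P b))"
  unfolding orbit_equiv_def using assms CM_rel_refl[OF subst_pair_CM_pairs] subst_pair_CM_pairs by blast

definition separated :: "nat \<Rightarrow> (bool \<Rightarrow> complex mat \<times> complex mat) \<Rightarrow> bool" where
  "separated n P \<longleftrightarrow> (\<forall>b. P b \<in> CM_pairs n \<and> card (spectrum (fst (P b))) = n) \<and>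
     spectrum (fst (P True)) \<inter> spectrum (fst (P False)) = {}"

text \<open>The pair with the largest joint spectrum in the orbit is separated.\<close>

lemma orbit_equiv_separated:
  assumes n: "n \<ge> 1" and P: "\<And>b. P b \<in> CM_pairs n" and ne: "(P True, P False) \<notin> CM_rel n"
  shows "\<exists>P'. orbit_equiv n P P' \<and> separated n P'"
proof -
  obtain \<tau> where t: "\<tau> \<in> autG" and mx: "spectra_maximal n (subst_pair n \<tau> (P True)) (subst_pair n \<tau> (P False))"
    using spectra_maximal_ex[OF P P] by blast
  let ?P = "\<lambda>b. subst_pair n \<tau> (P b)"
  have P': "?P b \<in> CM_pairs n" for b by (rule subst_pair_CM_pairs[OF t P])
  have "(?P True, ?P False) \<notin> CM_rel n"
    using CM_rel_subst_pair[OF autG_inv[OF t], of "?P True" "?P False" n] ne subst_pair_inverse[OF t P] by auto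
  then have "separated n ?P"
    unfolding separated_def
    using P' spectra_maximal_simple[OF n, of ?P] spectra_maximal_disjoint[OF n, of ?P] mx by blast
  then show ?thesis using orbit_equiv_subst[OF t, of P] P by blast
qed

text \<open>Bring all points to normal form.  The shear \<open>y + q(x)\<close> adds the values of \<open>q\<close> at the eigenvalues to the
  diagonal of \<open>Y\<close>; as all \<open>2 n\<close> eigenvalues are distinct, \<open>q\<close> can be interpolated.\<close>

lemma separated_same_spectra:
  assumes n: "n \<ge> 1" and P: "separated n P" and P': "\<And>b. P' b \<in> CM_pairs n"
    and sp: "\<And>b. spectrum (fst (P' b)) = spectrum (fst (P b))"
  shows "orbit_equiv n P P'"
proof -
  have Pc: "P b \<in> CM_pairs n" and card: "card (spectrum (fst (P b))) = n"
    and disj: "spectrum (fst (P True)) \<inter> spectrum (fst (P False)) = {}" for b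
    using P by (auto simp: separated_def)
  have "\<exists>d Y Y'. inj_on d {..<n} \<and> d ` {..<n} = spectrum (fst (P b)) \<and>
      (P b, (mat_diag n d, Y)) \<in> CM_rel n \<and> offdiag_normal n d Y \<and>
      (P' b, (mat_diag n d, Y')) \<in> CM_rel n \<and> offdiag_normal n d Y'" for b
  proof -
    obtain d where d: "inj_on d {..<n}" "d ` {..<n} = spectrum (fst (P b))"
      using enumerate_spectrum[OF CM_pairs_carrier(1)[OF Pc] card] .
    have "(fst (P b), snd (P b)) \<in> CM_pairs n" "(fst (P' b), snd (P' b)) \<in> CM_pairs n" using Pc P' by auto
    from CM_normal_form[OF n this(1) d] CM_normal_form[OF n this(2) d(1)] d(2) sp[of b]
    show ?thesis using d by auto
  qed
  then obtain d Y Y' where d: "\<And>b. inj_on (d b) {..<n}" "\<And>b. d b ` {..<n} = spectrum (fst (P b))"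
    and rel: "\<And>b. (P b, (mat_diag n (d b), Y b)) \<in> CM_rel n" "\<And>b. (P' b, (mat_diag n (d b), Y' b)) \<in> CM_rel n"
    and norm: "\<And>b. offdiag_normal n (d b) (Y b)" "\<And>b. offdiag_normal n (d b) (Y' b)" by metis
  let ?A = "spectrum (fst (P True)) \<union> spectrum (fst (P False))"
  have fin: "finite ?A" using card_finite_spectrum(1)[OF CM_pairs_carrier(1)[OF Pc]] by blast
  have dA: "d b i \<in> ?A" if "i < n" for b i using d(2)[of b] that by (cases b) auto
  have d_inj: "d b i = d b' j \<longleftrightarrow> b = b' \<and> i = j" if "i < n" "j < n" for b b' i j
  proof (cases "b = b'")
    case True
    then show ?thesis using d(1)[of b] that by (auto simp: inj_on_def)
  next
    case False
    have "d b i \<in> spectrum (fst (P b))" "d b' j \<in> spectrum (fst (P b'))" using d(2) that by auto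
    then show ?thesis using False disj by (cases b; cases b') auto
  qed
  define q where "q = (\<Sum>(b, i)\<in>UNIV \<times> {..<n}. smult (Y' b $$ (i, i) - Y b $$ (i, i)) (lagrange ?A (d b i)))"
  have q: "poly q (d b i) = Y' b $$ (i, i) - Y b $$ (i, i)" if i: "i < n" for b i
  proof -
    have "poly q (d b i) = (\<Sum>x\<in>UNIV \<times> {..<n}. if x = (b, i) then Y' b $$ (i, i) - Y b $$ (i, i) else 0)"
      unfolding q_def poly_sum
      by (intro sum.cong refl) (use i in \<open>auto simp: poly_lagrange[OF fin dA dA] d_inj split: if_splits\<close>)
    then show ?thesis using i by simp
  qed
  have "(subst_pair n (shear LetterY q) (P b), P' b) \<in> CM_rel n" for b
  proof -
    have Yc: "Y b \<in> carrier_mat n n" "Y' b \<in> carrier_mat n n" using norm by (auto simp: offdiag_normal_def)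
    have "Y b + mat_diag n (\<lambda>i. poly q (d b i)) = Y' b"
    proof (rule eq_matI)
      fix i j assume "i < dim_row (Y' b)" "j < dim_col (Y' b)"
      then have ij: "i < n" "j < n" using Yc by auto
      then show "(Y b + mat_diag n (\<lambda>i. poly q (d b i))) $$ (i, j) = Y' b $$ (i, j)"
        using norm[of b] Yc q[of j b]
        by (auto simp: offdiag_normal_def mat_diag_simps(2) carrier_matD[OF mat_diag_simps(1)])
    qed (use Yc in \<open>auto simp: mat_diag_def\<close>)
    then have "subst_pair n (shear LetterY q) (mat_diag n (d b), Y b) = (mat_diag n (d b), Y' b)"
      using subst_pair_shear(2)[OF mat_diag_simps(1) Yc(1)] by (simp add: mat_poly_mat_diag)
    then have "(subst_pair n (shear LetterY q) (P b), (mat_diag n (d b), Y' b)) \<in> CM_rel n"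
      using CM_rel_subst_pair[OF shear_autG rel(1)] by metis
    then show ?thesis by (rule CM_rel_trans[OF _ CM_rel_sym[OF rel(2)]])
  qed
  then show ?thesis unfolding orbit_equiv_def using Pc P' shear_autG by blast
qed

definition base_pair :: "nat \<Rightarrow> bool \<Rightarrow> complex mat \<times> complex mat" where
  "base_pair n b = (raise_mat n, lower_mat n + (if b then 0 else 1) \<cdot>\<^sub>m 1\<^sub>m n)"

text \<open>Choose one shear \<open>x + r(y)\<close> that gives the first matrices of the base pair the same spectra as those
  of \<open>P\<close>.\<close>

lemma separated_orbit_base_pair:
  assumes n: "n \<ge> 1" and P: "separated n P"
  shows "orbit_equiv n P (base_pair n)"
proof -
  have base: "base_pair n b \<in> CM_pairs n" for b unfolding base_pair_def by (rule base_CM_pairs[OF n])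
  have "\<exists>p. spectrum (raise_mat n + mat_poly n (lower_mat n) p) = spectrum (fst (P b))" for b
  proof (rule spectrum_base_shear)
    have "fst (P b) \<in> carrier_mat n n" using P CM_pairs_carrier(1) by (auto simp: separated_def)
    then show "finite (spectrum (fst (P b)))" by (rule card_finite_spectrum)
    show "card (spectrum (fst (P b))) = n" using P by (auto simp: separated_def)
  qed
  then obtain p where p: "\<And>b. spectrum (raise_mat n + mat_poly n (lower_mat n) (p b)) = spectrum (fst (P b))" by metis
  obtain r where r: "mat_poly n (lower_mat n) r = mat_poly n (lower_mat n) (p True)"
    "mat_poly n (lower_mat n + 1 \<cdot>\<^sub>m 1\<^sub>m n) r = mat_poly n (lower_mat n) (p False)"
    using mat_poly_two_shifts by blast
  have z: "lower_mat n + 0 \<cdot>\<^sub>m 1\<^sub>m n = lower_mat n" by (intro eq_matI) (auto simp: lower_mat_def)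
  let ?B = "\<lambda>b. subst_pair n (shear LetterX r) (base_pair n b)"
  have "fst (?B b) = raise_mat n + mat_poly n (lower_mat n) (p b)" for b
    unfolding base_pair_def using subst_pair_shear(1)[OF base_carrier(1), where p = r and Y = "lower_mat n + (if b then 0 else 1) \<cdot>\<^sub>m 1\<^sub>m n"]
    by (cases b) (simp_all add: r z)
  then have "orbit_equiv n P ?B"
    by (intro separated_same_spectra[OF n P] subst_pair_CM_pairs[OF shear_autG base]) (simp add: p)
  moreover have "orbit_equiv n ?B (base_pair n)"
    by (rule orbit_equiv_sym[OF orbit_equiv_subst[OF shear_autG, of "base_pair n", OF base]])
  ultimately show ?thesis by (rule orbit_equiv_trans)
qed

lemma orbit_equiv_distinct:
  assumes "n \<ge> 1" "\<And>b. P b \<in> CM_pairs n" "\<And>b. P' b \<in> CM_pairs n"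
    and "(P True, P False) \<notin> CM_rel n" "(P' True, P' False) \<notin> CM_rel n"
  shows "orbit_equiv n P P'"
proof -
  have "orbit_equiv n Q (base_pair n)" if "\<And>b. Q b \<in> CM_pairs n" "(Q True, Q False) \<notin> CM_rel n" for Q
    using orbit_equiv_separated[OF assms(1) that] separated_orbit_base_pair[OF assms(1)] orbit_equiv_trans by blast
  from this[OF assms(2,4)] this[OF assms(3,5)] show ?thesis
    using orbit_equiv_trans orbit_equiv_sym by blast
qed

theorem theorem1:
  fixes n :: nat
    and p1 p2 q1 q2 :: "(complex mat \<times> complex mat) set"
  assumes "n \<ge> 1"
    and "p1 \<in> CM_space n" and "p2 \<in> CM_space n" and "p1 \<noteq> p2"
    and "q1 \<in> CM_space n" and "q2 \<in> CM_space n" and "q1 \<noteq> q2"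
  shows "\<exists>g\<in>autG. CM_act n g p1 = q1 \<and> CM_act n g p2 = q2"
proof -
  have rep: "\<exists>P. (\<forall>b. P b \<in> CM_pairs n) \<and> x = CM_rel n `` {P True} \<and> y = CM_rel n `` {P False} \<and>
      (P True, P False) \<notin> CM_rel n" if xy: "x \<in> CM_space n" "y \<in> CM_space n" "x \<noteq> y" for x y
  proof -
    obtain X Y where XY: "X \<in> CM_pairs n" "Y \<in> CM_pairs n" "x = CM_rel n `` {X}" "y = CM_rel n `` {Y}"
      using xy by (auto simp: CM_space_def elim!: quotientE)
    then have "(X, Y) \<notin> CM_rel n" using xy(3) equiv_class_eq[OF equiv_CM_rel] by blast
    then show ?thesis using XY by (intro exI[of _ "\<lambda>b. if b then X else Y"]) auto
  qed
  obtain P where P: "\<And>b. P b \<in> CM_pairs n" "p1 = CM_rel n `` {P True}" "p2 = CM_rel n `` {P False}"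
    "(P True, P False) \<notin> CM_rel n" using rep[OF assms(2-4)] by blast
  obtain P' where P': "\<And>b. P' b \<in> CM_pairs n" "q1 = CM_rel n `` {P' True}" "q2 = CM_rel n `` {P' False}"
    "(P' True, P' False) \<notin> CM_rel n" using rep[OF assms(5-7)] by blast
  have "orbit_equiv n P P'" by (rule orbit_equiv_distinct[OF assms(1) P(1) P'(1) P(4) P'(4)])
  then obtain \<tau> where t: "\<tau> \<in> autG" "\<And>b. (subst_pair n \<tau> (P b), P' b) \<in> CM_rel n"
    unfolding orbit_equiv_def by blast
  \<comment> \<open>a group element acts by substituting its inverse\<close>
  have "bij \<tau>" using t(1) by (simp add: autG_def algebra_automorphism_def)
  then have inv: "inv_into UNIV (inv_into UNIV \<tau>) = \<tau>" by (rule inv_inv_eq)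
  have "CM_act n (inv_into UNIV \<tau>) (CM_rel n `` {P b}) = CM_rel n `` {P' b}" for b
    using CM_act_class[OF autG_inv[OF t(1)] P(1)] equiv_class_eq[OF equiv_CM_rel t(2)] by (simp add: inv)
  then show ?thesis using autG_inv[OF t(1)] P(2,3) P'(2,3) by blast
qed

end
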